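(* Let $u_b\in H^2(0,T;H^{-1/2}(\Gamma_b))$. The solution $\mathbf U$, with $\mathbf U\in L^2(0,T;\mathcal D(\widetilde G))$ and $\frac{d}{dt}\mathbf U\in L^2(0,T;\mathcal H)$, of the problem $$\frac{d^2}{dt^2}(\mathbf U,\widetilde{\mathbf U})_{\mathcal H}+(\widetilde G\,\mathbf U,G\,\widetilde{\mathbf U})_{\mathcal G}=0\quad\forall\,\widetilde{\mathbf U}\in\mathcal D(G),\ \text{in }\mathcal D'(0,T),$$ $$\gamma_{1,b}(\mathbf U)=u_b\ \text{ in }(0,T),\qquad \mathbf U(0)=\tfrac{d}{dt}\mathbf U(0)=0,$$ is unique (i.e. there is at most one such $\mathbf U$).
   Context: Let $d\in\{2,3\}$, $H,g,T>0$. Points of $\mathbb R^d$ are written $(\mathbf x,z)$ with $\mathbf x\in\mathbb R^{d-1}$, and $\mathbf e_z$ is the unit vector along the $z$-axis. Let $z_b\in W^{1,\infty}(\mathbb R^{d-1})$ be such that, for some positive $H_-,R_+$, $0\le z_b(\mathbf x)\le H_-<H$ for all $\mathbf x$ and $\nabla z_b(\mathbf x)=0$ for $|\mathbf x|\ge R_+$. Let $\Omega$ be the domain lying between $z=z_b(\mathbf x)$ and $z=H$, with $\Gamma_s=\{z=H\}$ and $\Gamma_b=\{z=z_b(\mathbf x)\}$ its top and bottom boundaries. Let $\rho_0\in C^1([0,H])$ and $c_0\in C^0([0,H])$ be functions of $z$ only with $0<\rho_-\le\rho_0\le\rho_+$ and $0<c_-\le c_0\le c_+$ for some constants, and assume $N^2:=-\frac{g}{\rho_0}\frac{d\rho_0}{dz}-\frac{g^2}{c_0^2}\ge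 0$; put $N=\sqrt{N^2}$. $\gamma_{1,s}:H(\mathrm{div},\Omega)\to H^{-1/2}(\Gamma_s)$ and $\gamma_{1,b}:H(\mathrm{div},\Omega)\to H^{-1/2}(\Gamma_b)$ are the outward normal traces (extending $\mathbf U\mapsto\mathbf U\cdot\mathbf n$); $H^{-1/2}$ is the dual of $H^{1/2}$. Spaces: $\mathcal H=L^2(\Omega)^d$ with $(\mathbf U,\widetilde{\mathbf U})_{\mathcal H}=\int_\Omega\rho_0\mathbf U\cdot\widetilde{\mathbf U}$; $\mathcal G=L^2(\Omega)\times L^2(\Omega)\times L^2(\Gamma_s)$ with $((\varphi,\psi,\gamma),(\tilde\varphi,\tilde\psi,\tilde\gamma))_{\mathcal G}=\int_\Omega\frac{\rho_0}{c_0^2}\varphi\tilde\varphi+\int_\Omega\rho_0\psi\tilde\psi+\int_{\Gamma_s}\frac{\rho_0}{g}\gamma\tilde\gamma$. Operators: $\mathcal D(\widetilde G)=\{\mathbf U\in H(\mathrm{div},\Omega):\gamma_{1,s}(\mathbf U)\in L^2(\Gamma_s)\}$, $\widetilde G\mathbf U=\big(c_0^2(\nabla\cdot\mathbf U-\frac{g}{c_0^2}\mathbf U\cdot\mathbf e_z),\ N\mathbf U\cdot\mathbf e_z,\ -g\gamma_{1,s}(\mathbf U)\big)^t\in\mathcal G$; $\mathcal D(G)=\{\mathbf U\in\mathcal D(\widetilde G):\gamma_{1,b}(\mathbf U)=0\}$ and $G$ is the restriction of $\widetilde G$ to $\mathcal D(G)$. Both are closed and densely defined operators $\mathcal H\to\mathcal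 G$. Operator domains carry their graph norms. *)

theory Defs
  imports "HOL-Analysis.Analysis"
begin

text \<open>
  Points of \<open>\<real>\<^sup>d\<close> are pairs \<open>(x, z)\<close> of type \<open>(real ^ 'n) \<times> real\<close>, so \<open>d = CARD('n) + 1\<close>.
  Elements of Lebesgue and Sobolev spaces are represented by functions, so that the norms below
  are only seminorms; two functions at distance zero represent the same element.
\<close>

type_synonym 'n pt = "(real ^ 'n) \<times> real"


section \<open>Test functions and Lebesgue spaces\<close>

primrec Ck :: "nat \<Rightarrow> ('a::euclidean_space \<Rightarrow> real) \<Rightarrow> bool" where
  "Ck 0 f \<longleftrightarrow> continuous_on UNIV f"
| "Ck (Suc k) f \<longleftrightarrow> f differentiable_on UNIV \<and>
     (\<forall>b\<in>Basis. Ck k (\<lambda>x. frechet_derivative f (at x) b))"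

definition test_functions :: "'a::euclidean_space set \<Rightarrow> ('a \<Rightarrow> real) set" where
  "test_functions S = {f. (\<forall>k. Ck k f) \<and> (\<exists>K. compact K \<and> K \<subseteq> S \<and> (\<forall>x. x \<notin> K \<longrightarrow> f x = 0))}"

definition grad :: "('a::euclidean_space \<Rightarrow> real) \<Rightarrow> 'a \<Rightarrow> 'a" where
  "grad f x = (\<Sum>b\<in>Basis. frechet_derivative f (at x) b *\<^sub>R b)"

definition L2 :: "'a::euclidean_space set \<Rightarrow> ('a \<Rightarrow> 'b::euclidean_space) set" where
  "L2 S = {f. f \<in> borel_measurable (lebesgue_on S) \<and>
              integrable (lebesgue_on S) (\<lambda>x. (norm (f x))\<^sup>2)}"

definition Linf :: "('a::euclidean_space \<Rightarrow> 'b::euclidean_space) set" where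
  "Linf = {f. f \<in> borel_measurable lebesgue \<and> (\<exists>C. AE x in lebesgue. norm (f x) \<le> C)}"

text \<open>\<open>f\<close> belongs to \<open>W\<^sup>1\<^sup>,\<^sup>\<infinity>\<close> of the whole space and \<open>G\<close> is its weak gradient.\<close>

definition W1inf_with_grad :: "('a::euclidean_space \<Rightarrow> real) \<Rightarrow> ('a \<Rightarrow> 'a) \<Rightarrow> bool" where
  "W1inf_with_grad f G \<longleftrightarrow> f \<in> Linf \<and> G \<in> Linf \<and>
     (\<forall>\<phi>\<in>test_functions UNIV. \<forall>b\<in>Basis.
        (LINT x|lebesgue. f x * (grad \<phi> x \<bullet> b)) = - (LINT x|lebesgue. (G x \<bullet> b) * \<phi> x))"


section \<open>Bochner spaces on \<open>(0,T)\<close>\<close>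

text \<open>
  The value space is a set \<open>S\<close> of functions with the pointwise operations and a seminorm \<open>p\<close> on it.
\<close>

definition step_fun :: "('a \<Rightarrow> 'b::real_vector) set \<Rightarrow> real \<Rightarrow> (real \<Rightarrow> 'a \<Rightarrow> 'b) \<Rightarrow> bool" where
  "step_fun S T s \<longleftrightarrow> finite (s ` {0<..<T}) \<and> s ` {0<..<T} \<subseteq> S \<and>
     (\<forall>v. {t\<in>{0<..<T}. s t = v} \<in> sets lebesgue)"

definition step_integral :: "real \<Rightarrow> (real \<Rightarrow> 'a \<Rightarrow> 'b::real_vector) \<Rightarrow> 'a \<Rightarrow> 'b" where
  "step_integral T s =
     (\<lambda>a. \<Sum>v\<in>s ` {0<..<T}. measure lebesgue {t\<in>{0<..<T}. s t = v} *\<^sub>R v a)"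

definition strongly_measurable ::
  "('a \<Rightarrow> 'b::real_vector) set \<Rightarrow> (('a \<Rightarrow> 'b) \<Rightarrow> real) \<Rightarrow> real \<Rightarrow> (real \<Rightarrow> 'a \<Rightarrow> 'b) \<Rightarrow> bool" where
  "strongly_measurable S p T f \<longleftrightarrow>
     (AE t in lebesgue_on {0<..<T}. f t \<in> S) \<and>
     (\<exists>s. (\<forall>k. step_fun S T (s k)) \<and>
          (AE t in lebesgue_on {0<..<T}. (\<lambda>k::nat. p (\<lambda>a. f t a - s k t a)) \<longlonglongrightarrow> 0))"

text \<open>\<open>w\<close> is the Bochner integral of \<open>f\<close> over \<open>(0,T)\<close>.\<close>

definition has_Bochner_integral_in ::
  "('a \<Rightarrow> 'b::real_vector) set \<Rightarrow> (('a \<Rightarrow> 'b) \<Rightarrow> real) \<Rightarrow> real \<Rightarrow> (real \<Rightarrow> 'a \<Rightarrow> 'b) \<Rightarrow> ('a \<Rightarrow> 'b) \<Rightarrow> bool"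
  where
  "has_Bochner_integral_in S p T f w \<longleftrightarrow> strongly_measurable S p T f \<and> w \<in> S \<and>
     (\<exists>s. (\<forall>k. step_fun S T (s k)) \<and>
          (\<lambda>k::nat. \<integral>\<^sup>+ t. ennreal (p (\<lambda>a. f t a - s k t a)) \<partial>lebesgue_on {0<..<T}) \<longlonglongrightarrow> 0 \<and>
          (\<lambda>k. p (\<lambda>a. step_integral T (s k) a - w a)) \<longlonglongrightarrow> 0)"

definition L2_time ::
  "('a \<Rightarrow> 'b::real_vector) set \<Rightarrow> (('a \<Rightarrow> 'b) \<Rightarrow> real) \<Rightarrow> real \<Rightarrow> (real \<Rightarrow> 'a \<Rightarrow> 'b) set" where
  "L2_time S p T = {u. strongly_measurable S p T u \<and>
                       integrable (lebesgue_on {0<..<T}) (\<lambda>t. (p (u t))\<^sup>2)}"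

text \<open>\<open>v\<close> is the derivative of \<open>u\<close> in the sense of \<open>S\<close>-valued distributions on \<open>(0,T)\<close>.\<close>

definition weak_time_deriv ::
  "('a \<Rightarrow> 'b::real_vector) set \<Rightarrow> (('a \<Rightarrow> 'b) \<Rightarrow> real) \<Rightarrow> real \<Rightarrow>
   (real \<Rightarrow> 'a \<Rightarrow> 'b) \<Rightarrow> (real \<Rightarrow> 'a \<Rightarrow> 'b) \<Rightarrow> bool" where
  "weak_time_deriv S p T u v \<longleftrightarrow>
     (\<forall>\<phi>\<in>test_functions {0<..<T}. \<exists>w.
        has_Bochner_integral_in S p T (\<lambda>t a. deriv \<phi> t *\<^sub>R u t a) w \<and>
        has_Bochner_integral_in S p T (\<lambda>t a. - (\<phi> t *\<^sub>R v t a)) w)"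

definition H2_time ::
  "('a \<Rightarrow> 'b::real_vector) set \<Rightarrow> (('a \<Rightarrow> 'b) \<Rightarrow> real) \<Rightarrow> real \<Rightarrow> (real \<Rightarrow> 'a \<Rightarrow> 'b) set" where
  "H2_time S p T = {u. u \<in> L2_time S p T \<and>
     (\<exists>v\<in>L2_time S p T. \<exists>w\<in>L2_time S p T. weak_time_deriv S p T u v \<and> weak_time_deriv S p T v w)}"

text \<open>\<open>u\<close> has a representative in \<open>C([0,T]; S)\<close>, whose value at time 0 is zero.\<close>

definition zero_at_time_0 ::
  "('a \<Rightarrow> 'b::real_vector) set \<Rightarrow> (('a \<Rightarrow> 'b) \<Rightarrow> real) \<Rightarrow> real \<Rightarrow> (real \<Rightarrow> 'a \<Rightarrow> 'b) \<Rightarrow> bool" where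
  "zero_at_time_0 S p T u \<longleftrightarrow>
     (\<exists>c. (\<forall>t\<in>{0..T}. c t \<in> S) \<and>
          (\<forall>t\<in>{0..T}. ((\<lambda>s. p (\<lambda>a. c s a - c t a)) \<longlongrightarrow> 0) (at t within {0..T})) \<and>
          (AE t in lebesgue_on {0<..<T}. p (\<lambda>a. u t a - c t a) = 0) \<and>
          p (c 0) = 0)"


section \<open>Dual spaces and \<open>H\<^sup>1\<^sup>/\<^sup>2\<close> on graphs\<close>

text \<open>
  Only the values of a functional on \<open>S\<close> matter; boundedness with respect to \<open>p\<close> makes them
  independent of the choice of representatives.
\<close>

definition dual_space ::
  "('a \<Rightarrow> 'b::real_vector) set \<Rightarrow> (('a \<Rightarrow> 'b) \<Rightarrow> real) \<Rightarrow> (('a \<Rightarrow> 'b) \<Rightarrow> real) set" where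
  "dual_space S p = {l.
     (\<forall>u\<in>S. \<forall>v\<in>S. l (\<lambda>a. u a + v a) = l u + l v) \<and>
     (\<forall>u\<in>S. \<forall>r. l (\<lambda>a. r *\<^sub>R u a) = r * l u) \<and>
     (\<exists>C. \<forall>u\<in>S. \<bar>l u\<bar> \<le> C * p u)}"

definition dual_norm ::
  "('a \<Rightarrow> 'b::real_vector) set \<Rightarrow> (('a \<Rightarrow> 'b) \<Rightarrow> real) \<Rightarrow> (('a \<Rightarrow> 'b) \<Rightarrow> real) \<Rightarrow> real" where
  "dual_norm S p l = (SUP u\<in>{u\<in>S. p u \<le> 1}. \<bar>l u\<bar>)"

text \<open>
  Squared Gagliardo--Slobodeckij seminorm of order \<open>1/2\<close> on \<open>\<real>\<^sup>m\<close>, where \<open>m = CARD('n)\<close>: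
  the kernel exponent is \<open>m + 2 \<cdot> (1/2)\<close>.
\<close>

definition slobodeckij :: "(real ^ 'n \<Rightarrow> real) \<Rightarrow> ennreal" where
  "slobodeckij f = (\<integral>\<^sup>+ x. (\<integral>\<^sup>+ y. ennreal ((f x - f y)\<^sup>2 / norm (x - y) ^ (CARD('n) + 1))
                      \<partial>lebesgue) \<partial>lebesgue)"

text \<open>
  \<open>H\<^sup>1\<^sup>/\<^sup>2\<close> of the Lipschitz graph \<open>\<Gamma> = {(x, \<zeta> x)}\<close> is, as usual, defined through the chart
  \<open>x \<mapsto> (x, \<zeta> x)\<close>.  Its elements are functions of the point of which only the values on \<open>\<Gamma>\<close> matter.
\<close>

definition Hhalf :: "(real ^ 'n \<Rightarrow> real) \<Rightarrow> ('n::finite pt \<Rightarrow> real) set" where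
  "Hhalf \<zeta> = {u. (\<lambda>x. u (x, \<zeta> x)) \<in> L2 UNIV \<and> slobodeckij (\<lambda>x. u (x, \<zeta> x)) < \<infinity>}"

definition Hhalf_norm :: "(real ^ 'n \<Rightarrow> real) \<Rightarrow> ('n::finite pt \<Rightarrow> real) \<Rightarrow> real" where
  "Hhalf_norm \<zeta> u = sqrt ((LINT x|lebesgue. (u (x, \<zeta> x))\<^sup>2) +
                          enn2real (slobodeckij (\<lambda>x. u (x, \<zeta> x))))"

abbreviation Hmhalf :: "(real ^ 'n \<Rightarrow> real) \<Rightarrow> (('n::finite pt \<Rightarrow> real) \<Rightarrow> real) set" where
  "Hmhalf \<zeta> \<equiv> dual_space (Hhalf \<zeta>) (Hhalf_norm \<zeta>)"

abbreviation Hmhalf_norm :: "(real ^ 'n \<Rightarrow> real) \<Rightarrow> (('n::finite pt \<Rightarrow> real) \<Rightarrow> real) \<Rightarrow> real" where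
  "Hmhalf_norm \<zeta> \<equiv> dual_norm (Hhalf \<zeta>) (Hhalf_norm \<zeta>)"


section \<open>The domain, \<open>H(div)\<close> and normal traces\<close>

definition Dom :: "real \<Rightarrow> (real ^ 'n \<Rightarrow> real) \<Rightarrow> 'n::finite pt set" where
  "Dom H zb = {(x, z). zb x < z \<and> z < H}"

definition is_weak_div :: "'a::euclidean_space set \<Rightarrow> ('a \<Rightarrow> 'a) \<Rightarrow> ('a \<Rightarrow> real) \<Rightarrow> bool" where
  "is_weak_div S U f \<longleftrightarrow> f \<in> L2 S \<and>
     (\<forall>\<phi>\<in>test_functions S.
        (LINT p|lebesgue_on S. U p \<bullet> grad \<phi> p) = - (LINT p|lebesgue_on S. f p * \<phi> p))"

definition weak_div :: "'a::euclidean_space set \<Rightarrow> ('a \<Rightarrow> 'a) \<Rightarrow> 'a \<Rightarrow> real" where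
  "weak_div S U = (SOME f. is_weak_div S U f)"

definition Hdiv :: "'a::euclidean_space set \<Rightarrow> ('a \<Rightarrow> 'a) set" where
  "Hdiv S = {U \<in> L2 S. \<exists>f. is_weak_div S U f}"

text \<open>
  The outward normal trace of \<open>U\<close> on a part \<open>\<Gamma>\<close> of the boundary is the functional given by
  Green's formula
  \<open>\<langle>U \<cdot> n, \<phi>\<rangle> = \<integral>\<^sub>\<Omega> (U \<cdot> \<nabla>\<phi> + \<phi> div U)\<close>
  for smooth \<open>\<phi>\<close> vanishing near the other part, which is \<open>\<integral>\<^sub>\<Gamma> (U \<cdot> n) \<phi>\<close> when \<open>U\<close> is smooth.  The restrictions of these \<open>\<phi>\<close> are dense in
  \<open>H\<^sup>1\<^sup>/\<^sup>2(\<Gamma>)\<close>, so that the formula determines the trace.  Supports are compact in the half space below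
  the top boundary for the trace on the bottom, and in the region above the bottom boundary for
  the trace on the top.
\<close>

definition green :: "'a::euclidean_space set \<Rightarrow> ('a \<Rightarrow> 'a) \<Rightarrow> ('a \<Rightarrow> real) \<Rightarrow> real" where
  "green S U \<phi> = (LINT p|lebesgue_on S. U p \<bullet> grad \<phi> p + weak_div S U p * \<phi> p)"

definition has_bottom_trace ::
  "real \<Rightarrow> (real ^ 'n \<Rightarrow> real) \<Rightarrow> ('n::finite pt \<Rightarrow> 'n pt) \<Rightarrow> (('n pt \<Rightarrow> real) \<Rightarrow> real) \<Rightarrow> bool" where
  "has_bottom_trace H zb U l \<longleftrightarrow> l \<in> Hmhalf zb \<and>
     (\<forall>\<phi>\<in>test_functions {(x, z). z < H}. l \<phi> = green (Dom H zb) U \<phi>)"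

definition has_top_trace ::
  "real \<Rightarrow> (real ^ 'n \<Rightarrow> real) \<Rightarrow> ('n::finite pt \<Rightarrow> 'n pt) \<Rightarrow> (('n pt \<Rightarrow> real) \<Rightarrow> real) \<Rightarrow> bool" where
  "has_top_trace H zb U l \<longleftrightarrow> l \<in> Hmhalf (\<lambda>x. H) \<and>
     (\<forall>\<phi>\<in>test_functions {(x, z). zb x < z}. l \<phi> = green (Dom H zb) U \<phi>)"

text \<open>
  The top boundary is identified with \<open>\<real>\<^sup>d\<^sup>-\<^sup>1\<close>, and \<open>k \<in> L\<^sup>2\<close> with the functional
  \<open>u \<mapsto> \<integral> k u\<close> of \<open>H\<^sup>-\<^sup>1\<^sup>/\<^sup>2\<close>.
\<close>

definition top_functional :: "real \<Rightarrow> (real ^ 'n \<Rightarrow> real) \<Rightarrow> ('n::finite pt \<Rightarrow> real) \<Rightarrow> real" where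
  "top_functional H k = (\<lambda>u. LINT x|lebesgue. k x * u (x, H))"

definition is_L2_top_trace ::
  "real \<Rightarrow> (real ^ 'n \<Rightarrow> real) \<Rightarrow> ('n::finite pt \<Rightarrow> 'n pt) \<Rightarrow> (real ^ 'n \<Rightarrow> real) \<Rightarrow> bool" where
  "is_L2_top_trace H zb U k \<longleftrightarrow> k \<in> L2 UNIV \<and> has_top_trace H zb U (top_functional H k)"

definition L2_top_trace ::
  "real \<Rightarrow> (real ^ 'n \<Rightarrow> real) \<Rightarrow> ('n::finite pt \<Rightarrow> 'n pt) \<Rightarrow> real ^ 'n \<Rightarrow> real" where
  "L2_top_trace H zb U = (SOME k. is_L2_top_trace H zb U k)"


section \<open>Hilbert spaces and operators\<close>

definition N2 :: "real \<Rightarrow> real \<Rightarrow> (real \<Rightarrow> real) \<Rightarrow> (real \<Rightarrow> real) \<Rightarrow> real \<Rightarrow> real" where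
  "N2 H g rho c z =
     - (g / rho z) * vector_derivative rho (at z within {0..H}) - g\<^sup>2 / (c z)\<^sup>2"

definition inner_H ::
  "real \<Rightarrow> (real ^ 'n \<Rightarrow> real) \<Rightarrow> (real \<Rightarrow> real) \<Rightarrow> ('n::finite pt \<Rightarrow> 'n pt) \<Rightarrow> ('n pt \<Rightarrow> 'n pt) \<Rightarrow> real"
  where
  "inner_H H zb rho U V = (LINT p|lebesgue_on (Dom H zb). rho (snd p) * (U p \<bullet> V p))"

definition norm_H ::
  "real \<Rightarrow> (real ^ 'n \<Rightarrow> real) \<Rightarrow> (real \<Rightarrow> real) \<Rightarrow> ('n::finite pt \<Rightarrow> 'n pt) \<Rightarrow> real" where
  "norm_H H zb rho U = sqrt (inner_H H zb rho U U)"

type_synonym 'n triple = "('n pt \<Rightarrow> real) \<times> ('n pt \<Rightarrow> real) \<times> (real ^ 'n \<Rightarrow> real)"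

definition inner_G ::
  "real \<Rightarrow> real \<Rightarrow> (real ^ 'n \<Rightarrow> real) \<Rightarrow> (real \<Rightarrow> real) \<Rightarrow> (real \<Rightarrow> real) \<Rightarrow>
   'n::finite triple \<Rightarrow> 'n triple \<Rightarrow> real" where
  "inner_G H g zb rho c = (\<lambda>(\<phi>, \<psi>, \<gamma>) (\<phi>', \<psi>', \<gamma>').
     (LINT p|lebesgue_on (Dom H zb). rho (snd p) / (c (snd p))\<^sup>2 * \<phi> p * \<phi>' p) +
     (LINT p|lebesgue_on (Dom H zb). rho (snd p) * \<psi> p * \<psi>' p) +
     (LINT x|lebesgue. rho H / g * \<gamma> x * \<gamma>' x))"

definition dom_Gt :: "real \<Rightarrow> (real ^ 'n \<Rightarrow> real) \<Rightarrow> ('n::finite pt \<Rightarrow> 'n pt) set" where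
  "dom_Gt H zb = {U \<in> Hdiv (Dom H zb). \<exists>k. is_L2_top_trace H zb U k}"

definition Gt ::
  "real \<Rightarrow> real \<Rightarrow> (real ^ 'n \<Rightarrow> real) \<Rightarrow> (real \<Rightarrow> real) \<Rightarrow> (real \<Rightarrow> real) \<Rightarrow>
   ('n::finite pt \<Rightarrow> 'n pt) \<Rightarrow> 'n triple" where
  "Gt H g zb rho c U =
     (\<lambda>p. (c (snd p))\<^sup>2 * (weak_div (Dom H zb) U p - g / (c (snd p))\<^sup>2 * snd (U p)),
      \<lambda>p. sqrt (N2 H g rho c (snd p)) * snd (U p),
      \<lambda>x. - g * L2_top_trace H zb U x)"

text \<open>The operator \<open>G\<close> is the restriction of \<open>Gt\<close> to this domain.\<close>

definition dom_G :: "real \<Rightarrow> (real ^ 'n \<Rightarrow> real) \<Rightarrow> ('n::finite pt \<Rightarrow> 'n pt) set" where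
  "dom_G H zb = {U \<in> dom_Gt H zb. has_bottom_trace H zb U (\<lambda>u. 0)}"

definition graph_norm ::
  "real \<Rightarrow> real \<Rightarrow> (real ^ 'n \<Rightarrow> real) \<Rightarrow> (real \<Rightarrow> real) \<Rightarrow> (real \<Rightarrow> real) \<Rightarrow>
   ('n::finite pt \<Rightarrow> 'n pt) \<Rightarrow> real" where
  "graph_norm H g zb rho c U =
     sqrt (inner_H H zb rho U U + inner_G H g zb rho c (Gt H g zb rho c U) (Gt H g zb rho c U))"


section \<open>The evolution problem\<close>

text \<open>
  The velocity \<open>V = dU/dt\<close> is only in \<open>L\<^sup>2(0,T; \<H>)\<close>, but for a solution of the variational equation
  \<open>t \<mapsto> (V(t), \<cdot>)\<close> belongs to \<open>H\<^sup>1(0,T; \<D>(G)')\<close>, hence to \<open>C([0,T]; \<D>(G)')\<close>; its initial value is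
  taken in this space.
\<close>

definition is_solution ::
  "real \<Rightarrow> real \<Rightarrow> real \<Rightarrow> (real ^ 'n \<Rightarrow> real) \<Rightarrow> (real \<Rightarrow> real) \<Rightarrow> (real \<Rightarrow> real) \<Rightarrow>
   (real \<Rightarrow> ('n::finite pt \<Rightarrow> real) \<Rightarrow> real) \<Rightarrow> (real \<Rightarrow> 'n pt \<Rightarrow> 'n pt) \<Rightarrow> bool" where
  "is_solution H g T zb rho c ub U \<longleftrightarrow>
     U \<in> L2_time (dom_Gt H zb) (graph_norm H g zb rho c) T \<and>
     (\<exists>V \<in> L2_time (L2 (Dom H zb)) (norm_H H zb rho) T.
        weak_time_deriv (L2 (Dom H zb)) (norm_H H zb rho) T U V \<and>
        zero_at_time_0 (dual_space (dom_G H zb) (graph_norm H g zb rho c))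
                       (dual_norm (dom_G H zb) (graph_norm H g zb rho c)) T
                       (\<lambda>t W. inner_H H zb rho (V t) W)) \<and>
     zero_at_time_0 (L2 (Dom H zb)) (norm_H H zb rho) T U \<and>
     (\<forall>W \<in> dom_G H zb. \<forall>\<phi> \<in> test_functions {0<..<T}.
        (LINT t|lebesgue_on {0<..<T}. inner_H H zb rho (U t) W * deriv (deriv \<phi>) t) +
        (LINT t|lebesgue_on {0<..<T}.
           inner_G H g zb rho c (Gt H g zb rho c (U t)) (Gt H g zb rho c W) * \<phi> t) = 0) \<and>
     (AE t in lebesgue_on {0<..<T}. has_bottom_trace H zb (U t) (ub t))"

end

theory Submission
  imports Defs
begin

text \<open>
  The difference \<open>D\<close> of two solutions has zero bottom trace, so \<open>D(t) \<in> \<D>(G)\<close> for almost every \<open>t\<close>.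
  With \<open>b\<close> the inner product of \<open>\<H>\<close> and \<open>a(u,v) = (Gu, Gv)\<close>, it satisfies \<open>b(D,W)'' + a(D,W) = 0\<close>
  for every \<open>W \<in> \<D>(G)\<close>, with zero initial data.  Formally \<open>D' = - \<A>X\<close>, where \<open>X(t) = \<integral>\<^sub>0\<^sup>t D\<close> and \<open>\<A>\<close> is the
  operator of the form \<open>a\<close>, so that the energy \<open>b(D,D) + a(X,X)\<close> is conserved and equal to zero.
  The integrated equation \<open>b(D'(t),W) = - a(X(t),W)\<close> holds for almost every \<open>t\<close>, with an exceptional set that depends
  on \<open>W\<close>, so \<open>W = D(t)\<close> cannot simply be inserted.  Two independent time variables avoid this: \<open>W = D(t)\<close> stays fixed
  while the equation is integrated in \<open>s\<close>.

  Let \<open>B(s,t) = b(D(s),D(t))\<close>, taken with the continuous representative of \<open>D\<close> in \<open>\<H>\<close>, and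
  \<open>A(s,t) = a(D(s),D(t))\<close>.  Testing the equation with the constant vector \<open>W = D(t)\<close> and integrating twice in time
  (\<open>solution_integral_identity\<close>) shows that \<open>- B(\<cdot>,t)\<close> is the double primitive of \<open>A(\<cdot>,t)\<close>.  Put
  \<open>\<alpha>(s,t) = \<integral>\<^sub>0\<^sup>s\<integral>\<^sub>0\<^sup>t A = a(X(s),X(t))\<close> and \<open>\<mu>(s,t) = \<integral>\<^sub>0\<^sup>s \<alpha>(r,t) dr\<close>.  Integrating in the second variable,
  \<open>\<mu>(s,t) = - \<integral>\<^sub>0\<^sup>t B(s,\<tau>) d\<tau>\<close>, so \<open>\<mu>\<close> is continuously differentiable with \<open>\<partial>\<^sub>s\<mu> = \<alpha>\<close> and \<open>\<partial>\<^sub>t\<mu> = - B\<close>, both of which are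
  symmetric.  Hence \<open>\<mu>(s,t) - \<mu>(t,s)\<close> is constant along the lines parallel to the diagonal; it vanishes on the axes,
  so \<open>\<mu>\<close> is symmetric and \<open>\<alpha> = - B\<close> everywhere (\<open>symmetric_derivatives_diagonal\<close>).  On the diagonal this is the
  energy identity \<open>b(D(t),D(t)) = - a(X(t),X(t)) \<le> 0\<close> (\<open>energy_identity_imp_zero\<close>).

  Only scalar integrals occur in this argument.  The sign \<open>\<alpha>(t,t) \<ge> 0\<close> is obtained by approximating \<open>D\<close> by step
  functions, for which \<open>\<alpha>(t,t)\<close> is a finite quadratic sum (\<open>kernel_nonneg\<close>), and no primitive of \<open>D\<close> has to be
  constructed in the space \<open>\<D>(G)\<close>.  Two further ingredients are needed.  The passage from the distributional equation
  and the initial conditions to integrated equations is the lemma of du Bois-Reymond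
  (\<open>weak_derivative_imp_primitive\<close>), applied to scalar functions obtained by testing with a bounded functional.
  The form \<open>a\<close> is bilinear only because weak divergences and normal traces are determined up to null sets; this
  follows from the fundamental lemma of the calculus of variations, proved with explicit bump functions.
\<close>


section \<open>Smooth functions approximating boxes\<close>

lemma Ck_continuous: "Ck k f \<Longrightarrow> continuous_on UNIV f"
  by (cases k) (auto intro: differentiable_imp_continuous_on)

lemma Ck_Suc_imp_Ck: "Ck (Suc k) f \<Longrightarrow> Ck k f"
proof (induction k arbitrary: f)
  case 0
  then show ?case by (auto intro: differentiable_imp_continuous_on)
next
  case (Suc k)
  then show ?case by (metis Ck.simps(2))
qed

lemma Ck_const: "Ck k (\<lambda>x. c)"
  by (induction k arbitrary: c) auto

lemma Ck_add:
  assumes "Ck k f" "Ck k g" shows "Ck k (\<lambda>x. f x + g x)"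
  using assms
proof (induction k arbitrary: f g)
  case 0 then show ?case by (auto intro: continuous_intros)
next
  case (Suc k)
  then have d: "f differentiable_on UNIV" "g differentiable_on UNIV" by auto
  then have "frechet_derivative (\<lambda>x. f x + g x) (at x) b =
      frechet_derivative f (at x) b + frechet_derivative g (at x) b" for x b
    by (intro fun_cong[OF frechet_derivative_at[symmetric]] has_derivative_add)
       (auto simp: differentiable_on_def frechet_derivative_works[symmetric])
  with Suc d show ?case by (auto intro!: differentiable_on_add)
qed

lemma Ck_mult:
  assumes "Ck k f" "Ck k g" shows "Ck k (\<lambda>x. f x * g x)"
  using assms
proof (induction k arbitrary: f g)
  case 0 then show ?case by (auto intro: continuous_intros)
next
  case (Suc k)
  then have d: "f differentiable_on UNIV" "g differentiable_on UNIV" by auto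
  then have "frechet_derivative (\<lambda>x. f x * g x) (at x) b =
      f x * frechet_derivative g (at x) b + frechet_derivative f (at x) b * g x" for x b
    by (intro fun_cong[OF frechet_derivative_at[symmetric]] has_derivative_mult)
       (auto simp: differentiable_on_def frechet_derivative_works[symmetric])
  moreover have "Ck k f" "Ck k g" using Suc.prems Ck_Suc_imp_Ck by blast+
  ultimately show ?case using Suc d by (auto intro!: differentiable_on_mult Ck_add Suc.IH)
qed

lemma Ck_cmult: "Ck k f \<Longrightarrow> Ck k (\<lambda>x. c * f x)"
  by (rule Ck_mult[OF Ck_const])

lemma Ck_diff: "Ck k f \<Longrightarrow> Ck k g \<Longrightarrow> Ck k (\<lambda>x. f x - g x)"
  using Ck_add[of k f "\<lambda>x. (-1) * g x"] Ck_cmult[of k g "-1"] by simp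

lemma Ck_power: "Ck k f \<Longrightarrow> Ck k (\<lambda>x. f x ^ m)"
  by (induction m) (auto intro: Ck_const Ck_mult)

lemma Ck_prod: "finite I \<Longrightarrow> (\<And>i. i \<in> I \<Longrightarrow> Ck k (f i)) \<Longrightarrow> Ck k (\<lambda>x. \<Prod>i\<in>I. f i x)"
  by (induction I rule: finite_induct) (auto intro: Ck_const Ck_mult)

lemma Ck_compose_affine:
  fixes f :: "real \<Rightarrow> real" and v :: "'a::euclidean_space"
  assumes "Ck k f" shows "Ck k (\<lambda>x::'a. f (x \<bullet> v + r))"
  using assms
proof (induction k arbitrary: f)
  case 0
  then have "continuous_on UNIV f" by simp
  then show ?case
    by (simp only: Ck.simps) (rule continuous_on_compose2[of UNIV f], auto intro!: continuous_intros)
next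
  case (Suc k)
  have D: "((\<lambda>x::'a. f (x \<bullet> v + r)) has_derivative
      (\<lambda>h. (h \<bullet> v) * frechet_derivative f (at (x \<bullet> v + r)) 1)) (at x)" for x
  proof -
    have fd: "f differentiable at (x \<bullet> v + r)" using Suc.prems by (auto simp: differentiable_on_def)
    then have 1: "(f has_derivative frechet_derivative f (at (x \<bullet> v + r))) (at (x \<bullet> v + r))"
      using frechet_derivative_works by blast
    interpret l: bounded_linear "frechet_derivative f (at (x \<bullet> v + r))"
      using 1 has_derivative_bounded_linear by blast
    have "((\<lambda>x::'a. x \<bullet> v + r) has_derivative (\<lambda>h. h \<bullet> v)) (at x)"
      by (auto intro!: derivative_eq_intros)
    from diff_chain_at[OF this 1]
    have "((\<lambda>x::'a. f (x \<bullet> v + r)) has_derivative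
        (\<lambda>h. frechet_derivative f (at (x \<bullet> v + r)) (h \<bullet> v))) (at x)" by (simp add: o_def)
    moreover have "(\<lambda>h. frechet_derivative f (at (x \<bullet> v + r)) (h \<bullet> v)) =
        (\<lambda>h. (h \<bullet> v) * frechet_derivative f (at (x \<bullet> v + r)) 1)"
    proof
      fix h
      show "frechet_derivative f (at (x \<bullet> v + r)) (h \<bullet> v) =
          (h \<bullet> v) * frechet_derivative f (at (x \<bullet> v + r)) 1"
        using l.scaleR[of "h \<bullet> v" 1] unfolding real_scaleR_def mult_1_right .
    qed
    ultimately show ?thesis by metis
  qed
  have "frechet_derivative (\<lambda>x::'a. f (x \<bullet> v + r)) (at x) b =
      (b \<bullet> v) * frechet_derivative f (at (x \<bullet> v + r)) 1" for x b
    by (simp only: frechet_derivative_at[OF D, symmetric])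
  moreover have "Ck k (\<lambda>x::'a. (b \<bullet> v) * frechet_derivative f (at (x \<bullet> v + r)) 1)" for b :: 'a
    using Suc by (intro Ck_cmult Suc.IH) auto
  moreover have "(\<lambda>x::'a. f (x \<bullet> v + r)) differentiable_on UNIV"
    unfolding differentiable_on_def using differentiableI[OF D] by blast
  ultimately show ?case by simp
qed

text \<open>
  The derivative of \<open>x\<^sup>-\<^sup>m exp(-1/x)\<close> is a combination of functions of the same form; the parameter \<open>m\<close>
  makes the family closed under differentiation, so that smoothness of all members follows by one induction.
\<close>

definition expbump :: "nat \<Rightarrow> real \<Rightarrow> real" where
  "expbump m x = (if x > 0 then (1 / x) ^ m * exp (- (1 / x)) else 0)"

lemma expbump_tendsto_0: "(expbump m \<longlongrightarrow> 0) (at 0)"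
proof -
  have "((\<lambda>y::real. y ^ m / exp y) \<longlongrightarrow> 0) at_top" by (rule tendsto_power_div_exp_0)
  then have "((\<lambda>x::real. (inverse x) ^ m / exp (inverse x)) \<longlongrightarrow> 0) (at_right 0)"
    by (rule filterlim_compose[OF _ filterlim_inverse_at_top_right])
  moreover have "eventually (\<lambda>x. expbump m x = (inverse x) ^ m / exp (inverse x)) (at_right 0)"
    using eventually_at_right_less by eventually_elim (simp add: expbump_def exp_minus divide_simps)
  ultimately have "(expbump m \<longlongrightarrow> 0) (at_right 0)" using tendsto_cong by fast
  moreover have "(expbump m \<longlongrightarrow> 0) (at_left 0)"
    by (rule tendsto_eventually, rule eventually_mono[OF eventually_at_left_real[of "-1" 0]])
       (auto simp: expbump_def)
  ultimately show ?thesis by (simp add: filterlim_at_split)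
qed

lemma expbump_has_derivative:
  "(expbump m has_real_derivative (expbump (m + 2) x - real m * expbump (m + 1) x)) (at x)"
proof -
  consider "x > 0" | "x = 0" | "x < 0" by linarith
  then show ?thesis
  proof cases
    case 1
    have pow: "real m * (1 / x) ^ (m - Suc 0) * (1 / x)\<^sup>2 = real m * (1 / x) ^ (m + 1)"
      by (cases m) (auto simp: power2_eq_square)
    have "((\<lambda>x. (1 / x) ^ m * exp (- (1 / x))) has_real_derivative
        (1 / x) ^ m * (exp (- (1 / x)) * (1 / x)\<^sup>2)
        - (real m * (1 / x) ^ (m - Suc 0) * (1 / x)\<^sup>2) * exp (- (1 / x))) (at x)"
      using 1 by (auto intro!: derivative_eq_intros simp: power2_eq_square algebra_simps)
    then have "((\<lambda>x. (1 / x) ^ m * exp (- (1 / x))) has_real_derivative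
        (expbump (m + 2) x - real m * expbump (m + 1) x)) (at x)"
      unfolding pow using 1 by (simp add: expbump_def power_add power2_eq_square algebra_simps)
    moreover have ev: "eventually (\<lambda>y. (1 / y) ^ m * exp (- (1 / y)) = expbump m y) (nhds x)"
      using eventually_nhds_in_open[of "{0<..}" x] 1 by (auto simp: expbump_def elim: eventually_mono)
    ultimately show ?thesis
      by (simp only: DERIV_cong_ev[OF refl ev refl])
  next
    case 2
    have "((\<lambda>h. expbump (m + 1) h) \<longlongrightarrow> 0) (at 0)" by (rule expbump_tendsto_0)
    moreover have "eventually (\<lambda>h. expbump (m + 1) h = (expbump m (0 + h) - expbump m 0) / h) (at 0)"
      by (rule always_eventually) (auto simp: expbump_def)
    ultimately have "((\<lambda>h. (expbump m (0 + h) - expbump m 0) / h) \<longlongrightarrow> 0) (at 0)"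
      using tendsto_cong by fast
    then have "(expbump m has_real_derivative 0) (at 0)" by (simp add: DERIV_def)
    then show ?thesis using 2 by (simp add: expbump_def)
  next
    case 3
    have "((\<lambda>x. 0) has_real_derivative
        (expbump (m + 2) x - real m * expbump (m + 1) x)) (at x)"
      using 3 by (auto simp: expbump_def)
    moreover have ev: "eventually (\<lambda>y. 0 = expbump m y) (nhds x)"
      using eventually_nhds_in_open[of "{..<0}" x] 3 by (auto simp: expbump_def elim: eventually_mono)
    ultimately show ?thesis
      by (simp only: DERIV_cong_ev[OF refl ev refl])
  qed
qed

lemma frechet_derivative_real:
  assumes "(f has_real_derivative D) (at x)"
  shows "frechet_derivative f (at x) h = D * h"
  using assms frechet_derivative_at[of f "\<lambda>h. D * h" x] by (simp add: has_field_derivative_def)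

text \<open>
  Induction on the order of differentiability, for all exponents \<open>m\<close> at once, because differentiation raises \<open>m\<close>.
\<close>

lemma Ck_expbump: "Ck k (expbump m)"
proof (induction k arbitrary: m)
  case 0
  show ?case using expbump_has_derivative DERIV_isCont continuous_at_imp_continuous_on
    by (metis Ck.simps(1))
next
  case (Suc k)
  have "expbump m differentiable_on UNIV"
    using expbump_has_derivative
    by (auto simp: differentiable_on_def real_differentiable_def
        intro!: differentiable_at_withinI)
  moreover have "frechet_derivative (expbump m) (at x) 1 =
      expbump (m + 2) x - real m * expbump (m + 1) x" for x
    using frechet_derivative_real[OF expbump_has_derivative, of m x 1] by simp
  moreover have "Ck k (\<lambda>x. expbump (m + 2) x - real m * expbump (m + 1) x)"
    by (intro Ck_diff Ck_cmult Suc)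
  ultimately show ?case by simp
qed

text \<open>
  A smooth function with values in \<open>[0,1]\<close> that is positive exactly on the open box.
\<close>

definition box_bump :: "'a::euclidean_space \<Rightarrow> 'a \<Rightarrow> 'a \<Rightarrow> real" where
  "box_bump a b x = (\<Prod>i\<in>Basis. expbump 0 (x \<bullet> i - a \<bullet> i) * expbump 0 (b \<bullet> i - x \<bullet> i))"

lemma expbump_0_bounds: "0 \<le> expbump 0 x" "expbump 0 x \<le> 1" "0 < expbump 0 x \<longleftrightarrow> 0 < x"
  by (auto simp: expbump_def)

lemma Ck_box_bump: "Ck k (box_bump a b)"
proof -
  have "Ck k (\<lambda>x. expbump 0 (x \<bullet> i - a \<bullet> i) * expbump 0 (b \<bullet> i - x \<bullet> i))" for i
    using Ck_mult[OF Ck_compose_affine[OF Ck_expbump[of k 0], of i "- (a \<bullet> i)"]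
        Ck_compose_affine[OF Ck_expbump[of k 0], of "-i" "b \<bullet> i"]] by simp
  then show ?thesis unfolding box_bump_def by (intro Ck_prod) auto
qed

lemma box_bump_bounds: "0 \<le> box_bump a b x" "box_bump a b x \<le> 1"
  unfolding box_bump_def
  by (auto intro!: prod_nonneg prod_le_1 mult_le_one simp: expbump_0_bounds)

lemma box_bump_pos: "x \<in> box a b \<Longrightarrow> 0 < box_bump a b x"
  unfolding box_bump_def by (intro prod_pos) (auto simp: expbump_0_bounds mem_box)

lemma box_bump_zero: "x \<notin> box a b \<Longrightarrow> box_bump a b x = 0"
  proof -
  assume "x \<notin> box a b"
  then obtain i where "i \<in> Basis" "expbump 0 (x \<bullet> i - a \<bullet> i) * expbump 0 (b \<bullet> i - x \<bullet> i) = 0"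
    by (auto simp: mem_box expbump_def not_less)
  then show ?thesis unfolding box_bump_def by (intro prod_zero) auto
qed

text \<open>
  As \<open>0 < \<theta> \<le> 1\<close> inside the box and \<open>\<theta> = 0\<close> outside for the bump function \<open>\<theta>\<close>, the polynomials
  \<open>1 - (1 - \<theta>)\<^sup>m\<close> of \<open>\<theta>\<close> converge boundedly to the indicator function of the open box.
\<close>

definition box_approx :: "nat \<Rightarrow> 'a::euclidean_space \<Rightarrow> 'a \<Rightarrow> 'a \<Rightarrow> real" where
  "box_approx m a b x = 1 - (1 - box_bump a b x) ^ m"

lemma box_approx_test_function:
  assumes "cbox a b \<subseteq> S" shows "box_approx m a b \<in> test_functions S"
proof -
  have "Ck k (box_approx m a b)" for k
    unfolding box_approx_def by (intro Ck_diff Ck_power Ck_const Ck_box_bump)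
  moreover have "box_approx m a b x = 0" if "x \<notin> cbox a b" for x
  proof -
    have "x \<notin> box a b" using that box_subset_cbox[of a b] by blast
    then show ?thesis by (simp add: box_approx_def box_bump_zero)
  qed
  ultimately show ?thesis
    unfolding test_functions_def using assms by (auto intro!: exI[of _ "cbox a b"])
qed

lemma one_minus_power_bounds:
  assumes "0 \<le> y" "y \<le> (1::real)" shows "0 \<le> 1 - (1 - y) ^ m" "1 - (1 - y) ^ m \<le> 1"
  using assms by (auto simp: power_le_one)

lemma one_minus_power_tendsto_1:
  assumes "0 < y" "y \<le> (1::real)" shows "(\<lambda>m. 1 - (1 - y) ^ m) \<longlonglongrightarrow> 1"
proof -
  have "(\<lambda>m. (1 - y) ^ m) \<longlonglongrightarrow> 0" using assms by (intro LIMSEQ_realpow_zero) auto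
  from tendsto_diff[OF tendsto_const this, of 1] show ?thesis by simp
qed

lemma box_approx_tendsto_indicator:
  "(\<lambda>m. box_approx m a b x) \<longlonglongrightarrow> indicator (box a b) x"
proof (cases "x \<in> box a b")
  case True
  then show ?thesis using one_minus_power_tendsto_1[of "box_bump a b x"] box_bump_pos[of x a b]
      box_bump_bounds[of a b x] by (simp add: box_approx_def)
next
  case False
  then show ?thesis by (simp add: box_approx_def box_bump_zero)
qed

lemma box_approx_bounds: "\<bar>box_approx m a b x\<bar> \<le> 1"
  using one_minus_power_bounds[of "box_bump a b x" m] box_bump_bounds[of a b x]
  by (simp add: box_approx_def)

lemma box_sets: "box a b \<in> sets lebesgue"
  by (simp add: fmeasurableD)

text \<open>
  The Borel sets with zero integral form a Dynkin system, and the open boxes are an intersection-stable generator.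
\<close>

lemma integral_zero_on_boxes_imp_AE_zero:
  fixes F :: "'a::euclidean_space \<Rightarrow> real"
  assumes F: "integrable lebesgue F"
    and zero: "\<And>a b. (LINT x|lebesgue. indicator (box a b) x * F x) = 0"
  shows "AE x in lebesgue. F x = 0"
proof -
  have int: "integrable lebesgue (\<lambda>x. indicator A x * F x)" if "A \<in> sets lebesgue" for A
    using integrable_mult_indicator[OF that F] by simp
  have Int: "Int_stable (range (\<lambda>(a, b). box a b :: 'a set))"
    by (auto simp: Int_stable_def box_Int_box)
  have borel: "(LINT x|lebesgue. indicator A x * F x) = 0" if "A \<in> sets borel" for A
  proof -
    note Int
    moreover have "range (\<lambda>(a, b). box a b :: 'a set) \<subseteq> Pow UNIV" by auto
    moreover have "A \<in> sigma_sets UNIV (range (\<lambda>(a, b). box a b))"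
      using that unfolding borel_eq_box by simp
    ultimately show ?thesis
    proof (induction rule: sigma_sets_induct_disjoint)
      case (compl A)
      then have A: "A \<in> sets lebesgue"
        using sets_completionI_sets[of A lborel] by (simp add: borel_eq_box)
      have "(LINT x|lebesgue. indicator UNIV x * F x) = 0"
      proof -
        have "(\<lambda>n. LINT x|lebesgue. indicator (box (- real n *\<^sub>R One) (real n *\<^sub>R One)) x * F x)
            \<longlonglongrightarrow> (LINT x|lebesgue. indicator UNIV x * F x)"
        proof (rule integral_dominated_convergence[where w = "\<lambda>x. \<bar>F x\<bar>"])
          show "AE x in lebesgue. (\<lambda>n. indicator (box (- real n *\<^sub>R One) (real n *\<^sub>R One)) x * F x)
              \<longlonglongrightarrow> indicator UNIV x * F x"
          proof (rule AE_I2, rule tendsto_eventually)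
            fix x :: 'a
            have "x \<in> box (- real n *\<^sub>R One) (real n *\<^sub>R One)" if "n > nat \<lceil>norm x\<rceil>" for n
            proof -
              have "norm x < real n" using that by linarith
              then have "\<bar>x \<bullet> i\<bar> < real n" if "i \<in> Basis" for i
                using Basis_le_norm[OF that, of x] by linarith
              then show ?thesis by (force simp: mem_box)
            qed
            then show "\<forall>\<^sub>F n in sequentially.
                indicator (box (- real n *\<^sub>R One) (real n *\<^sub>R One)) x * F x = indicator UNIV x * F x"
              by (intro eventually_mono[OF eventually_gt_at_top[of "nat \<lceil>norm x\<rceil>"]]) simp
          qed
        qed (use F int[OF box_sets] in \<open>auto simp: abs_mult split: split_indicator\<close>)
        then show ?thesis using zero by (simp add: LIMSEQ_const_iff)
      qed
      moreover have "indicator (UNIV - A) x * F x = indicator UNIV x * F x - indicator A x * F x" for x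
        by (auto simp: indicator_def)
      ultimately show ?case using compl int[OF A] int[of UNIV] by simp
    next
      case (union A)
      then have A: "A i \<in> sets lebesgue" for i
        using sets_completionI_sets[of "A i" lborel] by (force simp: borel_eq_box)
      have "(LINT x:(\<Union>i. A i)|lebesgue. F x) = (\<Sum>i. (LINT x:A i|lebesgue. F x))"
        using union(1) A int[of "\<Union>i. A i"] by (intro lebesgue_integral_countable_add)
           (auto simp: disjoint_family_on_def set_integrable_def)
      then show ?case using union by (simp add: set_lebesgue_integral_def)
    qed (use zero in auto)
  qed
  show ?thesis
  proof (rule density_unique_real[OF F integrable_zero])
    fix A :: "'a set" assume A: "A \<in> sets lebesgue"
    then obtain S N N' where S: "A = S \<union> N" "N \<subseteq> N'" "N' \<in> null_sets lborel" "S \<in> sets lborel"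
      by (rule sets_completionE)
    then have "AE x in lebesgue. x \<notin> N'"
      by (metis AE_completion AE_not_in)
    then have "(LINT x|lebesgue. indicator A x * F x) = (LINT x|lebesgue. indicator S x * F x)"
      using S A int[OF A] int[of S]
      by (intro integral_cong_AE) (auto simp: indicator_def elim!: eventually_mono)
    then show "set_lebesgue_integral lebesgue A F = set_lebesgue_integral lebesgue A (\<lambda>x. 0)"
      using borel[of S] S by (simp add: set_lebesgue_integral_def)
  qed
qed

lemma continuous_imp_lebesgue_measurable:
  fixes f :: "'a::euclidean_space \<Rightarrow> 'b::euclidean_space"
  shows "continuous_on UNIV f \<Longrightarrow> f \<in> borel_measurable lebesgue"
  using continuous_imp_measurable_on_sets_lebesgue[of UNIV f] by (simp add: lebesgue_on_UNIV_eq)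

text \<open>
  The fundamental lemma of the calculus of variations.  The approximations are a parameter, so that
  the lemma also applies to test functions of more variables that are restricted to a hyperplane.
\<close>

lemma AE_zero_if_orthogonal_to_box_approximations:
  fixes f :: "'a::euclidean_space \<Rightarrow> real"
  assumes "open S"
    and loc: "\<And>a b. cbox a b \<subseteq> S \<Longrightarrow> integrable lebesgue (\<lambda>x. indicator (cbox a b) x * f x)"
    and orth: "\<And>a b. cbox a b \<subseteq> S \<Longrightarrow> \<exists>\<psi>. (\<forall>m::nat. \<psi> m \<in> borel_measurable lebesgue) \<and>
        (\<forall>m x. \<bar>\<psi> m x\<bar> \<le> 1) \<and> (\<forall>x. (\<lambda>m. \<psi> m x) \<longlonglongrightarrow> indicator (box a b) x) \<and>
        (\<forall>m. (LINT x|lebesgue. (indicator (cbox a b) x * f x) * \<psi> m x) = 0)"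
  shows "AE x in lebesgue_on S. f x = 0"
proof -
  have box0: "(LINT x|lebesgue. indicator (box a b) x * f x) = 0" if ab: "cbox a b \<subseteq> S" for a b
  proof -
    let ?F = "\<lambda>x. indicator (cbox a b) x * f x"
    obtain \<psi> :: "nat \<Rightarrow> 'a \<Rightarrow> real" where \<psi>: "\<And>m. \<psi> m \<in> borel_measurable lebesgue"
      "\<And>m x. \<bar>\<psi> m x\<bar> \<le> 1" "\<And>x. (\<lambda>m. \<psi> m x) \<longlonglongrightarrow> indicator (box a b) x"
      "\<And>m. (LINT x|lebesgue. ?F x * \<psi> m x) = 0"
      using orth[OF ab] by metis
    have F: "integrable lebesgue ?F" by (rule loc[OF ab])
    have eq: "indicator (box a b) x * f x = ?F x * indicator (box a b) x" for x
      using box_subset_cbox[of a b] by (auto simp: indicator_def)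
    have "(\<lambda>m. LINT x|lebesgue. ?F x * \<psi> m x) \<longlonglongrightarrow> (LINT x|lebesgue. ?F x * indicator (box a b) x)"
    proof (rule integral_dominated_convergence[where w = "\<lambda>x. \<bar>?F x\<bar>"])
      show "(\<lambda>x. ?F x * \<psi> m x) \<in> borel_measurable lebesgue" for m
        by (rule borel_measurable_times[OF borel_measurable_integrable[OF F] \<psi>(1)])
      show "(\<lambda>x. ?F x * indicator (box a b) x) \<in> borel_measurable lebesgue"
        by (rule borel_measurable_times[OF borel_measurable_integrable[OF F]
            borel_measurable_indicator[OF box_sets]])
      show "AE x in lebesgue. (\<lambda>m. ?F x * \<psi> m x) \<longlonglongrightarrow> ?F x * indicator (box a b) x"
        by (rule AE_I2, rule tendsto_mult[OF tendsto_const \<psi>(3)])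
      show "AE x in lebesgue. norm (?F x * \<psi> m x) \<le> \<bar>?F x\<bar>" for m
      proof (rule AE_I2)
        fix x
        show "norm (?F x * \<psi> m x) \<le> \<bar>?F x\<bar>"
          using mult_left_le[OF \<psi>(2)[of m x] abs_ge_zero[of "?F x"]]
          by (simp only: abs_mult real_norm_def)
      qed
      show "integrable lebesgue (\<lambda>x. \<bar>?F x\<bar>)" by (rule integrable_abs[OF F])
    qed
    then have "(LINT x|lebesgue. ?F x * indicator (box a b) x) = 0"
      by (simp only: \<psi>(4) LIMSEQ_const_iff)
    then show ?thesis by (simp only: eq)
  qed
  have on_cbox: "AE x in lebesgue. x \<in> cbox a b \<longrightarrow> f x = 0" if ab: "cbox a b \<subseteq> S" for a b
  proof -
    have "AE x in lebesgue. indicator (cbox a b) x * f x = 0"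
    proof (rule integral_zero_on_boxes_imp_AE_zero[OF loc[OF ab]])
      fix c d
      obtain e k where ek: "cbox a b \<inter> cbox c d = cbox e k" "box a b \<inter> box c d = box e k"
        by (rule that[OF Int_interval box_Int_box])
      have "AE x in lebesgue. x \<notin> cbox a b - box a b"
        using negligible_frontier_interval[of a b] by (intro AE_not_in) (simp only: negligible_iff_null_sets)
      then have "(LINT x|lebesgue. indicator (box c d) x * (indicator (cbox a b) x * f x)) =
          (LINT x|lebesgue. indicator (box c d) x * (indicator (box a b) x * f x))"
      proof (intro integral_cong_AE)
        have m: "(\<lambda>x. indicator (cbox a b) x * f x) \<in> borel_measurable lebesgue"
          by (rule borel_measurable_integrable[OF loc[OF ab]])
        then show "(\<lambda>x. indicator (box c d) x * (indicator (cbox a b) x * f x)) \<in> borel_measurable lebesgue"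
          by (rule borel_measurable_times[OF borel_measurable_indicator[OF box_sets]])
        have eq: "indicator (box a b) x * f x = indicator (box a b) x * (indicator (cbox a b) x * f x)" for x
          using box_subset_cbox[of a b] by (auto simp: indicator_def)
        show "(\<lambda>x. indicator (box c d) x * (indicator (box a b) x * f x)) \<in> borel_measurable lebesgue"
          by (subst eq) (rule borel_measurable_times[OF borel_measurable_indicator[OF box_sets]
              borel_measurable_times[OF borel_measurable_indicator[OF box_sets] m]])
        assume ae: "AE x in lebesgue. x \<notin> cbox a b - box a b"
        then show "AE x in lebesgue. indicator (box c d) x * (indicator (cbox a b) x * f x) =
            indicator (box c d) x * (indicator (box a b) x * f x)"
        proof eventually_elim
          case (elim x)
          then have "x \<in> cbox a b \<longleftrightarrow> x \<in> box a b" using box_subset_cbox[of a b] by blast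
          then show ?case by (simp add: indicator_def)
        qed
      qed
      also have "\<dots> = (LINT x|lebesgue. indicator (box e k) x * f x)"
        unfolding ek(2)[symmetric] by (simp add: indicator_inter_arith mult_ac)
      also have "\<dots> = 0" using ek(1) ab by (intro box0) blast
      finally show "(LINT x|lebesgue. indicator (box c d) x * (indicator (cbox a b) x * f x)) = 0" .
    qed
    then show ?thesis by eventually_elim (simp add: indicator_def)
  qed
  obtain D where D: "countable D" "D \<subseteq> Pow S" "\<And>X. X \<in> D \<Longrightarrow> \<exists>a b. X = cbox a b" "\<Union>D = S"
    using open_countable_Union_open_cbox[OF \<open>open S\<close>] by blast
  have "AE x in lebesgue. \<forall>X\<in>D. x \<in> X \<longrightarrow> f x = 0"
  proof (subst AE_ball_countable[OF D(1)], rule ballI)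
    fix X assume "X \<in> D"
    then obtain a b where "X = cbox a b" "cbox a b \<subseteq> S" using D(2,3) by blast
    with on_cbox show "AE x in lebesgue. x \<in> X \<longrightarrow> f x = 0" by simp
  qed
  then have "AE x in lebesgue. x \<in> S \<longrightarrow> f x = 0"
    by eventually_elim (use D(4) in blast)
  then show ?thesis
    using lebesgue_openin[of UNIV S] \<open>open S\<close> by (subst AE_restrict_space_iff) auto
qed

section \<open>Kernels on a square\<close>

text \<open>
  The primitive \<open>\<integral>\<^sub>0\<^sup>s h\<close>, written as an integral over the fixed interval \<open>(0,T)\<close> so that Fubini's theorem and
  dominated convergence apply without a change of the domain.
\<close>

definition prim :: "real \<Rightarrow> (real \<Rightarrow> real) \<Rightarrow> real \<Rightarrow> real" where
  "prim T h s = (LINT r|lebesgue_on {0<..<T}. (if r < s then h r else 0))"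

lemma finite_measure_time: "finite_measure (lebesgue_on {0<..<T::real})"
  by (rule finite_measure_lebesgue_on) simp

lemma pair_sigma_finite_time: "pair_sigma_finite (lebesgue_on {0<..<T::real}) (lebesgue_on {0<..<T})"
proof -
  interpret finite_measure "lebesgue_on {0<..<T}" by (rule finite_measure_time)
  show ?thesis by unfold_locales
qed

lemma borel_imp_measurable_lebesgue_on:
  "f \<in> borel_measurable borel \<Longrightarrow> f \<in> borel_measurable (lebesgue_on S)"
  by (intro measurable_restrict_space1 measurable_completion) simp

lemma time_ident_measurable: "(\<lambda>x::real. x) \<in> borel_measurable (lebesgue_on {0<..<T})"
  by (intro borel_imp_measurable_lebesgue_on) simp

lemma prim_integrand_integrable:
  fixes h :: "real \<Rightarrow> real"
  assumes h: "integrable (lebesgue_on {0<..<T}) h"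
  shows "integrable (lebesgue_on {0<..<T}) (\<lambda>r. if r < s then h r else 0)"
proof (rule Bochner_Integration.integrable_bound[OF h])
  have [measurable]: "h \<in> borel_measurable (lebesgue_on {0<..<T})" "(\<lambda>x. x) \<in> borel_measurable (lebesgue_on {0<..<T})"
    using h time_ident_measurable by auto
  show "(\<lambda>r. if r < s then h r else 0) \<in> borel_measurable (lebesgue_on {0<..<T})"
    by measurable
qed simp

lemma prim_bound:
  assumes h: "integrable (lebesgue_on {0<..<T}) h"
  shows "\<bar>prim T h s\<bar> \<le> (LINT r|lebesgue_on {0<..<T}. \<bar>h r\<bar>)"
proof -
  have "\<bar>prim T h s\<bar> \<le> (LINT r|lebesgue_on {0<..<T}. \<bar>(if r < s then h r else 0)\<bar>)"
    unfolding prim_def by (rule integral_abs_bound)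
  also have "\<dots> \<le> (LINT r|lebesgue_on {0<..<T}. \<bar>h r\<bar>)"
    by (intro integral_mono integrable_abs prim_integrand_integrable h) auto
  finally show ?thesis .
qed

lemma prim_0: "s \<le> 0 \<Longrightarrow> prim T h s = 0"
  unfolding prim_def by (subst Bochner_Integration.integral_cong[OF refl, where g = "\<lambda>_. 0"]) auto

lemma prim_uminus: "prim T (\<lambda>r. - h r) s = - prim T h s"
proof -
  have "(if r < s then - h r else 0) = - (if r < s then h r else 0)" for r by simp
  then show ?thesis unfolding prim_def by simp
qed

lemma prim_diff:
  assumes "integrable (lebesgue_on {0<..<T}) h" "integrable (lebesgue_on {0<..<T}) k"
  shows "prim T (\<lambda>r. h r - k r) s = prim T h s - prim T k s"
proof -
  have "(if r < s then h r - k r else 0) = (if r < s then h r else 0) - (if r < s then k r else 0)" for r by simp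
  then show ?thesis unfolding prim_def using assms by (simp add: prim_integrand_integrable)
qed

lemma prim_cong_AE:
  assumes "integrable (lebesgue_on {0<..<T}) h" "integrable (lebesgue_on {0<..<T}) k"
    and "AE r in lebesgue_on {0<..<T}. h r = k r"
  shows "prim T h s = prim T k s"
  unfolding prim_def
  by (rule integral_cong_AE[OF borel_measurable_integrable[OF prim_integrand_integrable[OF assms(1)]]
        borel_measurable_integrable[OF prim_integrand_integrable[OF assms(2)]]])
     (use assms(3) in eventually_elim, simp)

lemma prim_continuous:
  assumes h: "integrable (lebesgue_on {0<..<T}) h"
  shows "continuous_on UNIV (prim T h)"
  unfolding continuous_on_sequentially
proof (intro allI ballI impI, elim conjE)
  fix x :: "nat \<Rightarrow> real" and a assume x: "x \<longlonglongrightarrow> a"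
  show "(prim T h \<circ> x) \<longlonglongrightarrow> prim T h a"
    unfolding prim_def o_def
  proof (rule integral_dominated_convergence[where w = "\<lambda>r. \<bar>h r\<bar>"])
    have "AE r in lebesgue_on {0<..<T}. r \<noteq> a"
      by (subst AE_restrict_space_iff) (auto intro!: AE_I'[of "{a}"] simp: )
    then show "AE r in lebesgue_on {0<..<T}. (\<lambda>i. if r < x i then h r else 0) \<longlonglongrightarrow> (if r < a then h r else 0)"
    proof eventually_elim
      case (elim r)
      have "eventually (\<lambda>i. (if r < x i then h r else 0) = (if r < a then h r else 0)) sequentially"
      proof (cases "r < a")
        case True
        show ?thesis using order_tendstoD(1)[OF x True] by eventually_elim (use True in simp)
      next
        case False
        then have ar: "a < r" using elim by simp
        show ?thesis using order_tendstoD(2)[OF x ar] by eventually_elim (use False in simp)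
      qed
      then show ?case by (rule tendsto_eventually)
    qed
  qed (use h prim_integrand_integrable[OF h] in auto)
qed

lemma continuous_integrable_time:
  fixes h :: "real \<Rightarrow> real"
  assumes "continuous_on {0..T} h" shows "integrable (lebesgue_on {0<..<T}) h"
proof -
  have "integrable lebesgue (\<lambda>x. indicator {0..T} x *\<^sub>R h x)"
    using continuous_imp_integrable_real[OF assms] by (subst (asm) integrable_restrict_space) auto
  from integrable_mult_indicator[OF _ this, of "{0<..<T}"]
  have "integrable lebesgue (\<lambda>x. indicator {0<..<T} x *\<^sub>R (indicator {0..T} x *\<^sub>R h x))"
    by simp
  moreover have "(\<lambda>x. indicator {0<..<T} x *\<^sub>R (indicator {0..T} x *\<^sub>R h x)) = (\<lambda>x. indicator {0<..<T} x *\<^sub>R h x)"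
    by (auto simp: indicator_def)
  ultimately show ?thesis by (subst integrable_restrict_space) auto
qed

lemma prim_eq_integral:
  fixes h :: "real \<Rightarrow> real"
  assumes h: "continuous_on {0..T} h" and s: "s \<in> {0..T}"
  shows "prim T h s = integral {0..s} h"
proof -
  let ?g = "\<lambda>r. if r < s then h r else 0"
  have "prim T h s = integral {0<..<T} ?g"
    unfolding prim_def
    by (intro lebesgue_integral_eq_integral prim_integrand_integrable continuous_integrable_time h) auto
  also have "\<dots> = integral {0<..<s} h"
    using s by (subst integral_restrict_UNIV[symmetric], subst (2) integral_restrict_UNIV[symmetric])
       (auto intro!: integral_cong)
  also have "\<dots> = integral {0..s} h"
    by (simp add: integral_open_interval_real)
  finally show ?thesis .
qed

lemma prim_has_derivative:
  fixes h :: "real \<Rightarrow> real"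
  assumes h: "continuous_on {0..T} h" and s: "s \<in> {0..T}"
  shows "(prim T h has_real_derivative h s) (at s within {0..T})"
proof (rule has_field_derivative_transform_within[where d = 1])
  show "((\<lambda>x. integral {0..x} h) has_real_derivative h s) (at s within {0..T})"
    by (rule integral_has_real_derivative[OF h s])
qed (use s prim_eq_integral[OF h] in auto)

lemma integrable_pair_bound:
  fixes F :: "real \<Rightarrow> real \<Rightarrow> real"
  assumes F: "case_prod F \<in> borel_measurable (lebesgue_on {0<..<T} \<Otimes>\<^sub>M lebesgue_on {0<..<T})"
    and n: "integrable (lebesgue_on {0<..<T}) n"
    and m: "integrable (lebesgue_on {0<..<T}) m"
    and b: "\<And>x y. x \<in> {0<..<T} \<Longrightarrow> y \<in> {0<..<T} \<Longrightarrow> \<bar>F x y\<bar> \<le> n x * m y"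
  shows "integrable (lebesgue_on {0<..<T} \<Otimes>\<^sub>M lebesgue_on {0<..<T}) (case_prod F)"
proof -
  let ?M = "lebesgue_on {0<..<T}"
  interpret P: pair_sigma_finite ?M ?M by (rule pair_sigma_finite_time)
  have [measurable]: "n \<in> borel_measurable ?M" "m \<in> borel_measurable ?M" using n m by auto
  have "integrable (?M \<Otimes>\<^sub>M ?M) (\<lambda>p. n (fst p) * m (snd p))"
  proof (rule P.Fubini_integrable)
    show "(\<lambda>p. n (fst p) * m (snd p)) \<in> borel_measurable (?M \<Otimes>\<^sub>M ?M)" by measurable
    show "integrable ?M (\<lambda>x. LINT y|?M. norm (n (fst (x, y)) * m (snd (x, y))))"
      using n m by (simp add: abs_mult)
    show "AE x in ?M. integrable ?M (\<lambda>y. n (fst (x, y)) * m (snd (x, y)))"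
      using n m by simp
  qed
  then show ?thesis
  proof (rule Bochner_Integration.integrable_bound)
    show "AE p in ?M \<Otimes>\<^sub>M ?M. norm (case_prod F p) \<le> norm (n (fst p) * m (snd p))"
      by (rule AE_I2) (use b in \<open>force simp: space_pair_measure\<close>)
  qed (rule F)
qed

lemma prim_measurable_pair:
  assumes [measurable]: "case_prod F \<in> borel_measurable (lebesgue_on {0<..<T} \<Otimes>\<^sub>M lebesgue_on {0<..<T})"
  shows "(\<lambda>(s, t). prim T (\<lambda>r. F r t) s) \<in> borel_measurable (lebesgue_on {0<..<T} \<Otimes>\<^sub>M lebesgue_on {0<..<T})"
proof -
  let ?M = "lebesgue_on {0<..<T}"
  interpret finite_measure ?M by (rule finite_measure_time)
  have [measurable]: "(\<lambda>x. x) \<in> borel_measurable ?M" by (rule time_ident_measurable)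
  have "(\<lambda>p. LINT r|?M. (if r < fst p then F r (snd p) else 0)) \<in> borel_measurable (?M \<Otimes>\<^sub>M ?M)"
  proof (rule borel_measurable_lebesgue_integral)
    have [measurable]: "(\<lambda>x. fst (fst x)) \<in> borel_measurable ((?M \<Otimes>\<^sub>M ?M) \<Otimes>\<^sub>M ?M)"
      "(\<lambda>x. snd x) \<in> borel_measurable ((?M \<Otimes>\<^sub>M ?M) \<Otimes>\<^sub>M ?M)"
      by (rule measurable_compose[OF _ time_ident_measurable], measurable)+
    have [measurable]: "(\<lambda>x. F (snd x) (snd (fst x))) \<in> borel_measurable ((?M \<Otimes>\<^sub>M ?M) \<Otimes>\<^sub>M ?M)"
      using measurable_compose[of "\<lambda>x. (snd x, snd (fst x))" "(?M \<Otimes>\<^sub>M ?M) \<Otimes>\<^sub>M ?M" "?M \<Otimes>\<^sub>M ?M" "case_prod F" borel]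
      by simp
    show "(\<lambda>(p, r). if r < fst p then F r (snd p) else 0) \<in> borel_measurable ((?M \<Otimes>\<^sub>M ?M) \<Otimes>\<^sub>M ?M)"
      unfolding case_prod_beta by measurable
  qed
  then show ?thesis unfolding prim_def by (simp add: case_prod_beta)
qed

lemma prim_measurable_snd:
  assumes F: "case_prod F \<in> borel_measurable (lebesgue_on {0<..<T} \<Otimes>\<^sub>M lebesgue_on {0<..<T})"
  shows "(\<lambda>y. prim T (\<lambda>x. F x y) s) \<in> borel_measurable (lebesgue_on {0<..<T})"
proof -
  let ?M = "lebesgue_on {0<..<T}"
  interpret finite_measure ?M by (rule finite_measure_time)
  show ?thesis
    unfolding prim_def
  proof (rule borel_measurable_lebesgue_integral)
    have 1: "(\<lambda>(x, y). F y x) \<in> borel_measurable (?M \<Otimes>\<^sub>M ?M)"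
      using measurable_compose[OF measurable_pair_swap' F] by (simp add: case_prod_beta)
    have [measurable]: "(\<lambda>x. snd x) \<in> borel_measurable (?M \<Otimes>\<^sub>M ?M)"
      by (rule measurable_compose[OF measurable_snd time_ident_measurable])
    show "(\<lambda>(x, y). if y < s then F y x else 0) \<in> borel_measurable (?M \<Otimes>\<^sub>M ?M)"
      using 1 unfolding case_prod_beta by measurable
  qed
qed

lemma prim_swap:
  assumes F: "integrable (lebesgue_on {0<..<T} \<Otimes>\<^sub>M lebesgue_on {0<..<T}) (case_prod F)"
  shows "prim T (\<lambda>y. prim T (\<lambda>x. F x y) s) t = prim T (\<lambda>x. prim T (\<lambda>y. F x y) t) s"
proof -
  let ?M = "lebesgue_on {0<..<T}"
  interpret P: pair_sigma_finite ?M ?M by (rule pair_sigma_finite_time)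
  have [measurable]: "(\<lambda>x. x) \<in> borel_measurable ?M" by (rule time_ident_measurable)
  have [measurable]: "case_prod F \<in> borel_measurable (?M \<Otimes>\<^sub>M ?M)" using F by auto
  \<comment> \<open>Both sides are the integral of \<open>F\<close> over the rectangle \<open>x < s\<close>, \<open>y < t\<close>.\<close>
  let ?G = "\<lambda>x y. if y < t then (if x < s then F x y else 0) else 0"
  have [measurable]: "(\<lambda>x. fst x) \<in> borel_measurable (?M \<Otimes>\<^sub>M ?M)" "(\<lambda>x. snd x) \<in> borel_measurable (?M \<Otimes>\<^sub>M ?M)"
    by (rule measurable_compose[OF _ time_ident_measurable], measurable)+
  have "integrable (?M \<Otimes>\<^sub>M ?M) (case_prod ?G)"
    by (rule Bochner_Integration.integrable_bound[OF F]) (measurable, auto)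
  note P.Fubini_integral[OF this]
  moreover have "(LINT x|?M. ?G x y) = (if y < t then (LINT x|?M. (if x < s then F x y else 0)) else 0)" for y
    by simp
  moreover have "(LINT y|?M. ?G x y) = (if x < s then (LINT y|?M. (if y < t then F x y else 0)) else 0)" for x
    by (cases "x < s") (auto simp: if_distrib cong: if_cong)
  ultimately show ?thesis unfolding prim_def by simp
qed


text \<open>
  The derivative of \<open>\<mu>(s,t) - \<mu>(t,s)\<close> in the direction \<open>(1,1)\<close> vanishes because both partial derivatives are
  symmetric.  Every point is joined to an axis, where \<open>\<mu>\<close> vanishes, by a line in this direction.  So \<open>\<mu>\<close> is
  symmetric, and exchanging the variables turns one partial derivative into the other.
\<close>

lemma symmetric_derivatives_diagonal:
  fixes \<mu> \<alpha> \<beta> :: "real \<Rightarrow> real \<Rightarrow> real"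
  assumes \<alpha>: "continuous_on ({0..T} \<times> {0..T}) (case_prod \<alpha>)"
    and \<beta>: "continuous_on ({0..T} \<times> {0..T}) (case_prod \<beta>)"
    and sym: "\<And>s t. s \<in> {0..T} \<Longrightarrow> t \<in> {0..T} \<Longrightarrow> \<alpha> s t = \<alpha> t s"
      "\<And>s t. s \<in> {0..T} \<Longrightarrow> t \<in> {0..T} \<Longrightarrow> \<beta> s t = \<beta> t s"
    and d1: "\<And>s t. s \<in> {0..T} \<Longrightarrow> t \<in> {0..T} \<Longrightarrow>
        ((\<lambda>s. \<mu> s t) has_real_derivative \<alpha> s t) (at s within {0..T})"
    and d2: "\<And>s t. s \<in> {0..T} \<Longrightarrow> t \<in> {0..T} \<Longrightarrow>
        (\<mu> s has_real_derivative \<beta> s t) (at t within {0..T})"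
    and zero: "\<And>t. t \<in> {0..T} \<Longrightarrow> \<mu> 0 t = 0" "\<And>t. t \<in> {0..T} \<Longrightarrow> \<mu> t 0 = 0"
    and T: "T > 0" and st: "s \<in> {0..T}" "t \<in> {0..T}"
  shows "\<alpha> s t = \<beta> s t"
proof -
  have total: "((\<lambda>(x, y). \<mu> x y) has_derivative (\<lambda>(h, k). \<alpha> x y * h + \<beta> x y * k))
      (at (x, y) within {0..T} \<times> {0..T})" if xy: "x \<in> {0..T}" "y \<in> {0..T}" for x y
  proof -
    have "((\<lambda>(x, y). \<mu> x y) has_derivative
        (\<lambda>(h, k). \<alpha> x y * h + blinfun_apply (blinfun_mult_right (\<beta> x y)) k))
        (at (x, y) within {0..T} \<times> {0..T})"
    proof (rule has_derivative_partialsI)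
      show "((\<lambda>x. \<mu> x y) has_derivative (*) (\<alpha> x y)) (at x within {0..T})"
        using d1[OF xy] by (simp add: has_field_derivative_def)
      show "(\<mu> x has_derivative blinfun_apply (blinfun_mult_right (\<beta> x y))) (at y within {0..T})"
        if "x \<in> {0..T}" "y \<in> {0..T}" for x y
        using d2[OF that] by (simp add: has_field_derivative_def)
      have "continuous (at (x, y) within {0..T} \<times> {0..T}) (\<lambda>p. case_prod \<beta> p)"
        using \<beta> xy by (auto simp: continuous_on_eq_continuous_within)
      then have "continuous (at (x, y) within {0..T} \<times> {0..T}) (\<lambda>p. blinfun_mult_right (case_prod \<beta> p))"
        by (rule bounded_linear.continuous[OF bounded_linear_blinfun_mult_right])
      then show "continuous (at (x, y) within {0..T} \<times> {0..T}) (\<lambda>(x, y). blinfun_mult_right (\<beta> x y))"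
        by (simp add: split_def)
    qed (use xy in auto)
    then show ?thesis by simp
  qed
  have diag: "((\<lambda>h. \<mu> (p + h) (q + h)) has_real_derivative \<alpha> (p + h) (q + h) + \<beta> (p + h) (q + h))
      (at h within {0..r})" if "p \<ge> 0" "q \<ge> 0" "p + r \<le> T" "q + r \<le> T" "h \<in> {0..r}" for p q r h
  proof -
    have "((\<lambda>h. (p + h, q + h)) has_derivative (\<lambda>k. (k, k))) (at h within {0..r})"
      by (auto intro!: derivative_eq_intros)
    moreover have "((\<lambda>(x, y). \<mu> x y) has_derivative (\<lambda>(k, l). \<alpha> (p + h) (q + h) * k + \<beta> (p + h) (q + h) * l))
      (at (p + h, q + h) within (\<lambda>h. (p + h, q + h)) ` {0..r})"
      using that by (intro has_derivative_subset[OF total]) auto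
    ultimately have "((\<lambda>(x, y). \<mu> x y) \<circ> (\<lambda>h. (p + h, q + h)) has_derivative
        (\<lambda>(k, l). \<alpha> (p + h) (q + h) * k + \<beta> (p + h) (q + h) * l) \<circ> (\<lambda>k. (k, k))) (at h within {0..r})"
      by (rule diff_chain_within)
    then have "((\<lambda>h. \<mu> (p + h) (q + h)) has_derivative
        (\<lambda>k. \<alpha> (p + h) (q + h) * k + \<beta> (p + h) (q + h) * k)) (at h within {0..r})"
      by (simp add: o_def)
    moreover have "(\<lambda>k. \<alpha> (p + h) (q + h) * k + \<beta> (p + h) (q + h) * k) =
        (*) (\<alpha> (p + h) (q + h) + \<beta> (p + h) (q + h))"
      by (rule ext) (simp only: distrib_right)
    ultimately show ?thesis unfolding has_field_derivative_def by (simp only:)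
  qed
  have sym\<mu>: "\<mu> x y = \<mu> y x" if "0 \<le> x" "x \<le> y" "y \<le> T" for x y
  proof -
    \<comment> \<open>The line through \<open>(x, y)\<close> in the direction \<open>(1,1)\<close> meets the axis at \<open>(0, y - x)\<close>.\<close>
    let ?f = "\<lambda>h. \<mu> (0 + h) (y - x + h) - \<mu> (y - x + h) (0 + h)"
    have "(?f has_real_derivative 0) (at h within {0..x})" if h: "h \<in> {0..x}" for h
    proof -
      have "(?f has_real_derivative (\<alpha> (0 + h) (y - x + h) + \<beta> (0 + h) (y - x + h))
          - (\<alpha> (y - x + h) (0 + h) + \<beta> (y - x + h) (0 + h))) (at h within {0..x})"
        using \<open>0 \<le> x\<close> \<open>x \<le> y\<close> \<open>y \<le> T\<close> h by (intro DERIV_diff diag) auto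
      moreover have "\<alpha> (0 + h) (y - x + h) = \<alpha> (y - x + h) (0 + h)" "\<beta> (0 + h) (y - x + h) = \<beta> (y - x + h) (0 + h)"
        using \<open>0 \<le> x\<close> \<open>x \<le> y\<close> \<open>y \<le> T\<close> h by (intro sym; auto)+
      ultimately show ?thesis by simp
    qed
    then have "\<exists>c. \<forall>h\<in>{0..x}. ?f h = c"
      by (intro has_field_derivative_zero_constant) auto
    then obtain c where c: "\<forall>h\<in>{0..x}. ?f h = c" by blast
    have "?f x = ?f 0" using bspec[OF c, of x] bspec[OF c, of 0] \<open>0 \<le> x\<close> by simp
    then show ?thesis using zero[of "y - x"] that by auto
  qed
  then have sym\<mu>': "\<mu> x y = \<mu> y x" if "x \<in> {0..T}" "y \<in> {0..T}" for x y
    using that by (metis atLeastAtMost_iff linear)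
  have "((\<lambda>s. \<mu> s t) has_real_derivative \<beta> t s) (at s within {0..T})"
    by (rule has_field_derivative_transform_within[OF d2[OF st(2,1)], where d = 1])
       (use st sym\<mu>' in auto)
  note d = this d1[OF st]
  have "\<alpha> s t = \<beta> t s"
    by (rule vector_derivative_unique_within_closed_interval[OF T, of s "\<lambda>s. \<mu> s t"])
       (use st d in \<open>simp_all add: has_real_derivative_iff_has_vector_derivative\<close>)
  then show ?thesis using sym(2)[OF st] by simp
qed

text \<open>
  The kernel form of energy conservation for \<open>u'' + \<A>u = 0\<close> with zero initial data.  When \<open>A(s,t) = a(u(s),u(t))\<close> and
  \<open>B(s,t) = b(u(s),u(t))\<close>, the number \<open>\<alpha>(t,t)\<close> is \<open>a(X(t),X(t))\<close> for the primitive \<open>X\<close> of \<open>u\<close>, and the conclusion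
  \<open>\<alpha> = - B\<close> of the previous lemma says that \<open>b(u,u) + a(X,X) = 0\<close>.
\<close>

lemma energy_identity_imp_zero:
  fixes A B :: "real \<Rightarrow> real \<Rightarrow> real"
  assumes T: "T > 0"
    and meas: "case_prod A \<in> borel_measurable (lebesgue_on {0<..<T} \<Otimes>\<^sub>M lebesgue_on {0<..<T})"
    and n: "integrable (lebesgue_on {0<..<T}) n"
    and bound: "\<And>s t. s \<in> {0<..<T} \<Longrightarrow> t \<in> {0<..<T} \<Longrightarrow> \<bar>A s t\<bar> \<le> n s * n t"
    and symA: "\<And>s t. A s t = A t s"
    and posA: "\<And>t. t \<in> {0..T} \<Longrightarrow> 0 \<le> prim T (\<lambda>\<tau>. prim T (\<lambda>r. A r \<tau>) t) t"
    and contB: "continuous_on ({0..T} \<times> {0..T}) (case_prod B)"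
    and symB: "\<And>s t. s \<in> {0..T} \<Longrightarrow> t \<in> {0..T} \<Longrightarrow> B s t = B t s"
    and posB: "\<And>t. t \<in> {0..T} \<Longrightarrow> 0 \<le> B t t"
    and eq: "AE \<tau> in lebesgue_on {0<..<T}. \<forall>s\<in>{0..T}. B s \<tau> = - prim T (prim T (\<lambda>r. A r \<tau>)) s"
    and t: "t \<in> {0..T}"
  shows "B t t = 0"
proof -
  let ?M = "lebesgue_on {0<..<T}"
  have intA: "integrable (?M \<Otimes>\<^sub>M ?M) (case_prod A)"
    by (rule integrable_pair_bound[OF meas n n bound])
  define g where "g \<sigma> \<tau> = prim T (\<lambda>r. A r \<tau>) \<sigma>" for \<sigma> \<tau>
  define \<alpha> where "\<alpha> s t = prim T (\<lambda>\<tau>. g s \<tau>) t" for s t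
  interpret finite_measure ?M by (rule finite_measure_time)
  have secA: "integrable ?M (\<lambda>r. A r \<tau>)" if "\<tau> \<in> {0<..<T}" for \<tau>
  proof (rule Bochner_Integration.integrable_bound)
    show "integrable ?M (\<lambda>r. n r * n \<tau>)" using n by simp
    show "(\<lambda>r. A r \<tau>) \<in> borel_measurable ?M"
      using measurable_compose[OF measurable_Pair2'[of \<tau> ?M ?M] meas] that by simp
    show "AE r in ?M. norm (A r \<tau>) \<le> norm (n r * n \<tau>)"
      by (rule AE_I2) (use that bound in fastforce)
  qed
  have gmeas: "(\<lambda>(s, t). g s t) \<in> borel_measurable (?M \<Otimes>\<^sub>M ?M)"
    unfolding g_def by (rule prim_measurable_pair[OF meas])
  define I where "I = (LINT r|?M. \<bar>n r\<bar>)"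
  have gbound: "\<bar>g \<sigma> \<tau>\<bar> \<le> I * \<bar>n \<tau>\<bar>" if "\<tau> \<in> {0<..<T}" for \<sigma> \<tau>
  proof -
    have "\<bar>g \<sigma> \<tau>\<bar> \<le> (LINT r|?M. \<bar>A r \<tau>\<bar>)" unfolding g_def by (rule prim_bound[OF secA[OF that]])
    also have "\<dots> \<le> (LINT r|?M. \<bar>n r\<bar> * \<bar>n \<tau>\<bar>)"
    proof (rule integral_mono)
      show "\<bar>A r \<tau>\<bar> \<le> \<bar>n r\<bar> * \<bar>n \<tau>\<bar>" if "r \<in> space ?M" for r
        using bound[of r \<tau>] that \<open>\<tau> \<in> _\<close> by (simp flip: abs_mult)
    qed (use secA[OF that] n in auto)
    finally show ?thesis by (simp add: I_def)
  qed
  have gint: "integrable (?M \<Otimes>\<^sub>M ?M) (case_prod g)"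
    by (rule integrable_pair_bound[where n = "\<lambda>_. I" and m = "\<lambda>\<tau>. \<bar>n \<tau>\<bar>"])
       (use gmeas gbound n in auto)
  have gsec: "integrable ?M (\<lambda>\<tau>. g s \<tau>)" for s
  proof (rule Bochner_Integration.integrable_bound)
    show "integrable ?M (\<lambda>\<tau>. I * \<bar>n \<tau>\<bar>)" using n by simp
    show "(\<lambda>\<tau>. g s \<tau>) \<in> borel_measurable ?M"
      unfolding g_def by (rule prim_measurable_snd[OF meas])
    show "AE \<tau> in ?M. norm (g s \<tau>) \<le> norm (I * \<bar>n \<tau>\<bar>)"
      by (rule AE_I2) (use gbound in \<open>auto intro: order_trans[OF _ abs_ge_self]\<close>)
  qed
  have sym\<alpha>: "\<alpha> s t = \<alpha> t s" for s t
    unfolding \<alpha>_def g_def using prim_swap[OF intA, of t s] symA by simp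
  \<comment> \<open>Both increments of \<open>\<alpha>\<close> are controlled by increments of the primitive of \<open>|n|\<close>, which is continuous.\<close>
  have lip1: "\<bar>\<alpha> s t - \<alpha> s' t\<bar> \<le> I * \<bar>prim T (\<lambda>r. \<bar>n r\<bar>) s - prim T (\<lambda>r. \<bar>n r\<bar>) s'\<bar>" if "s' \<le> s" for s s' t
  proof -
    have "\<bar>\<alpha> s t - \<alpha> s' t\<bar> = \<bar>prim T (\<lambda>\<tau>. g s \<tau> - g s' \<tau>) t\<bar>"
      unfolding \<alpha>_def by (simp only: prim_diff[OF gsec gsec])
    also have "\<dots> \<le> (LINT \<tau>|?M. \<bar>g s \<tau> - g s' \<tau>\<bar>)"
      by (intro prim_bound Bochner_Integration.integrable_diff gsec)
    also have "\<dots> \<le> (LINT \<tau>|?M. \<bar>n \<tau>\<bar> * \<bar>prim T (\<lambda>r. \<bar>n r\<bar>) s - prim T (\<lambda>r. \<bar>n r\<bar>) s'\<bar>)"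
    proof (rule integral_mono)
      fix \<tau> assume "\<tau> \<in> space ?M" then have \<tau>: "\<tau> \<in> {0<..<T}" by simp
      let ?k = "\<lambda>h r. (if r < s then h r else 0) - (if r < s' then h r else (0::real))"
      have int1: "integrable ?M (\<lambda>r. \<bar>?k (\<lambda>r. A r \<tau>) r\<bar>)"
        by (intro integrable_abs Bochner_Integration.integrable_diff prim_integrand_integrable secA[OF \<tau>])
      have int2: "integrable ?M (\<lambda>r. \<bar>n \<tau>\<bar> * ?k (\<lambda>r. \<bar>n r\<bar>) r)"
        by (intro integrable_mult_right Bochner_Integration.integrable_diff prim_integrand_integrable
            integrable_abs n)
      have "\<bar>g s \<tau> - g s' \<tau>\<bar> = \<bar>LINT r|?M. ?k (\<lambda>r. A r \<tau>) r\<bar>"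
        unfolding g_def prim_def using prim_integrand_integrable[OF secA[OF \<tau>]] by simp
      also have "\<dots> \<le> (LINT r|?M. \<bar>?k (\<lambda>r. A r \<tau>) r\<bar>)" by (rule integral_abs_bound)
      also have "\<dots> \<le> (LINT r|?M. \<bar>n \<tau>\<bar> * ?k (\<lambda>r. \<bar>n r\<bar>) r)"
      proof (rule Bochner_Integration.integral_mono[OF int1 int2])
        fix r assume "r \<in> space ?M"
        then have r: "r \<in> {0<..<T}" by simp
        have "\<bar>A r \<tau>\<bar> \<le> \<bar>n r * n \<tau>\<bar>" by (rule order_trans[OF bound[OF r \<tau>] abs_ge_self])
        also have "\<dots> = \<bar>n \<tau>\<bar> * \<bar>n r\<bar>" by (simp only: abs_mult mult.commute)
        finally have b: "\<bar>A r \<tau>\<bar> \<le> \<bar>n \<tau>\<bar> * \<bar>n r\<bar>" .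
        show "\<bar>?k (\<lambda>r. A r \<tau>) r\<bar> \<le> \<bar>n \<tau>\<bar> * ?k (\<lambda>r. \<bar>n r\<bar>) r"
          by (cases "r < s'"; cases "r < s") (use b \<open>s' \<le> s\<close> in simp_all)
      qed
      also have "\<dots> = \<bar>n \<tau>\<bar> * (prim T (\<lambda>r. \<bar>n r\<bar>) s - prim T (\<lambda>r. \<bar>n r\<bar>) s')"
        unfolding prim_def using prim_integrand_integrable[OF integrable_abs[OF n]] by simp
      also have "\<dots> \<le> \<bar>n \<tau>\<bar> * \<bar>prim T (\<lambda>r. \<bar>n r\<bar>) s - prim T (\<lambda>r. \<bar>n r\<bar>) s'\<bar>"
        by (intro mult_left_mono) auto
      finally show "\<bar>g s \<tau> - g s' \<tau>\<bar> \<le> \<bar>n \<tau>\<bar> * \<bar>prim T (\<lambda>r. \<bar>n r\<bar>) s - prim T (\<lambda>r. \<bar>n r\<bar>) s'\<bar>" .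
    qed (use gsec n in auto)
    finally show ?thesis by (simp add: I_def)
  qed
  have lip: "\<bar>\<alpha> s t - \<alpha> s' t\<bar> \<le> I * \<bar>prim T (\<lambda>r. \<bar>n r\<bar>) s - prim T (\<lambda>r. \<bar>n r\<bar>) s'\<bar>" for s s' t
  proof (cases "s' \<le> s")
    case True then show ?thesis by (rule lip1)
  next
    case False
    then show ?thesis using lip1[of s s' t] by (simp add: abs_minus_commute)
  qed
  have cont\<alpha>: "continuous_on UNIV (\<lambda>p. \<alpha> (fst p) (snd p))"
    unfolding continuous_on_def
  proof (intro ballI)
    fix p :: "real \<times> real"
    let ?N = "prim T (\<lambda>r. \<bar>n r\<bar>)"
    have N: "isCont ?N x" for x
      using prim_continuous[OF integrable_abs[OF n]] by (simp add: continuous_on_eq_continuous_at)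
    have "((\<lambda>q. ?N (fst q)) \<longlongrightarrow> ?N (fst p)) (at p)"
      by (rule isCont_tendsto_compose[OF N]) (intro tendsto_fst tendsto_ident_at)
    moreover have "((\<lambda>q. ?N (snd q)) \<longlongrightarrow> ?N (snd p)) (at p)"
      by (rule isCont_tendsto_compose[OF N]) (intro tendsto_snd tendsto_ident_at)
    ultimately have "((\<lambda>q. I * \<bar>?N (fst q) - ?N (fst p)\<bar> + I * \<bar>?N (snd q) - ?N (snd p)\<bar>) \<longlongrightarrow>
        I * \<bar>?N (fst p) - ?N (fst p)\<bar> + I * \<bar>?N (snd p) - ?N (snd p)\<bar>) (at p)"
      by (intro tendsto_intros)
    then have lim: "((\<lambda>q. I * \<bar>?N (fst q) - ?N (fst p)\<bar> + I * \<bar>?N (snd q) - ?N (snd p)\<bar>) \<longlongrightarrow> 0) (at p)"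
      by simp
    have "((\<lambda>q. \<alpha> (fst q) (snd q) - \<alpha> (fst p) (snd p)) \<longlongrightarrow> 0) (at p)"
    proof (rule Lim_null_comparison[OF _ lim], rule always_eventually, rule allI)
      fix q :: "real \<times> real"
      show "norm (\<alpha> (fst q) (snd q) - \<alpha> (fst p) (snd p))
          \<le> I * \<bar>?N (fst q) - ?N (fst p)\<bar> + I * \<bar>?N (snd q) - ?N (snd p)\<bar>"
        using lip[of "fst q" "snd q" "fst p"] lip[of "snd q" "fst p" "snd p"]
          sym\<alpha>[of "fst p" "snd q"] sym\<alpha>[of "fst p" "snd p"] by simp
    qed
    then show "((\<lambda>p. \<alpha> (fst p) (snd p)) \<longlongrightarrow> \<alpha> (fst p) (snd p)) (at p within UNIV)"
      by (rule LIM_zero_cancel)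
  qed
  have cont\<alpha>': "continuous_on ({0..T} \<times> {0..T}) (case_prod \<alpha>)"
    unfolding case_prod_unfold by (rule continuous_on_subset[OF cont\<alpha> subset_UNIV])
  have sec\<alpha>: "continuous_on {0..T} (\<lambda>s. \<alpha> s t)" for t
  proof -
    have "continuous_on {0..T} (\<lambda>s. (\<lambda>p. \<alpha> (fst p) (snd p)) (s, t))"
      by (rule continuous_on_compose2[OF cont\<alpha>, of "{0..T}" "\<lambda>s. (s, t)",
            OF continuous_on_Pair[OF continuous_on_id continuous_on_const]]) simp
    then show ?thesis by simp
  qed
  have secB: "continuous_on {0..T} (B s)" if "s \<in> {0..T}" for s
  proof -
    have "continuous_on {0..T} (\<lambda>t. case_prod B (s, t))"
      by (rule continuous_on_compose2[OF contB, of "{0..T}" "\<lambda>t. (s, t)",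
            OF continuous_on_Pair[OF continuous_on_const continuous_on_id]]) (use that in auto)
    then show ?thesis by simp
  qed
  define \<mu> where "\<mu> s t = prim T (\<lambda>\<sigma>. \<alpha> \<sigma> t) s" for s t
  \<comment> \<open>The equation holds for almost every \<open>\<tau>\<close> only, but integrating it over \<open>\<tau> < t\<close> gives an identity for all \<open>s\<close> and \<open>t\<close>.\<close>
  have \<mu>: "\<mu> s t = - prim T (B s) t" if s: "s \<in> {0..T}" for s t
  proof -
    have "AE \<tau> in ?M. B s \<tau> = - prim T (\<lambda>\<sigma>. g \<sigma> \<tau>) s"
      using eq by eventually_elim (use s in \<open>simp add: g_def\<close>)
    moreover have "integrable ?M (\<lambda>\<tau>. - prim T (\<lambda>\<sigma>. g \<sigma> \<tau>) s)"
    proof -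
      interpret P: pair_sigma_finite ?M ?M by (rule pair_sigma_finite_time)
      have [measurable]: "(\<lambda>x. fst x) \<in> borel_measurable (?M \<Otimes>\<^sub>M ?M)"
        by (rule measurable_compose[OF _ time_ident_measurable], measurable)
      have [measurable]: "case_prod g \<in> borel_measurable (?M \<Otimes>\<^sub>M ?M)" using gmeas by simp
      have "integrable (?M \<Otimes>\<^sub>M ?M) (\<lambda>(\<sigma>, \<tau>). if \<sigma> < s then g \<sigma> \<tau> else 0)"
        by (rule Bochner_Integration.integrable_bound[OF gint]) (measurable, auto)
      from P.integrable_snd[OF this] show ?thesis unfolding prim_def by simp
    qed
    ultimately have "prim T (B s) t = prim T (\<lambda>\<tau>. - prim T (\<lambda>\<sigma>. g \<sigma> \<tau>) s) t"
      by (intro prim_cong_AE continuous_integrable_time[OF secB[OF s]])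
    also have "\<dots> = - \<mu> s t"
      unfolding prim_uminus \<mu>_def \<alpha>_def by (subst prim_swap[OF gint]) simp
    finally show ?thesis by simp
  qed
  have "\<alpha> t t = - B t t"
  proof (rule symmetric_derivatives_diagonal[of T \<alpha> "\<lambda>s t. - B s t" \<mu>])
    show "continuous_on ({0..T} \<times> {0..T}) (\<lambda>(s, t). - B s t)"
      using continuous_on_minus[OF contB] by (simp add: case_prod_beta)
    show "((\<lambda>s. \<mu> s t) has_real_derivative \<alpha> s t) (at s within {0..T})" if "s \<in> {0..T}" for s t
      unfolding \<mu>_def by (rule prim_has_derivative[OF sec\<alpha> that])
    show "(\<mu> s has_real_derivative - B s t) (at t within {0..T})" if "s \<in> {0..T}" "t \<in> {0..T}" for s t
    proof -
      have "((\<lambda>t. - prim T (B s) t) has_real_derivative - B s t) (at t within {0..T})"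
        by (intro DERIV_minus prim_has_derivative secB that)
      moreover have "\<mu> s = (\<lambda>t. - prim T (B s) t)" using \<mu>[OF that(1)] by auto
      ultimately show ?thesis by simp
    qed
    show "\<mu> 0 t = 0" for t unfolding \<mu>_def by (simp add: prim_0)
    show "\<mu> t 0 = 0" if "t \<in> {0..T}" for t using \<mu>[OF that] by (simp add: prim_0)
  qed (use cont\<alpha>' sym\<alpha> symB T t in auto)
  moreover have "0 \<le> \<alpha> t t" unfolding \<alpha>_def g_def by (rule posA[OF t])
  ultimately show ?thesis using posB[OF t] by simp
qed

section \<open>Distributional derivatives of scalar functions\<close>

text \<open>
  The classical form of the fundamental lemma: the box approximations are themselves test functions.
\<close>

lemma AE_zero_if_orthogonal_to_test_functions:
  fixes f :: "'a::euclidean_space \<Rightarrow> real"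
  assumes S: "open S"
    and loc: "\<And>a b. cbox a b \<subseteq> S \<Longrightarrow> integrable lebesgue (\<lambda>x. indicator (cbox a b) x * f x)"
    and orth: "\<And>\<phi>. \<phi> \<in> test_functions S \<Longrightarrow> (LINT x|lebesgue_on S. f x * \<phi> x) = 0"
  shows "AE x in lebesgue_on S. f x = 0"
proof (rule AE_zero_if_orthogonal_to_box_approximations[OF S loc])
  fix a b :: 'a assume ab: "cbox a b \<subseteq> S"
  have Sm: "S \<in> sets lebesgue" using lebesgue_openin[of UNIV S] S by simp
  have out: "box_approx m a b x = 0" if "x \<notin> cbox a b" for m x
  proof -
    have "x \<notin> box a b" using that box_subset_cbox[of a b] by blast
    then show ?thesis by (simp add: box_approx_def box_bump_zero)
  qed
  have "(LINT x|lebesgue. (indicator (cbox a b) x * f x) * box_approx m a b x) = 0" for m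
  proof -
    have eq: "(indicator (cbox a b) x * f x) * box_approx m a b x =
        indicator S x *\<^sub>R (f x * box_approx m a b x)" for x
      using ab out[of x m] by (cases "x \<in> cbox a b") (auto simp: indicator_def)
    have "(LINT x|lebesgue. (indicator (cbox a b) x * f x) * box_approx m a b x) =
        (LINT x|lebesgue_on S. f x * box_approx m a b x)"
      by (subst integral_restrict_space) (use Sm in simp, simp only: eq)
    also have "\<dots> = 0" by (rule orth[OF box_approx_test_function[OF ab]])
    finally show ?thesis .
  qed
  moreover have "box_approx m a b \<in> borel_measurable lebesgue" for m
    using box_approx_test_function[of a b UNIV m]
    by (intro continuous_imp_lebesgue_measurable Ck_continuous[of 0]) (simp only: test_functions_def, blast)
  ultimately show "\<exists>\<psi>. (\<forall>m::nat. \<psi> m \<in> borel_measurable lebesgue) \<and>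
        (\<forall>m x. \<bar>\<psi> m x\<bar> \<le> 1) \<and> (\<forall>x. (\<lambda>m. \<psi> m x) \<longlonglongrightarrow> indicator (box a b) x) \<and>
        (\<forall>m. (LINT x|lebesgue. (indicator (cbox a b) x * f x) * \<psi> m x) = 0)"
    using box_approx_bounds box_approx_tendsto_indicator by (intro exI[of _ "\<lambda>m. box_approx m a b"]) auto
qed

lemma test_function_continuous: "\<phi> \<in> test_functions S \<Longrightarrow> continuous_on UNIV \<phi>"
  using Ck_continuous[of 0 \<phi>] by (simp only: test_functions_def) blast

text \<open>
  Vanishing mean makes the primitive vanish to the right of the support as well.
\<close>

lemma test_function_integral_is_test_function:
  assumes \<psi>: "\<psi> \<in> test_functions {0<..<T::real}" and T: "T > 0"
    and mean: "(LINT r|lebesgue_on {0<..<T}. \<psi> r) = 0"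
  shows "prim T \<psi> \<in> test_functions {0<..<T}" "(prim T \<psi> has_real_derivative \<psi> x) (at x)"
proof -
  obtain K where K: "compact K" "K \<subseteq> {0<..<T}" "\<And>x. x \<notin> K \<Longrightarrow> \<psi> x = 0"
    and Ck: "\<And>k. Ck k \<psi>" using \<psi> unfolding test_functions_def by blast
  obtain a b where ab: "0 < a" "b < T" "K \<subseteq> {a..b}" "a \<le> b"
  proof (cases "K = {}")
    case True then show ?thesis using that[of "T/2" "T/2"] T by auto
  next
    case False
    obtain a where a: "a \<in> K" "\<And>y. y \<in> K \<Longrightarrow> a \<le> y" using compact_attains_inf[OF K(1) False] by blast
    obtain b where b: "b \<in> K" "\<And>y. y \<in> K \<Longrightarrow> y \<le> b" using compact_attains_sup[OF K(1) False] by blast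
    show ?thesis using that[of a b] a b K(2) by fastforce
  qed
  have cont: "continuous_on {0..T} \<psi>" using Ck_continuous[OF Ck] continuous_on_subset by blast
  have left: "prim T \<psi> x = 0" if "x \<le> a" for x
    unfolding prim_def
  proof (subst Bochner_Integration.integral_cong[OF refl, where g = "\<lambda>_. 0"])
    show "(if r < x then \<psi> r else 0) = 0" for r using K(3)[of r] ab(3) that by fastforce
  qed simp
  have right: "prim T \<psi> x = 0" if "x > b" for x
    unfolding prim_def
  proof (subst Bochner_Integration.integral_cong[OF refl, where g = \<psi>])
    show "(if r < x then \<psi> r else 0) = \<psi> r" for r using K(3)[of r] ab(3) that by fastforce
  qed (rule mean)
  show D: "(prim T \<psi> has_real_derivative \<psi> x) (at x)" for x
  proof -
    consider "x < a" | "x > b" | "0 < x" "x < T" using ab by linarith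
    then show ?thesis
    proof cases
      case 1
      have ev: "\<forall>\<^sub>F y in nhds x. prim T \<psi> y = 0"
        using eventually_nhds_in_open[of "{..<a}" x] 1 left by (auto elim!: eventually_mono)
      have "\<psi> x = 0" using K(3)[of x] ab(3) 1 by fastforce
      then show ?thesis using DERIV_cong_ev[OF refl ev refl, of 0] by simp
    next
      case 2
      have ev: "\<forall>\<^sub>F y in nhds x. prim T \<psi> y = 0"
        using eventually_nhds_in_open[of "{b<..}" x] 2 right by (auto elim!: eventually_mono)
      have "\<psi> x = 0" using K(3)[of x] ab(3) 2 by fastforce
      then show ?thesis using DERIV_cong_ev[OF refl ev refl, of 0] by simp
    next
      case 3
      then show ?thesis using prim_has_derivative[OF cont, of x]
        at_within_interior[of x "{0..T}"] by simp
    qed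
  qed
  have "Ck k (prim T \<psi>)" for k
  proof -
    have "prim T \<psi> differentiable_on UNIV"
      using D by (auto simp: differentiable_on_def real_differentiable_def)
    moreover have "frechet_derivative (prim T \<psi>) (at x) 1 = \<psi> x" for x
      using frechet_derivative_real[OF D, of x 1] by simp
    ultimately have "Ck (Suc k) (prim T \<psi>)" using Ck by simp
    then show ?thesis by (rule Ck_Suc_imp_Ck)
  qed
  moreover have "prim T \<psi> x = 0" if "x \<notin> {a..b}" for x using that left[of x] right[of x] by force
  ultimately show "prim T \<psi> \<in> test_functions {0<..<T}"
    unfolding test_functions_def using ab by (auto intro!: exI[of _ "{a..b}"])
qed

lemma test_function_bounded:
  assumes "\<phi> \<in> test_functions S" obtains C where "\<And>x. \<bar>\<phi> x\<bar> \<le> C" "C \<ge> 0"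
proof -
  obtain K where K: "compact K" "\<And>x. x \<notin> K \<Longrightarrow> \<phi> x = 0"
    using assms unfolding test_functions_def by blast
  have "compact (\<phi> ` K)"
    by (rule compact_continuous_image[OF continuous_on_subset[OF test_function_continuous[OF assms]] K(1)]) simp
  then obtain C where C: "\<And>y. y \<in> \<phi> ` K \<Longrightarrow> norm y \<le> C"
    using compact_imp_bounded bounded_iff by metis
  have "\<bar>\<phi> x\<bar> \<le> max C 0" for x
    using K(2)[of x] C[of "\<phi> x"] by (cases "x \<in> K") auto
  then show thesis using that by fastforce
qed

lemma Ck_deriv: "Ck (Suc k) \<phi> \<Longrightarrow> Ck k (deriv \<phi>)" for \<phi> :: "real \<Rightarrow> real"
proof -
  assume a: "Ck (Suc k) \<phi>"
  then have "\<phi> differentiable at x" for x by (auto simp: differentiable_on_def)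
  then have D: "(\<phi> has_real_derivative deriv \<phi> x) (at x)" for x
    using DERIV_deriv_iff_real_differentiable by blast
  have "frechet_derivative \<phi> (at x) 1 = deriv \<phi> x" for x
    using frechet_derivative_real[OF D, of x 1] by simp
  then show ?thesis using a by simp
qed

lemma deriv_test_function:
  assumes "\<phi> \<in> test_functions (S::real set)" shows "deriv \<phi> \<in> test_functions S"
proof -
  obtain K where K: "compact K" "K \<subseteq> S" "\<And>x. x \<notin> K \<Longrightarrow> \<phi> x = 0" and C: "\<And>k. Ck k \<phi>"
    using assms unfolding test_functions_def by blast
  have "deriv \<phi> x = 0" if "x \<notin> K" for x
  proof -
    have "open (- K)" using compact_imp_closed[OF K(1)] by auto
    then have ev: "\<forall>\<^sub>F y in nhds x. \<phi> y = 0"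
      using eventually_nhds_in_open[of "- K" x] that K(3) by (auto elim!: eventually_mono)
    show ?thesis using deriv_cong_ev[OF ev refl] by simp
  qed
  then show ?thesis unfolding test_functions_def using K Ck_deriv[OF C] by blast
qed

lemma integrable_times_test_function:
  fixes h :: "real \<Rightarrow> real"
  assumes h: "integrable (lebesgue_on {0<..<T}) h" and \<phi>: "\<phi> \<in> test_functions S"
  shows "integrable (lebesgue_on {0<..<T}) (\<lambda>t. h t * \<phi> t)"
proof -
  obtain C where C: "\<And>x. \<bar>\<phi> x\<bar> \<le> C" "C \<ge> 0" using test_function_bounded[OF \<phi>] by blast
  show ?thesis
  proof (rule Bochner_Integration.integrable_bound)
    show "integrable (lebesgue_on {0<..<T}) (\<lambda>t. C * h t)" using h by simp
    show "(\<lambda>t. h t * \<phi> t) \<in> borel_measurable (lebesgue_on {0<..<T})"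
      by (rule borel_measurable_times[OF borel_measurable_integrable[OF h]])
         (rule borel_imp_measurable_lebesgue_on, rule borel_measurable_continuous_onI,
          rule test_function_continuous[OF \<phi>])
    show "AE t in lebesgue_on {0<..<T}. norm (h t * \<phi> t) \<le> norm (C * h t)"
    proof (rule AE_I2)
      fix t
      show "norm (h t * \<phi> t) \<le> norm (C * h t)"
        using mult_left_mono[OF C(1)[of t] abs_ge_zero[of "h t"]] C(2) by (simp add: abs_mult mult.commute)
    qed
  qed
qed

text \<open>
  Integration by parts for merely integrable \<open>g\<close>, by Fubini's theorem on the triangle \<open>r < t\<close>: the boundary term
  is a multiple of the mean of \<open>\<psi>\<close>.
\<close>

lemma integral_by_parts_prim:
  assumes g: "integrable (lebesgue_on {0<..<T}) g" and \<psi>: "\<psi> \<in> test_functions {0<..<T}"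
    and mean: "(LINT r|lebesgue_on {0<..<T}. \<psi> r) = 0"
  shows "(LINT t|lebesgue_on {0<..<T}. g t * prim T \<psi> t) = - (LINT r|lebesgue_on {0<..<T}. prim T g r * \<psi> r)"
proof -
  let ?M = "lebesgue_on {0<..<T}"
  interpret P: pair_sigma_finite ?M ?M by (rule pair_sigma_finite_time)
  interpret finite_measure ?M by (rule finite_measure_time)
  obtain C where C: "\<And>x. \<bar>\<psi> x\<bar> \<le> C" "C \<ge> 0" using test_function_bounded[OF \<psi>] by blast
  have [measurable]: "g \<in> borel_measurable ?M" using g by auto
  have [measurable]: "\<psi> \<in> borel_measurable ?M"
    by (rule borel_imp_measurable_lebesgue_on, rule borel_measurable_continuous_onI,
          rule test_function_continuous[OF \<psi>])
  have [measurable]: "(\<lambda>x. fst x) \<in> borel_measurable (?M \<Otimes>\<^sub>M ?M)" "(\<lambda>x. snd x) \<in> borel_measurable (?M \<Otimes>\<^sub>M ?M)"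
    by (rule measurable_compose[OF measurable_fst time_ident_measurable],
        rule measurable_compose[OF measurable_snd time_ident_measurable])
  have \<psi>int: "integrable ?M \<psi>"
    by (rule continuous_integrable_time[OF continuous_on_subset[OF test_function_continuous[OF \<psi>]]]) simp
  have int: "integrable (?M \<Otimes>\<^sub>M ?M) (case_prod (\<lambda>r t. if r < t then g t * \<psi> r else 0))"
  proof (rule integrable_pair_bound)
    show "case_prod (\<lambda>r t. if r < t then g t * \<psi> r else 0) \<in> borel_measurable (?M \<Otimes>\<^sub>M ?M)"
      unfolding case_prod_beta by measurable
    show "\<bar>if r < t then g t * \<psi> r else 0\<bar> \<le> C * \<bar>g t\<bar>" for r t
      using mult_left_mono[OF C(1)[of r] abs_ge_zero[of "g t"]] C(2) by (simp add: abs_mult mult.commute)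
  qed (use g in auto)
  have 1: "(LINT r|?M. (if r < t then g t * \<psi> r else 0)) = g t * prim T \<psi> t" for t
  proof -
    have "(if r < t then g t * \<psi> r else 0) = g t * (if r < t then \<psi> r else 0)" for r by simp
    then show ?thesis unfolding prim_def by simp
  qed
  define G where "G = (LINT t|?M. g t)"
  have 2: "(LINT t|?M. (if r < t then g t * \<psi> r else 0)) = (G - prim T g r) * \<psi> r" for r
  proof -
    have "(LINT t|?M. (if r < t then g t * \<psi> r else 0)) = (LINT t|?M. (g t - (if t < r then g t else 0)) * \<psi> r)"
    proof (rule integral_cong_AE)
      have "AE t in ?M. t \<noteq> r"
        by (subst AE_restrict_space_iff) (auto intro!: AE_I'[of "{r}"])
      then show "AE t in ?M. (if r < t then g t * \<psi> r else 0) = (g t - (if t < r then g t else 0)) * \<psi> r"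
        by eventually_elim auto
      have [measurable]: "(\<lambda>x. x) \<in> borel_measurable ?M" by (rule time_ident_measurable)
      show "(\<lambda>t. if r < t then g t * \<psi> r else 0) \<in> borel_measurable ?M"
        "(\<lambda>t. (g t - (if t < r then g t else 0)) * \<psi> r) \<in> borel_measurable ?M" by measurable
    qed
    also have "\<dots> = (G - prim T g r) * \<psi> r"
      unfolding prim_def G_def using g prim_integrand_integrable[OF g] by simp
    finally show ?thesis .
  qed
  have "(LINT t|?M. g t * prim T \<psi> t) = (LINT r|?M. (G - prim T g r) * \<psi> r)"
    using P.Fubini_integral[OF int] unfolding 1 2 .
  also have "\<dots> = (LINT r|?M. G * \<psi> r - prim T g r * \<psi> r)" by (simp add: left_diff_distrib)
  also have "\<dots> = (LINT r|?M. G * \<psi> r) - (LINT r|?M. prim T g r * \<psi> r)"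
  proof (rule Bochner_Integration.integral_diff)
    show "integrable ?M (\<lambda>r. prim T g r * \<psi> r)"
      by (rule integrable_times_test_function[OF _ \<psi>], rule continuous_integrable_time,
          rule continuous_on_subset[OF prim_continuous[OF g]]) simp
  qed (use \<psi>int in simp)
  also have "\<dots> = - (LINT r|?M. prim T g r * \<psi> r)" using mean by simp
  finally show ?thesis .
qed

text \<open>
  The lemma of du Bois-Reymond.  A test function is the derivative of a test function exactly when its mean is zero.
  Subtracting from a given \<open>\<psi>\<close> the multiple of a fixed \<open>\<eta>\<close> with the same mean therefore gives an admissible derivative,
  and shows that \<open>v - \<integral>\<^sub>0 g\<close> has the same integral against \<open>\<psi>\<close> as a constant.
\<close>

lemma weak_derivative_imp_primitive:
  assumes T: "T > 0" and v: "integrable (lebesgue_on {0<..<T}) v" and g: "integrable (lebesgue_on {0<..<T}) g"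
    and weak: "\<And>\<phi>. \<phi> \<in> test_functions {0<..<T} \<Longrightarrow>
      (LINT t|lebesgue_on {0<..<T}. v t * deriv \<phi> t) = - (LINT t|lebesgue_on {0<..<T}. g t * \<phi> t)"
  shows "\<exists>C. AE t in lebesgue_on {0<..<T}. v t = C + prim T g t"
proof -
  let ?M = "lebesgue_on {0<..<T}"
  interpret finite_measure ?M by (rule finite_measure_time)
  \<comment> \<open>Any fixed test function of nonzero mean would do.\<close>
  define \<eta> where "\<eta> = box_approx 1 (T / 4) (3 * T / 4)"
  have \<eta>: "\<eta> \<in> test_functions {0<..<T}"
    unfolding \<eta>_def by (rule box_approx_test_function) (use T in auto)
  have int: "integrable ?M \<phi>" if "\<phi> \<in> test_functions {0<..<T}" for \<phi>
    by (rule continuous_integrable_time[OF continuous_on_subset[OF test_function_continuous[OF that]]]) simp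
  define c where "c = (LINT r|?M. \<eta> r)"
  have "c > 0"
  proof -
    have nn: "\<eta> r \<ge> 0" for r
      using box_bump_bounds[of "T / 4" "3 * T / 4" r] by (simp add: \<eta>_def box_approx_def)
    have "c \<noteq> 0"
    proof
      assume "c = 0"
      then have "AE r in ?M. \<eta> r = 0"
        unfolding c_def using integral_nonneg_eq_0_iff_AE[OF int[OF \<eta>]] nn by simp
      then have "AE r in ?M. r \<notin> box (T / 4) (3 * T / 4)"
      proof eventually_elim
        case (elim r)
        then show ?case using box_bump_pos[of r "T / 4" "3 * T / 4"] by (auto simp: \<eta>_def box_approx_def)
      qed
      then have "AE r in lebesgue. r \<notin> {T / 4<..<3 * T / 4}"
        using T by (subst (asm) AE_restrict_space_iff) (auto elim!: eventually_mono)
      then have "emeasure lebesgue {T / 4<..<3 * T / 4} = 0"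
        by (subst (asm) AE_iff_measurable[of "{T / 4<..<3 * T / 4}"]) auto
      then show False using T by simp
    qed
    moreover have "c \<ge> 0" unfolding c_def using nn by simp
    ultimately show ?thesis by simp
  qed
  define w where "w t = v t - prim T g t" for t
  have w: "integrable ?M w"
    unfolding w_def using v continuous_integrable_time[OF continuous_on_subset[OF prim_continuous[OF g]], of T] by auto
  define C where "C = (LINT t|?M. w t * \<eta> t) / c"
  have orth: "(LINT t|?M. (w t - C) * \<psi> t) = 0" if \<psi>: "\<psi> \<in> test_functions {0<..<T}" for \<psi>
  proof -
    define m where "m = (LINT r|?M. \<psi> r)"
    define \<psi>0 where "\<psi>0 r = \<psi> r - m / c * \<eta> r" for r
    have \<psi>0: "\<psi>0 \<in> test_functions {0<..<T}"
    proof -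
      obtain K L where "compact K" "K \<subseteq> {0<..<T}" "\<And>x. x \<notin> K \<Longrightarrow> \<psi> x = 0"
        "compact L" "L \<subseteq> {0<..<T}" "\<And>x. x \<notin> L \<Longrightarrow> \<eta> x = 0"
        using \<psi> \<eta> unfolding test_functions_def by blast
      moreover have "Ck k \<psi>0" for k
        unfolding \<psi>0_def by (intro Ck_diff Ck_cmult) (use \<psi> \<eta> in \<open>simp_all add: test_functions_def\<close>)
      ultimately show ?thesis
        unfolding test_functions_def mem_Collect_eq
        by (intro conjI exI[of _ "K \<union> L"] allI impI) (auto simp: \<psi>0_def)
    qed
    have mean: "(LINT r|?M. \<psi>0 r) = 0"
      unfolding \<psi>0_def using int[OF \<psi>] int[OF \<eta>] \<open>c > 0\<close> by (simp add: m_def[symmetric] c_def[symmetric])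
    have "deriv (prim T \<psi>0) = \<psi>0"
      using test_function_integral_is_test_function(2)[OF \<psi>0 T mean] DERIV_imp_deriv by blast
    then have "(LINT t|?M. v t * \<psi>0 t) = (LINT t|?M. prim T g t * \<psi>0 t)"
      using weak[OF test_function_integral_is_test_function(1)[OF \<psi>0 T mean]]
        integral_by_parts_prim[OF g \<psi>0 mean] by simp
    moreover have "integrable ?M (\<lambda>t. prim T g t * \<psi>0 t)"
      by (rule integrable_times_test_function[OF _ \<psi>0], rule continuous_integrable_time,
          rule continuous_on_subset[OF prim_continuous[OF g]]) simp
    ultimately have "(LINT t|?M. w t * \<psi>0 t) = 0"
      unfolding w_def left_diff_distrib using integrable_times_test_function[OF v \<psi>0] by simp
    then have "(LINT t|?M. w t * \<psi> t - m / c * (w t * \<eta> t)) = 0"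
      unfolding \<psi>0_def by (simp add: algebra_simps)
    then have "(LINT t|?M. w t * \<psi> t) = m * C"
      using integrable_times_test_function[OF w \<psi>] integrable_times_test_function[OF w \<eta>]
      by (simp add: C_def)
    then show ?thesis
      unfolding left_diff_distrib using integrable_times_test_function[OF w \<psi>] int[OF \<psi>]
      by (simp add: m_def)
  qed
  have "AE t in ?M. w t - C = 0"
  proof (rule AE_zero_if_orthogonal_to_test_functions[OF _ _ orth])
    fix a b :: real assume ab: "cbox a b \<subseteq> {0<..<T}"
    have "integrable ?M (\<lambda>t. w t - C)" using w by simp
    then have "integrable lebesgue (\<lambda>t. indicator {0<..<T} t *\<^sub>R (w t - C))"
      by (subst (asm) integrable_restrict_space) auto
    from integrable_mult_indicator[OF _ this, of "cbox a b"]
    have "integrable lebesgue (\<lambda>t. indicator (cbox a b) t *\<^sub>R (indicator {0<..<T} t *\<^sub>R (w t - C)))" by simp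
    moreover have "(\<lambda>t. indicator (cbox a b) t *\<^sub>R (indicator {0<..<T} t *\<^sub>R (w t - C))) =
        (\<lambda>t. indicator (cbox a b) t * (w t - C))"
    proof
      fix t
      show "indicator (cbox a b) t *\<^sub>R (indicator {0<..<T} t *\<^sub>R (w t - C)) = indicator (cbox a b) t * (w t - C)"
        using ab by (cases "t \<in> cbox a b") (auto simp: subset_iff)
    qed
    ultimately show "integrable lebesgue (\<lambda>t. indicator (cbox a b) t * (w t - C))" by simp
  qed auto
  then have "AE t in ?M. v t = C + prim T g t" by eventually_elim (simp add: w_def)
  then show ?thesis by blast
qed

text \<open>
  The primitives agree everywhere, hence so do their derivatives.
\<close>

lemma continuous_AE_eq_imp_eq:
  fixes F G :: "real \<Rightarrow> real"
  assumes T: "T > 0" and F: "continuous_on {0..T} F" and G: "continuous_on {0..T} G"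
    and eq: "AE t in lebesgue_on {0<..<T}. F t = G t" and s: "s \<in> {0..T}"
  shows "F s = G s"
proof -
  have "prim T F = prim T G"
    by (rule ext, rule prim_cong_AE[OF continuous_integrable_time[OF F] continuous_integrable_time[OF G] eq])
  then have "(prim T F has_real_derivative F s) (at s within {0..T})"
    "(prim T F has_real_derivative G s) (at s within {0..T})"
    using prim_has_derivative[OF F s] prim_has_derivative[OF G s] by simp_all
  note d = this
  show ?thesis
    by (rule vector_derivative_unique_within_closed_interval[OF T, of s "prim T F"])
       (use s d in \<open>simp_all add: has_real_derivative_iff_has_vector_derivative\<close>)
qed


section \<open>Functions with values in a function space\<close>

text \<open>
  Linear subspaces are predicates on sets of functions with pointwise operations, since function types carry
  no vector space structure and the seminorms do not separate functions.
\<close>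

definition fun_subspace :: "('x \<Rightarrow> 'y::real_vector) set \<Rightarrow> bool" where
  "fun_subspace S \<longleftrightarrow> (\<lambda>x. 0) \<in> S \<and> (\<forall>u\<in>S. \<forall>v\<in>S. (\<lambda>x. u x + v x) \<in> S) \<and>
     (\<forall>u\<in>S. \<forall>r. (\<lambda>x. r *\<^sub>R u x) \<in> S)"

lemma fun_subspaceD:
  assumes "fun_subspace S"
  shows "(\<lambda>x. 0) \<in> S" "u \<in> S \<Longrightarrow> v \<in> S \<Longrightarrow> (\<lambda>x. u x + v x) \<in> S" "u \<in> S \<Longrightarrow> (\<lambda>x. r *\<^sub>R u x) \<in> S"
  using assms by (auto simp: fun_subspace_def)

lemma fun_subspace_diff: "fun_subspace S \<Longrightarrow> u \<in> S \<Longrightarrow> v \<in> S \<Longrightarrow> (\<lambda>x. u x - v x) \<in> S"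
  using fun_subspaceD(2)[of S u "\<lambda>x. (-1) *\<^sub>R v x"] fun_subspaceD(3)[of S v "-1"] by simp

lemma fun_subspace_sum:
  assumes "fun_subspace S" "finite F" "\<And>i. i \<in> F \<Longrightarrow> u i \<in> S"
  shows "(\<lambda>x. \<Sum>i\<in>F. c i *\<^sub>R u i x) \<in> S"
  using assms(2,3)
proof (induction F rule: finite_induct)
  case empty then show ?case using fun_subspaceD(1)[OF assms(1)] by simp
next
  case (insert i F)
  then have "(\<lambda>x. c i *\<^sub>R u i x + (\<Sum>i\<in>F. c i *\<^sub>R u i x)) \<in> S"
    by (intro fun_subspaceD[OF assms(1)]) auto
  then show ?case using insert by simp
qed

lemma dual_spaceD:
  assumes "l \<in> dual_space S p"
  shows "u \<in> S \<Longrightarrow> v \<in> S \<Longrightarrow> l (\<lambda>x. u x + v x) = l u + l v"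
    "u \<in> S \<Longrightarrow> l (\<lambda>x. r *\<^sub>R u x) = r * l u"
  using assms by (auto simp: dual_space_def)

text \<open>
  The constant in the definition of the dual space may have any sign; for a nonnegative seminorm it can be made positive.
\<close>

lemma dual_space_bound:
  assumes "l \<in> dual_space S p" and p: "\<And>u. u \<in> S \<Longrightarrow> 0 \<le> p u"
  obtains C where "C > 0" "\<And>u. u \<in> S \<Longrightarrow> \<bar>l u\<bar> \<le> C * p u"
proof -
  obtain C where C: "\<And>u. u \<in> S \<Longrightarrow> \<bar>l u\<bar> \<le> C * p u"
    using assms(1) unfolding dual_space_def by blast
  have "\<bar>l u\<bar> \<le> (\<bar>C\<bar> + 1) * p u" if "u \<in> S" for u
    using C[OF that] mult_right_mono[of C "\<bar>C\<bar> + 1" "p u"] p[OF that] by linarith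
  then show thesis using that[of "\<bar>C\<bar> + 1"] by auto
qed

lemma dual_space_diff:
  assumes l: "l \<in> dual_space S p" and S: "fun_subspace S" and u: "u \<in> S" and v: "v \<in> S"
  shows "l (\<lambda>x. u x - v x) = l u - l v"
proof -
  have "l (\<lambda>x. u x + (-1) *\<^sub>R v x) = l u + (-1) * l v"
    by (simp only: dual_spaceD(1)[OF l u fun_subspaceD(3)[OF S v]] dual_spaceD(2)[OF l v])
  then show ?thesis by simp
qed

lemma dual_space_zero:
  assumes l: "l \<in> dual_space S p" and S: "fun_subspace S" shows "l (\<lambda>x. 0) = 0"
  using dual_spaceD(2)[OF l fun_subspaceD(1)[OF S], of 0] by simp

lemma dual_space_sum:
  assumes l: "l \<in> dual_space S p" and S: "fun_subspace S" and F: "finite F" "\<And>i. i \<in> F \<Longrightarrow> u i \<in> S"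
  shows "l (\<lambda>x. \<Sum>i\<in>F. c i *\<^sub>R u i x) = (\<Sum>i\<in>F. c i * l (u i))"
  using F
proof (induction F rule: finite_induct)
  case empty then show ?case using dual_space_zero[OF l S] by simp
next
  case (insert i F)
  have "l (\<lambda>x. c i *\<^sub>R u i x + (\<Sum>i\<in>F. c i *\<^sub>R u i x)) = c i * l (u i) + l (\<lambda>x. \<Sum>i\<in>F. c i *\<^sub>R u i x)"
    using insert fun_subspaceD(3)[OF S, of "u i" "c i"] fun_subspace_sum[OF S insert(1), of u c]
    by (simp add: dual_spaceD[OF l])
  then show ?case using insert by simp
qed

lemma step_fun_expand:
  assumes s: "step_fun S T s" and t: "t \<in> {0<..<T}"
  shows "g (s t) = (\<Sum>v\<in>s ` {0<..<T}. indicator {t\<in>{0<..<T}. s t = v} t * (g v :: real))"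
proof -
  have "(\<Sum>v\<in>s ` {0<..<T}. indicator {t\<in>{0<..<T}. s t = v} t * g v) = (\<Sum>v\<in>s ` {0<..<T}. if s t = v then g v else 0)"
    using t by (intro sum.cong) auto
  also have "\<dots> = g (s t)"
    using s t by (simp add: step_fun_def)
  finally show ?thesis by simp
qed

lemma step_fun_in: "step_fun S T s \<Longrightarrow> t \<in> {0<..<T} \<Longrightarrow> s t \<in> S"
  by (auto simp: step_fun_def)

lemma step_fun_level_sets: "step_fun S T s \<Longrightarrow> {t\<in>{0<..<T}. s t = v} \<in> sets (lebesgue_on {0<..<T})"
  unfolding step_fun_def by (auto simp: sets_restrict_space_iff)

lemma step_fun_has_integral:
  fixes g :: "_ \<Rightarrow> real"
  assumes s: "step_fun S T s"
  shows "(\<lambda>t. g (s t)) \<in> borel_measurable (lebesgue_on {0<..<T})"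
    "integrable (lebesgue_on {0<..<T}) (\<lambda>t. g (s t))"
    "(LINT t|lebesgue_on {0<..<T}. g (s t)) = (\<Sum>v\<in>s ` {0<..<T}. measure lebesgue {t\<in>{0<..<T}. s t = v} * g v)"
proof -
  let ?M = "lebesgue_on {0<..<T}"
  let ?G = "\<lambda>t. \<Sum>v\<in>s ` {0<..<T}. indicator {t\<in>{0<..<T}. s t = v} t * g v"
  interpret finite_measure ?M by (rule finite_measure_time)
  have eq: "g (s t) = ?G t" if "t \<in> space ?M" for t
    using step_fun_expand[OF s, of t g] that by simp
  have ind: "integrable ?M (indicator {t\<in>{0<..<T}. s t = v} :: real \<Rightarrow> real)" for v
    using step_fun_level_sets[OF s, of v]
    by (intro integrable_real_indicator) (auto simp: emeasure_finite less_top[symmetric])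
  have G: "integrable ?M ?G"
    by (intro Bochner_Integration.integrable_sum integrable_mult_left ind)
  show int: "integrable ?M (\<lambda>t. g (s t))"
    using G by (subst Bochner_Integration.integrable_cong[OF refl eq]) auto
  then show "(\<lambda>t. g (s t)) \<in> borel_measurable ?M" by (rule borel_measurable_integrable)
  have "(LINT t|?M. g (s t)) = (LINT t|?M. ?G t)"
    by (rule Bochner_Integration.integral_cong[OF refl eq])
  also have "\<dots> = (\<Sum>v\<in>s ` {0<..<T}. LINT t|?M. indicator {t\<in>{0<..<T}. s t = v} t * g v)"
    by (intro Bochner_Integration.integral_sum integrable_mult_left ind)
  also have "\<dots> = (\<Sum>v\<in>s ` {0<..<T}. measure lebesgue {t\<in>{0<..<T}. s t = v} * g v)"
  proof (intro sum.cong refl)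
    fix v
    have "(LINT t|?M. indicator {t\<in>{0<..<T}. s t = v} t) = measure ?M {t\<in>{0<..<T}. s t = v}"
      by (simp add: Int_absorb2 subset_eq)
    also have "\<dots> = measure lebesgue {t\<in>{0<..<T}. s t = v}"
      by (rule measure_restrict_space) auto
    finally show "(LINT t|?M. indicator {t\<in>{0<..<T}. s t = v} t * g v) = measure lebesgue {t\<in>{0<..<T}. s t = v} * g v"
      by simp
  qed
  finally show "(LINT t|?M. g (s t)) = (\<Sum>v\<in>s ` {0<..<T}. measure lebesgue {t\<in>{0<..<T}. s t = v} * g v)" .
qed

lemma step_integral_in:
  "fun_subspace S \<Longrightarrow> step_fun S T s \<Longrightarrow> step_integral T s \<in> S"
  unfolding step_integral_def step_fun_def by (rule fun_subspace_sum) auto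

lemma dual_step_integral:
  assumes l: "l \<in> dual_space S p" and S: "fun_subspace S" and s: "step_fun S T s"
  shows "(LINT t|lebesgue_on {0<..<T}. l (s t)) = l (step_integral T s)"
  unfolding step_fun_has_integral(3)[OF s] step_integral_def
  using s by (subst dual_space_sum[OF l S]) (auto simp: step_fun_def)

text \<open>
  Changing \<open>f\<close> and the step functions to zero on a null set turns every almost-everywhere property into a pointwise one.
  This matters for kernels \<open>q(f(s),f(t))\<close>: the product of two complete measures is not complete, so that pointwise limits
  of measurable kernels are measurable while almost-everywhere limits need not be.
\<close>

lemma strongly_measurable_regular_version:
  assumes S: "fun_subspace S" and p0: "p (\<lambda>x. 0) = 0" and f: "strongly_measurable S p T f"
    and P: "AE t in lebesgue_on {0<..<T}. P t"
  obtains f0 s0 where "AE t in lebesgue_on {0<..<T}. f0 t = f t" "\<And>t. f0 t \<in> S"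
    "\<And>k::nat. step_fun S T (s0 k)"
    "\<And>t. t \<in> {0<..<T} \<Longrightarrow> (\<lambda>k. p (\<lambda>x. f0 t x - s0 k t x)) \<longlonglongrightarrow> 0"
    "\<And>t. f0 t = (\<lambda>x. 0) \<or> (t \<in> {0<..<T} \<and> f0 t = f t \<and> P t)"
proof -
  let ?M = "lebesgue_on {0<..<T}"
  obtain s where s: "\<And>k::nat. step_fun S T (s k)"
    and lim: "AE t in ?M. (\<lambda>k. p (\<lambda>a. f t a - s k t a)) \<longlonglongrightarrow> 0" and fS: "AE t in ?M. f t \<in> S"
    using f unfolding strongly_measurable_def by blast
  have "AE t in ?M. f t \<in> S \<and> (\<lambda>k. p (\<lambda>a. f t a - s k t a)) \<longlonglongrightarrow> 0 \<and> P t"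
    using fS lim P by eventually_elim auto
  then obtain N where N: "{t \<in> space ?M. \<not> (f t \<in> S \<and> (\<lambda>k. p (\<lambda>a. f t a - s k t a)) \<longlonglongrightarrow> 0 \<and> P t)} \<subseteq> N"
      "N \<in> sets ?M" "emeasure ?M N = 0"
    by (rule AE_E)
  have NL: "N \<in> sets lebesgue" "N \<subseteq> {0<..<T}" using N(2) by (auto simp: sets_restrict_space)
  define f0 where "f0 t = (if t \<in> {0<..<T} - N then f t else (\<lambda>x. 0))" for t
  define s0 where "s0 k t = (if t \<in> N then (\<lambda>x. 0) else s k t)" for k t
  have good: "f t \<in> S" "(\<lambda>k. p (\<lambda>a. f t a - s k t a)) \<longlonglongrightarrow> 0" "P t" if "t \<in> {0<..<T} - N" for t
    using N(1) that by auto
  show thesis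
  proof (rule that)
    have "AE t in ?M. t \<notin> N" using N by (intro AE_not_in) auto
    then show "AE t in ?M. f0 t = f t"
      using AE_space by eventually_elim (auto simp: f0_def)
    show "f0 t \<in> S" for t using good(1) fun_subspaceD(1)[OF S] by (auto simp: f0_def)
    show "step_fun S T (s0 k)" for k
      unfolding step_fun_def
    proof (intro conjI allI)
      have sub: "s0 k ` {0<..<T} \<subseteq> insert (\<lambda>x. 0) (s k ` {0<..<T})" by (auto simp: s0_def)
      then show "finite (s0 k ` {0<..<T})" using s[of k] by (auto simp: step_fun_def intro: finite_subset)
      show "s0 k ` {0<..<T} \<subseteq> S"
        using s[of k] fun_subspaceD(1)[OF S] by (intro order_trans[OF sub]) (auto simp: step_fun_def)
      fix v
      have "{t \<in> {0<..<T}. s0 k t = v} = ({t \<in> {0<..<T}. s k t = v} - N) \<union> (if v = (\<lambda>x. 0) then N else {})"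
        using NL(2) by (auto simp: s0_def)
      then show "{t \<in> {0<..<T}. s0 k t = v} \<in> sets lebesgue"
        using s[of k] NL(1) by (auto simp: step_fun_def)
    qed
    show "(\<lambda>k. p (\<lambda>x. f0 t x - s0 k t x)) \<longlonglongrightarrow> 0" if "t \<in> {0<..<T}" for t
    proof (cases "t \<in> N")
      case True
      then show ?thesis using p0 by (simp add: f0_def s0_def)
    next
      case False
      then show ?thesis using good(2)[of t] that by (simp add: f0_def s0_def)
    qed
    show "f0 t = (\<lambda>x. 0) \<or> (t \<in> {0<..<T} \<and> f0 t = f t \<and> P t)" for t
      using good(3)[of t] by (auto simp: f0_def)
  qed
qed

lemma lebesgue_on_AE_measurable:
  fixes f g :: "real \<Rightarrow> real"
  assumes f: "f \<in> borel_measurable (lebesgue_on S)" and S: "S \<in> sets lebesgue"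
    and ae: "AE x in lebesgue_on S. f x = g x"
  shows "g \<in> borel_measurable (lebesgue_on S)"
proof -
  have "(\<lambda>x. if x \<in> S then f x else 0) \<in> borel_measurable lebesgue"
    using f by (simp only: borel_measurable_if[OF S])
  moreover have "AE x in lebesgue. (if x \<in> S then f x else 0) = (if x \<in> S then g x else 0)"
    using ae by (subst (asm) AE_restrict_space_iff) (use S in \<open>auto elim!: eventually_mono\<close>)
  ultimately have "(\<lambda>x. if x \<in> S then g x else 0) \<in> borel_measurable lebesgue"
    by (rule borel_measurable_AE)
  then show ?thesis by (simp only: borel_measurable_if[OF S])
qed

lemma dual_limit:
  assumes l: "l \<in> dual_space S p" and S: "fun_subspace S" and p: "\<And>u. u \<in> S \<Longrightarrow> 0 \<le> p u"
    and f: "f \<in> S" and s: "\<And>k. s k \<in> S" and lim: "(\<lambda>k::nat. p (\<lambda>x. f x - s k x)) \<longlonglongrightarrow> 0"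
  shows "(\<lambda>k. l (s k)) \<longlonglongrightarrow> l f"
proof -
  obtain C where C: "C > 0" "\<And>u. u \<in> S \<Longrightarrow> \<bar>l u\<bar> \<le> C * p u" using dual_space_bound[OF l p] by blast
  have lim': "(\<lambda>k. C * p (\<lambda>x. f x - s k x)) \<longlonglongrightarrow> 0" using tendsto_mult_left[OF lim, of C] by simp
  have "(\<lambda>k. l f - l (s k)) \<longlonglongrightarrow> 0"
  proof (rule Lim_null_comparison[OF _ lim'], rule always_eventually, rule allI)
    fix k
    show "norm (l f - l (s k)) \<le> C * p (\<lambda>x. f x - s k x)"
      using C(2)[OF fun_subspace_diff[OF S f s[of k]]] dual_space_diff[OF l S f s[of k]] by simp
  qed
  from tendsto_diff[OF tendsto_const[of "l f"] this] show ?thesis by simp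
qed

lemma dual_tendsto:
  assumes l: "l \<in> dual_space S p" and S: "fun_subspace S" and p: "\<And>u. u \<in> S \<Longrightarrow> 0 \<le> p u"
    and f: "f \<in> S" and s: "\<forall>\<^sub>F k in F. s k \<in> S" and lim: "((\<lambda>k. p (\<lambda>x. s k x - f x)) \<longlongrightarrow> 0) F"
  shows "((\<lambda>k. l (s k)) \<longlongrightarrow> l f) F"
proof (rule LIM_zero_cancel)
  obtain C where C: "C > 0" "\<And>u. u \<in> S \<Longrightarrow> \<bar>l u\<bar> \<le> C * p u" using dual_space_bound[OF l p] by blast
  have lim': "((\<lambda>k. C * p (\<lambda>x. s k x - f x)) \<longlongrightarrow> 0) F" using tendsto_mult_left[OF lim, of C] by simp
  show "((\<lambda>k. l (s k) - l f) \<longlongrightarrow> 0) F"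
  proof (rule Lim_null_comparison[OF _ lim'])
    show "\<forall>\<^sub>F k in F. norm (l (s k) - l f) \<le> C * p (\<lambda>x. s k x - f x)"
      using s
    proof eventually_elim
      case (elim k)
      show ?case using C(2)[OF fun_subspace_diff[OF S elim f]] dual_space_diff[OF l S elim f] by simp
    qed
  qed
qed

lemma dual_measurable:
  assumes l: "l \<in> dual_space S p" and S: "fun_subspace S" and p: "\<And>u. u \<in> S \<Longrightarrow> 0 \<le> p u"
    and p0: "p (\<lambda>x. 0) = 0" and f: "strongly_measurable S p T f"
  shows "(\<lambda>t. l (f t)) \<in> borel_measurable (lebesgue_on {0<..<T})"
proof -
  obtain f0 s0 where f0: "AE t in lebesgue_on {0<..<T}. f0 t = f t" "\<And>t. f0 t \<in> S"
    "\<And>k::nat. step_fun S T (s0 k)"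
    "\<And>t. t \<in> {0<..<T} \<Longrightarrow> (\<lambda>k. p (\<lambda>x. f0 t x - s0 k t x)) \<longlonglongrightarrow> 0"
    by (rule strongly_measurable_regular_version[OF S p0 f, of "\<lambda>_. True"], simp, rule that, assumption+)
  have "(\<lambda>t. l (f0 t)) \<in> borel_measurable (lebesgue_on {0<..<T})"
  proof (rule borel_measurable_LIMSEQ_metric)
    show "(\<lambda>t. l (s0 k t)) \<in> borel_measurable (lebesgue_on {0<..<T})" for k
      by (rule step_fun_has_integral(1)[OF f0(3)])
    show "(\<lambda>k. l (s0 k t)) \<longlonglongrightarrow> l (f0 t)" if "t \<in> space (lebesgue_on {0<..<T})" for t
      by (rule dual_limit[OF l S p f0(2) step_fun_in[OF f0(3)] f0(4)]) (use that in auto)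
  qed
  then show ?thesis
    by (rule lebesgue_on_AE_measurable) (use f0(1) in \<open>auto elim!: eventually_mono\<close>)
qed

text \<open>
  Bounded functionals commute with the Bochner integral.  The seminorm of the error need not be measurable in time; the
  estimate goes through since \<open>|l(f - s\<^sub>k)| / C\<close> is measurable and lies below it.
\<close>

lemma dual_Bochner_integral:
  assumes l: "l \<in> dual_space S p" and S: "fun_subspace S" and p: "\<And>u. u \<in> S \<Longrightarrow> 0 \<le> p u"
    and p0: "p (\<lambda>x. 0) = 0" and f: "has_Bochner_integral_in S p T f w"
  shows "integrable (lebesgue_on {0<..<T}) (\<lambda>t. l (f t))" "(LINT t|lebesgue_on {0<..<T}. l (f t)) = l w"
proof -
  let ?M = "lebesgue_on {0<..<T}"
  from f obtain s where sm: "strongly_measurable S p T f" and w: "w \<in> S" and s: "\<And>k::nat. step_fun S T (s k)"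
    and lim: "(\<lambda>k. \<integral>\<^sup>+ t. ennreal (p (\<lambda>a. f t a - s k t a)) \<partial>?M) \<longlonglongrightarrow> 0"
    and limw: "(\<lambda>k. p (\<lambda>a. step_integral T (s k) a - w a)) \<longlonglongrightarrow> 0"
    unfolding has_Bochner_integral_in_def by blast
  have fS: "AE t in ?M. f t \<in> S" using sm by (simp add: strongly_measurable_def)
  obtain C where C: "C > 0" "\<And>u. u \<in> S \<Longrightarrow> \<bar>l u\<bar> \<le> C * p u" using dual_space_bound[OF l p] by blast
  have lf: "(\<lambda>t. l (f t)) \<in> borel_measurable ?M" by (rule dual_measurable[OF l S p p0 sm])
  have ls: "integrable ?M (\<lambda>t. l (s k t))" for k by (rule step_fun_has_integral(2)[OF s])
  have lsm: "(\<lambda>t. l (s k t)) \<in> borel_measurable ?M" for k by (rule step_fun_has_integral(1)[OF s])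
  let ?e = "\<lambda>k. \<integral>\<^sup>+ t. ennreal (p (\<lambda>a. f t a - s k t a)) \<partial>?M"
  have bound: "(\<integral>\<^sup>+ t. ennreal (norm (l (s k t) - l (f t))) \<partial>?M) \<le> ennreal C * ?e k" for k
  proof -
    have "(\<integral>\<^sup>+ t. ennreal (norm (l (s k t) - l (f t))) \<partial>?M) =
        (\<integral>\<^sup>+ t. ennreal C * ennreal (norm (l (s k t) - l (f t)) / C) \<partial>?M)"
      using C(1) by (intro nn_integral_cong) (simp add: ennreal_mult[symmetric])
    also have "\<dots> = ennreal C * (\<integral>\<^sup>+ t. ennreal (norm (l (s k t) - l (f t)) / C) \<partial>?M)"
      by (rule nn_integral_cmult[OF measurable_compose[OF borel_measurable_divide[OF
            measurable_compose[OF borel_measurable_diff[OF lsm lf] borel_measurable_norm] borel_measurable_const] measurable_ennreal]])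
    also have "\<dots> \<le> ennreal C * ?e k"
    proof (intro mult_left_mono nn_integral_mono_AE)
      show "AE t in ?M. ennreal (norm (l (s k t) - l (f t)) / C) \<le> ennreal (p (\<lambda>a. f t a - s k t a))"
        using fS AE_space
      proof eventually_elim
        case (elim t)
        then have "s k t \<in> S" using s[of k] by (auto simp: step_fun_def)
        then have "\<bar>l (f t) - l (s k t)\<bar> \<le> C * p (\<lambda>a. f t a - s k t a)"
          using C(2)[OF fun_subspace_diff[OF S elim(1)]] dual_space_diff[OF l S elim(1)] by simp
        then show ?case using C(1) by (intro ennreal_leI) (simp add: field_simps abs_minus_commute)
      qed
    qed simp
    finally show ?thesis .
  qed
  have lim0: "(\<lambda>k. \<integral>\<^sup>+ t. ennreal (norm (l (s k t) - l (f t))) \<partial>?M) \<longlonglongrightarrow> 0"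
  proof (rule tendsto_sandwich[OF _ _ tendsto_const])
    show "(\<lambda>k. ennreal C * ?e k) \<longlonglongrightarrow> 0"
      using ennreal_tendsto_cmult[OF _ lim, of "ennreal C"] by simp
  qed (use bound in auto)
  show int: "integrable ?M (\<lambda>t. l (f t))"
  proof -
    have "eventually (\<lambda>k. (\<integral>\<^sup>+ t. ennreal (norm (l (s k t) - l (f t))) \<partial>?M) < 1) sequentially"
      by (rule order_tendstoD(2)[OF lim0]) simp
    then obtain k where "(\<integral>\<^sup>+ t. ennreal (norm (l (s k t) - l (f t))) \<partial>?M) < 1"
      by (auto simp: eventually_sequentially)
    then have "integrable ?M (\<lambda>t. l (s k t) - l (f t))"
      using lf lsm[of k] by (intro integrableI_bounded) (auto intro: less_trans[OF _ ennreal_one_less_top])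
    from Bochner_Integration.integrable_diff[OF ls[of k] this] show ?thesis by simp
  qed
  have "(\<lambda>k. LINT t|?M. l (s k t)) \<longlonglongrightarrow> (LINT t|?M. l (f t))"
    by (rule tendsto_L1_int[OF ls int]) (use lim0 in simp)
  moreover have "(\<lambda>k. l (step_integral T (s k))) \<longlonglongrightarrow> l w"
    by (rule dual_tendsto[OF l S p w always_eventually limw]) (auto intro: step_integral_in[OF S s])
  ultimately show "(LINT t|?M. l (f t)) = l w"
    unfolding dual_step_integral[OF l S s] by (rule LIMSEQ_unique)
qed

text \<open>
  Testing with a functional reduces a vector-valued distributional derivative to a scalar one.
\<close>

lemma dual_weak_time_deriv:
  assumes l: "l \<in> dual_space S p" and S: "fun_subspace S" and p: "\<And>u. u \<in> S \<Longrightarrow> 0 \<le> p u"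
    and p0: "p (\<lambda>x. 0) = 0" and uv: "weak_time_deriv S p T u v"
    and u: "AE t in lebesgue_on {0<..<T}. u t \<in> S" and v: "AE t in lebesgue_on {0<..<T}. v t \<in> S"
    and lu: "(\<lambda>t. l (u t)) \<in> borel_measurable (lebesgue_on {0<..<T})"
    and lv: "(\<lambda>t. l (v t)) \<in> borel_measurable (lebesgue_on {0<..<T})"
    and \<phi>: "\<phi> \<in> test_functions {0<..<T}"
  shows "(LINT t|lebesgue_on {0<..<T}. l (u t) * deriv \<phi> t) = - (LINT t|lebesgue_on {0<..<T}. l (v t) * \<phi> t)"
proof -
  let ?M = "lebesgue_on {0<..<T}"
  obtain w where w: "has_Bochner_integral_in S p T (\<lambda>t a. deriv \<phi> t *\<^sub>R u t a) w"
    "has_Bochner_integral_in S p T (\<lambda>t a. - (\<phi> t *\<^sub>R v t a)) w"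
    using uv \<phi> unfolding weak_time_deriv_def by blast
  have meas: "\<psi> \<in> borel_measurable ?M" if "\<psi> \<in> test_functions {0<..<T}" for \<psi>
    by (rule borel_imp_measurable_lebesgue_on, rule borel_measurable_continuous_onI,
        rule test_function_continuous[OF that])
  have "(LINT t|?M. l (u t) * deriv \<phi> t) = (LINT t|?M. l (\<lambda>a. deriv \<phi> t *\<^sub>R u t a))"
  proof (rule integral_cong_AE)
    show "(\<lambda>t. l (u t) * deriv \<phi> t) \<in> borel_measurable ?M"
      by (intro borel_measurable_times lu meas deriv_test_function \<phi>)
    show "(\<lambda>t. l (\<lambda>a. deriv \<phi> t *\<^sub>R u t a)) \<in> borel_measurable ?M"
      by (rule borel_measurable_integrable[OF dual_Bochner_integral(1)[OF l S p p0 w(1)]])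
    show "AE t in ?M. l (u t) * deriv \<phi> t = l (\<lambda>a. deriv \<phi> t *\<^sub>R u t a)"
      using u
    proof eventually_elim
      case (elim t)
      show ?case using dual_spaceD(2)[OF l elim, of "deriv \<phi> t"] by (simp add: mult.commute)
    qed
  qed
  also have "\<dots> = l w" by (rule dual_Bochner_integral(2)[OF l S p p0 w(1)])
  also have "\<dots> = (LINT t|?M. l (\<lambda>a. - (\<phi> t *\<^sub>R v t a)))"
    by (rule dual_Bochner_integral(2)[OF l S p p0 w(2), symmetric])
  also have "\<dots> = (LINT t|?M. - (l (v t) * \<phi> t))"
  proof (rule integral_cong_AE)
    show "(\<lambda>t. - (l (v t) * \<phi> t)) \<in> borel_measurable ?M"
      by (intro borel_measurable_uminus borel_measurable_times lv meas \<phi>)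
    show "(\<lambda>t. l (\<lambda>a. - (\<phi> t *\<^sub>R v t a))) \<in> borel_measurable ?M"
      by (rule borel_measurable_integrable[OF dual_Bochner_integral(1)[OF l S p p0 w(2)]])
    show "AE t in ?M. l (\<lambda>a. - (\<phi> t *\<^sub>R v t a)) = - (l (v t) * \<phi> t)"
      using v
    proof eventually_elim
      case (elim t)
      show ?case using dual_spaceD(2)[OF l elim, of "- \<phi> t"] by (simp add: mult.commute)
    qed
  qed
  finally show ?thesis by simp
qed

section \<open>Positive semidefinite forms\<close>

text \<open>
  Semidefinite only: the vectors are functions rather than equivalence classes, and \<open>(Gu, Gv)\<close> need not
  be definite even modulo null sets.
\<close>

locale psd_form =
  fixes S :: "('x \<Rightarrow> 'y::real_vector) set" and q :: "('x \<Rightarrow> 'y) \<Rightarrow> ('x \<Rightarrow> 'y) \<Rightarrow> real"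
  assumes subspace: "fun_subspace S"
    and form_add: "\<And>u v w. u \<in> S \<Longrightarrow> v \<in> S \<Longrightarrow> w \<in> S \<Longrightarrow> q (\<lambda>x. u x + v x) w = q u w + q v w"
    and form_scale: "\<And>u w r. u \<in> S \<Longrightarrow> w \<in> S \<Longrightarrow> q (\<lambda>x. r *\<^sub>R u x) w = r * q u w"
    and form_sym: "\<And>u v. u \<in> S \<Longrightarrow> v \<in> S \<Longrightarrow> q u v = q v u"
    and form_nonneg: "\<And>u. u \<in> S \<Longrightarrow> 0 \<le> q u u"
begin

definition nrm where "nrm u = sqrt (q u u)"

lemma nrm_nonneg: "u \<in> S \<Longrightarrow> 0 \<le> nrm u"
  by (simp add: nrm_def form_nonneg)

lemma form_zero: "w \<in> S \<Longrightarrow> q (\<lambda>x. 0) w = 0"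
  using form_scale[OF fun_subspaceD(1)[OF subspace], of w 0] by simp

lemma nrm_zero: "nrm (\<lambda>x. 0) = 0"
  using form_zero[OF fun_subspaceD(1)[OF subspace]] by (simp add: nrm_def)

lemma form_expand:
  assumes "u \<in> S" "v \<in> S"
  shows "q (\<lambda>x. u x + r *\<^sub>R v x) (\<lambda>x. u x + r *\<^sub>R v x) = q u u + 2 * r * q u v + r\<^sup>2 * q v v"
proof -
  have rv: "(\<lambda>x. r *\<^sub>R v x) \<in> S" and urv: "(\<lambda>x. u x + r *\<^sub>R v x) \<in> S"
    using assms by (auto intro!: fun_subspaceD[OF subspace])
  have "q u (\<lambda>x. u x + r *\<^sub>R v x) = q u u + r * q u v"
    using assms rv urv form_add[of u "\<lambda>x. r *\<^sub>R v x" u] form_scale[of v u r]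
    by (simp add: form_sym[of u "\<lambda>x. u x + r *\<^sub>R v x"] form_sym[of v u])
  moreover have "q v (\<lambda>x. u x + r *\<^sub>R v x) = q u v + r * q v v"
    using assms rv urv form_add[of u "\<lambda>x. r *\<^sub>R v x" v] form_scale[of v v r]
    by (simp add: form_sym[of v "\<lambda>x. u x + r *\<^sub>R v x"])
  ultimately show ?thesis
    using assms rv urv by (simp add: form_add form_scale power2_eq_square algebra_simps)
qed

lemma Cauchy_Schwarz:
  assumes "u \<in> S" "v \<in> S" shows "\<bar>q u v\<bar> \<le> nrm u * nrm v"
proof -
  have pos: "0 \<le> q u u + 2 * r * q u v + r\<^sup>2 * q v v" for r
    using form_nonneg[of "\<lambda>x. u x + r *\<^sub>R v x"] form_expand[OF assms, of r] assms
      fun_subspaceD(2)[OF subspace assms(1) fun_subspaceD(3)[OF subspace assms(2), of r]] by simp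
  have "(q u v)\<^sup>2 \<le> q u u * q v v"
  proof (cases "q v v = 0")
    case True
    have "q u v = 0"
    proof (rule ccontr)
      assume n: "q u v \<noteq> 0"
      show False using pos[of "- (q u u + 1) / (2 * q u v)"] True n by (simp add: field_simps)
    qed
    then show ?thesis using True by simp
  next
    case False
    then have v: "q v v > 0" using form_nonneg[OF assms(2)] by simp
    have "0 \<le> q u u + 2 * (- q u v / q v v) * q u v + (- q u v / q v v)\<^sup>2 * q v v" by (rule pos)
    also have "\<dots> = q u u - (q u v)\<^sup>2 / q v v"
      using v by (simp add: power2_eq_square field_simps)
    finally show ?thesis using v by (simp add: field_simps)
  qed
  then have "sqrt ((q u v)\<^sup>2) \<le> sqrt (q u u * q v v)" by (rule real_sqrt_le_mono)
  then show ?thesis by (simp add: nrm_def real_sqrt_mult)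
qed

lemma nrm_triangle:
  assumes "u \<in> S" "v \<in> S" shows "nrm (\<lambda>x. u x + v x) \<le> nrm u + nrm v"
proof -
  have "q (\<lambda>x. u x + v x) (\<lambda>x. u x + v x) = q u u + 2 * q u v + q v v"
    using form_expand[OF assms, of 1] by simp
  also have "\<dots> \<le> q u u + 2 * (nrm u * nrm v) + q v v"
    using Cauchy_Schwarz[OF assms] by simp
  also have "\<dots> = (nrm u + nrm v)\<^sup>2"
    using assms form_nonneg by (simp add: nrm_def power2_eq_square algebra_simps)
  finally show ?thesis
    unfolding nrm_def[of "\<lambda>x. u x + v x"] using assms nrm_nonneg by (intro real_le_lsqrt) auto
qed

lemma nrm_uminus: "u \<in> S \<Longrightarrow> nrm (\<lambda>x. - u x) = nrm u"
proof -
  assume u: "u \<in> S"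
  then have m: "(\<lambda>x. (-1) *\<^sub>R u x) \<in> S" by (rule fun_subspaceD(3)[OF subspace])
  have "q (\<lambda>x. (-1) *\<^sub>R u x) (\<lambda>x. (-1) *\<^sub>R u x) = q u u"
    by (simp only: form_scale[OF u m] form_sym[OF u m] form_scale[OF u u])
  then show ?thesis by (simp add: nrm_def)
qed

lemma nrm_diff_commute:
  assumes "u \<in> S" "v \<in> S" shows "nrm (\<lambda>x. u x - v x) = nrm (\<lambda>x. v x - u x)"
  using nrm_uminus[OF fun_subspace_diff[OF subspace assms(2,1)]] by simp

lemma nrm_diff_triangle:
  assumes "u \<in> S" "v \<in> S" "w \<in> S"
  shows "nrm (\<lambda>x. u x - w x) \<le> nrm (\<lambda>x. u x - v x) + nrm (\<lambda>x. v x - w x)"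
  using nrm_triangle[OF fun_subspace_diff[OF subspace assms(1,2)] fun_subspace_diff[OF subspace assms(2,3)]]
  by simp

lemma nrm_diff_le:
  assumes "u \<in> S" "v \<in> S" shows "nrm (\<lambda>x. u x - v x) \<le> nrm u + nrm v"
  using nrm_diff_triangle[OF assms(1) fun_subspaceD(1)[OF subspace] assms(2)] nrm_uminus[OF assms(2)] by simp

lemma form_in_dual: "w \<in> S \<Longrightarrow> (\<lambda>u. q u w) \<in> dual_space S nrm"
  unfolding dual_space_def mem_Collect_eq
  by (intro conjI ballI allI exI[of _ "nrm w"])
     (use Cauchy_Schwarz in \<open>auto simp: form_add form_scale mult.commute\<close>)

lemma form_diff: "u \<in> S \<Longrightarrow> v \<in> S \<Longrightarrow> w \<in> S \<Longrightarrow> q (\<lambda>x. u x - v x) w = q u w - q v w"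
  using dual_space_diff[OF form_in_dual subspace] by blast

lemma form_diff_bound:
  assumes "u \<in> S" "v \<in> S" "u' \<in> S" "v' \<in> S"
  shows "\<bar>q u v - q u' v'\<bar> \<le> nrm (\<lambda>x. u x - u' x) * nrm v + nrm u' * nrm (\<lambda>x. v x - v' x)"
proof -
  have uu: "(\<lambda>x. u x - u' x) \<in> S" and vv: "(\<lambda>x. v x - v' x) \<in> S"
    using fun_subspace_diff[OF subspace] assms by auto
  have "q u v - q u' v' = q (\<lambda>x. u x - u' x) v + q (\<lambda>x. v x - v' x) u'"
    using assms form_sym[of u' v] form_sym[of u' v'] by (simp add: form_diff)
  also have "\<bar>\<dots>\<bar> \<le> \<bar>q (\<lambda>x. u x - u' x) v\<bar> + \<bar>q (\<lambda>x. v x - v' x) u'\<bar>" by (rule abs_triangle_ineq)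
  also have "\<dots> \<le> nrm (\<lambda>x. u x - u' x) * nrm v + nrm u' * nrm (\<lambda>x. v x - v' x)"
    using Cauchy_Schwarz[OF uu assms(2)] Cauchy_Schwarz[OF vv assms(3)] by (simp add: mult.commute)
  finally show ?thesis .
qed

lemma form_null_diff:
  assumes "u \<in> S" "v \<in> S" "w \<in> S" "nrm (\<lambda>x. u x - v x) = 0" shows "q u w = q v w"
  using form_diff_bound[OF assms(1,3,2,3)] assms(4) nrm_zero by simp

text \<open>
  The sum is \<open>q z z\<close> for the combination \<open>z\<close> of the vectors of \<open>F\<close> with coefficients \<open>c\<close>.
\<close>

lemma form_sum_nonneg:
  assumes "finite F" "F \<subseteq> S" shows "0 \<le> (\<Sum>v\<in>F. \<Sum>w\<in>F. c v * c w * q v w)"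
proof -
  define z where "z = (\<lambda>x. \<Sum>v\<in>F. c v *\<^sub>R v x)"
  have z: "z \<in> S" unfolding z_def using assms by (intro fun_subspace_sum[OF subspace]) auto
  have expand: "q z w = (\<Sum>v\<in>F. c v * q v w)" if "w \<in> S" for w
    unfolding z_def by (rule dual_space_sum[OF form_in_dual[OF that] subspace]) (use assms in auto)
  have "(\<Sum>v\<in>F. \<Sum>w\<in>F. c v * c w * q v w) = (\<Sum>v\<in>F. c v * q z v)"
  proof (intro sum.cong refl)
    fix v assume "v \<in> F"
    then have "(\<Sum>w\<in>F. c v * c w * q v w) = (\<Sum>w\<in>F. c v * (c w * q w v))"
      using assms(2) form_sym[of v] by (intro sum.cong) (auto simp: mult.assoc)
    also have "\<dots> = c v * q z v" using expand[of v] assms(2) \<open>v \<in> F\<close> by (auto simp: sum_distrib_left)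
    finally show "(\<Sum>w\<in>F. c v * c w * q v w) = c v * q z v" .
  qed
  also have "\<dots> = (\<Sum>v\<in>F. c v * q v z)"
    using assms(2) z form_sym by (intro sum.cong) auto
  also have "\<dots> = q z z" by (rule expand[OF z, symmetric])
  finally show ?thesis using form_nonneg[OF z] by simp
qed

lemma form_tendsto:
  assumes u: "u \<in> S" "\<And>k. s k \<in> S" "(\<lambda>k::nat. nrm (\<lambda>x. u x - s k x)) \<longlonglongrightarrow> 0"
    and v: "v \<in> S" "\<And>k. r k \<in> S" "(\<lambda>k::nat. nrm (\<lambda>x. v x - r k x)) \<longlonglongrightarrow> 0"
  shows "(\<lambda>k. q (s k) (r k)) \<longlonglongrightarrow> q u v"
proof -
  let ?a = "\<lambda>k. nrm (\<lambda>x. u x - s k x)" and ?b = "\<lambda>k. nrm (\<lambda>x. v x - r k x)"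
  have lim: "(\<lambda>k. ?a k * nrm v + (nrm u + ?a k) * ?b k) \<longlonglongrightarrow> 0 * nrm v + (nrm u + 0) * 0"
    by (intro tendsto_add tendsto_mult tendsto_const u(3) v(3))
  have "(\<lambda>k. q u v - q (s k) (r k)) \<longlonglongrightarrow> 0"
  proof (rule Lim_null_comparison[OF always_eventually, OF allI])
    fix k
    have "norm (q u v - q (s k) (r k)) \<le> ?a k * nrm v + nrm (s k) * ?b k"
      using form_diff_bound[OF u(1) v(1) u(2) v(2)] by simp
    also have "\<dots> \<le> ?a k * nrm v + (nrm u + ?a k) * ?b k"
    proof (intro add_left_mono mult_right_mono)
      have "nrm (\<lambda>x. u x - (u x - s k x)) \<le> nrm u + ?a k"
        by (rule nrm_diff_le[OF u(1) fun_subspace_diff[OF subspace u(1) u(2)]])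
      then show "nrm (s k) \<le> nrm u + ?a k" by simp
      show "0 \<le> ?b k" by (rule nrm_nonneg[OF fun_subspace_diff[OF subspace v(1) v(2)]])
    qed
    finally show "norm (q u v - q (s k) (r k)) \<le> ?a k * nrm v + (nrm u + ?a k) * ?b k" .
  qed (use lim in simp)
  from tendsto_diff[OF tendsto_const[of "q u v"] this] show ?thesis by simp
qed

lemma step_kernel_measurable:
  assumes s: "step_fun S T s"
  shows "(\<lambda>(x, y). q (s x) (s y)) \<in> borel_measurable (lebesgue_on {0<..<T} \<Otimes>\<^sub>M lebesgue_on {0<..<T})"
proof -
  let ?M = "lebesgue_on {0<..<T}"
  let ?L = "\<lambda>v. {t\<in>{0<..<T}. s t = v}"
  have eq: "(case p of (x, y) \<Rightarrow> q (s x) (s y)) = (\<Sum>v\<in>s ` {0<..<T}. \<Sum>w\<in>s ` {0<..<T}.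
      indicator (?L v) (fst p) * (indicator (?L w) (snd p) * q v w))" if "p \<in> space (?M \<Otimes>\<^sub>M ?M)" for p
  proof -
    have p: "fst p \<in> {0<..<T}" "snd p \<in> {0<..<T}" using that by (auto simp: space_pair_measure)
    have "q (s (fst p)) (s (snd p)) = (\<Sum>v\<in>s ` {0<..<T}. indicator (?L v) (fst p) * q v (s (snd p)))"
      by (rule step_fun_expand[OF s p(1)])
    also have "\<dots> = (\<Sum>v\<in>s ` {0<..<T}. indicator (?L v) (fst p) *
        (\<Sum>w\<in>s ` {0<..<T}. indicator (?L w) (snd p) * q v w))"
      by (intro sum.cong refl arg_cong2[where f = "(*)"] step_fun_expand[OF s p(2)])
    finally show ?thesis by (simp add: sum_distrib_left case_prod_beta)
  qed
  have ind: "indicator (?L v) \<in> borel_measurable ?M" for v :: "'x \<Rightarrow> 'y"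
    by (rule borel_measurable_indicator[OF step_fun_level_sets[OF s]])
  have "(\<lambda>p. \<Sum>v\<in>s ` {0<..<T}. \<Sum>w\<in>s ` {0<..<T}.
      indicator (?L v) (fst p) * (indicator (?L w) (snd p) * q v w)) \<in> borel_measurable (?M \<Otimes>\<^sub>M ?M)"
    by (intro borel_measurable_sum borel_measurable_times borel_measurable_const
        measurable_compose[OF measurable_fst ind] measurable_compose[OF measurable_snd ind])
  then show ?thesis by (subst measurable_cong[OF eq]) auto
qed

lemma prim_step:
  assumes s: "step_fun S T s"
  shows "prim T (\<lambda>r. g (s r)) t = (\<Sum>v\<in>s ` {0<..<T}. measure lebesgue ({r\<in>{0<..<T}. s r = v} \<inter> {..<t}) * (g v :: real))"
proof -
  let ?M = "lebesgue_on {0<..<T}"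
  interpret finite_measure ?M by (rule finite_measure_time)
  let ?L = "\<lambda>v. {r\<in>{0<..<T}. s r = v} \<inter> {..<t}"
  have L: "?L v \<in> sets ?M" for v :: "'x \<Rightarrow> 'y"
    using step_fun_level_sets[OF s, of v] by (auto simp: sets_restrict_space_iff)
  have eq: "(if r < t then g (s r) else 0) = (\<Sum>v\<in>s ` {0<..<T}. indicator (?L v) r * g v)" if "r \<in> space ?M" for r
    using step_fun_expand[OF s, of r g] that by (cases "r < t") (auto simp: indicator_def intro!: sum.cong)
  have ind: "integrable ?M (indicator (?L v) :: real \<Rightarrow> real)" for v :: "'x \<Rightarrow> 'y"
    using L by (intro integrable_real_indicator) (auto simp: emeasure_finite less_top[symmetric])
  have "prim T (\<lambda>r. g (s r)) t = (LINT r|?M. (\<Sum>v\<in>s ` {0<..<T}. indicator (?L v) r * g v))"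
    unfolding prim_def by (rule Bochner_Integration.integral_cong[OF refl eq])
  also have "\<dots> = (\<Sum>v\<in>s ` {0<..<T}. LINT r|?M. indicator (?L v) r * g v)"
    by (intro Bochner_Integration.integral_sum integrable_mult_left ind)
  also have "\<dots> = (\<Sum>v\<in>s ` {0<..<T}. measure lebesgue (?L v) * g v)"
  proof (intro sum.cong refl)
    fix v
    have "(LINT r|?M. indicator (?L v) r) = measure ?M (?L v \<inter> space ?M)" by (rule Bochner_Integration.integral_indicator)
    also have "?L v \<inter> space ?M = ?L v" by auto
    also have "measure ?M (?L v) = measure lebesgue (?L v)" by (rule measure_restrict_space) auto
    finally show "(LINT r|?M. indicator (?L v) r * g v) = measure lebesgue (?L v) * g v" by simp
  qed
  finally show ?thesis .
qed

text \<open>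
  For a step function the double primitive on the diagonal is \<open>q z z\<close>, where \<open>z\<close> is its integral up to time \<open>t\<close>.
\<close>

lemma step_kernel_nonneg:
  assumes s: "step_fun S T s"
  shows "0 \<le> prim T (\<lambda>y. prim T (\<lambda>x. q (s x) (s y)) t) t"
proof -
  let ?m = "\<lambda>v. measure lebesgue ({r\<in>{0<..<T}. s r = v} \<inter> {..<t})"
  have "prim T (\<lambda>y. prim T (\<lambda>x. q (s x) (s y)) t) t =
      (\<Sum>w\<in>s ` {0<..<T}. ?m w * (\<Sum>v\<in>s ` {0<..<T}. ?m v * q v w))"
    unfolding prim_step[OF s, of "\<lambda>v. q v w" for w] by (rule prim_step[OF s])
  also have "\<dots> = (\<Sum>w\<in>s ` {0<..<T}. \<Sum>v\<in>s ` {0<..<T}. ?m w * ?m v * q w v)"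
    unfolding sum_distrib_left using s form_sym
    by (intro sum.cong refl) (auto simp: step_fun_def subset_eq)
  also have "0 \<le> \<dots>"
    by (rule form_sum_nonneg) (use s in \<open>simp_all add: step_fun_def\<close>)
  finally show ?thesis .
qed

end

lemma prim_tendsto:
  assumes h: "\<And>k. h k \<in> borel_measurable (lebesgue_on {0<..<T})"
    and w: "integrable (lebesgue_on {0<..<T}) w"
    and bound: "\<And>k r. r \<in> {0<..<T} \<Longrightarrow> \<bar>h k r\<bar> \<le> w r"
    and lim: "\<And>r. r \<in> {0<..<T} \<Longrightarrow> (\<lambda>k. h k r) \<longlonglongrightarrow> h' r"
  shows "(\<lambda>k::nat. prim T (h k) t) \<longlonglongrightarrow> prim T h' t"
proof -
  let ?M = "lebesgue_on {0<..<T}"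
  have hm: "(\<lambda>r. if r < t then g r else 0) \<in> borel_measurable ?M" if g: "g \<in> borel_measurable ?M" for g :: "real \<Rightarrow> real"
  proof -
    note [measurable] = g time_ident_measurable[of T]
    show ?thesis by measurable
  qed
  have h': "h' \<in> borel_measurable ?M"
    by (rule borel_measurable_LIMSEQ_metric[OF h]) (use lim in simp)
  show ?thesis
    unfolding prim_def
  proof (rule integral_dominated_convergence[OF hm[OF h'] hm[OF h] w])
    show "AE r in ?M. (\<lambda>k. if r < t then h k r else 0) \<longlonglongrightarrow> (if r < t then h' r else 0)"
      by (rule AE_I2) (use lim in auto)
    show "AE r in ?M. norm (if r < t then h k r else 0) \<le> w r" for k
    proof (rule AE_I2)
      fix r assume "r \<in> space ?M"
      then show "norm (if r < t then h k r else 0) \<le> w r" using bound[of r k] by auto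
    qed
  qed
qed

context psd_form
begin

lemma kernel_measurable:
  assumes D: "\<And>t. D t \<in> S" and s: "\<And>k::nat. step_fun S T (s k)"
    and lim: "\<And>t. t \<in> {0<..<T} \<Longrightarrow> (\<lambda>k. nrm (\<lambda>x. D t x - s k t x)) \<longlonglongrightarrow> 0"
  shows "(\<lambda>(x, y). q (D x) (D y)) \<in> borel_measurable (lebesgue_on {0<..<T} \<Otimes>\<^sub>M lebesgue_on {0<..<T})"
    "(\<lambda>t. nrm (D t)) \<in> borel_measurable (lebesgue_on {0<..<T})"
proof -
  let ?M = "lebesgue_on {0<..<T}"
  have sS: "s k t \<in> S" if "t \<in> {0<..<T}" for k t using s[of k] that by (auto simp: step_fun_def)
  have "(\<lambda>k. q (s k x) (s k y)) \<longlonglongrightarrow> q (D x) (D y)" if "x \<in> {0<..<T}" "y \<in> {0<..<T}" for x y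
    by (rule form_tendsto[OF D sS lim D sS lim]) (use that in auto)
  note conv = this
  show "(\<lambda>(x, y). q (D x) (D y)) \<in> borel_measurable (?M \<Otimes>\<^sub>M ?M)"
  proof (rule borel_measurable_LIMSEQ_metric[OF step_kernel_measurable[OF s]])
    show "(\<lambda>k. case p of (x, y) \<Rightarrow> q (s k x) (s k y)) \<longlonglongrightarrow> (case p of (x, y) \<Rightarrow> q (D x) (D y))"
      if "p \<in> space (?M \<Otimes>\<^sub>M ?M)" for p
      using that by (auto simp: space_pair_measure intro!: conv)
  qed
  have "(\<lambda>t. q (D t) (D t)) \<in> borel_measurable ?M"
  proof (rule borel_measurable_LIMSEQ_metric)
    show "(\<lambda>t. q (s k t) (s k t)) \<in> borel_measurable ?M" for k
      by (rule step_fun_has_integral(1)[OF s, of "\<lambda>v. q v v"])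
  qed (use conv in simp)
  then show "(\<lambda>t. nrm (D t)) \<in> borel_measurable ?M"
    unfolding nrm_def by (rule measurable_compose[OF _ borel_measurable_sqrt]) 
qed

text \<open>
  The approximating step functions are cut off where their seminorm exceeds \<open>nrm (D t) + 1\<close>.  This keeps
  the pointwise convergence and yields an integrable bound, so that the sign passes to the limit.
\<close>

lemma kernel_nonneg:
  assumes D: "\<And>t. D t \<in> S" and s: "\<And>k::nat. step_fun S T (s k)"
    and lim: "\<And>t. t \<in> {0<..<T} \<Longrightarrow> (\<lambda>k. nrm (\<lambda>x. D t x - s k t x)) \<longlonglongrightarrow> 0"
    and int: "integrable (lebesgue_on {0<..<T}) (\<lambda>t. nrm (D t))"
  shows "0 \<le> prim T (\<lambda>y. prim T (\<lambda>x. q (D x) (D y)) t) t"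
proof -
  let ?M = "lebesgue_on {0<..<T}"
  interpret finite_measure ?M by (rule finite_measure_time)
  let ?n = "\<lambda>t. nrm (D t) + 1"
  \<comment> \<open>The truncated step functions; truncation is eventually inactive at each time.\<close>
  define r where "r k t = (if nrm (s k t) \<le> ?n t then s k t else (\<lambda>x. 0))" for k t
  have zS: "(\<lambda>x. 0) \<in> S" by (rule fun_subspaceD(1)[OF subspace])
  have sS: "s k t \<in> S" if "t \<in> {0<..<T}" for k t using s[of k] that by (auto simp: step_fun_def)
  have rS: "r k t \<in> S" if "t \<in> {0<..<T}" for k t using sS[OF that] zS by (simp add: r_def)
  have rn: "nrm (r k t) \<le> ?n t" for k t
    using nrm_nonneg[OF D[of t]] by (simp add: r_def nrm_zero)
  have step: "step_fun S T (r k)" for k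
    unfolding step_fun_def
  proof (intro conjI allI)
    have sub: "r k ` {0<..<T} \<subseteq> insert (\<lambda>x. 0) (s k ` {0<..<T})" by (auto simp: r_def)
    then show "finite (r k ` {0<..<T})" using s[of k] by (auto simp: step_fun_def intro: finite_subset)
    show "r k ` {0<..<T} \<subseteq> S" using rS by auto
    fix v
    have nm: "(\<lambda>t. nrm (s k t)) \<in> borel_measurable ?M"
      by (rule step_fun_has_integral(1)[OF s, of nrm])
    note [measurable] = nm kernel_measurable(2)[OF D s lim]
    have A: "{t \<in> space ?M. nrm (s k t) \<le> ?n t} \<in> sets ?M" by measurable
    have L: "{t\<in>{0<..<T}. s k t = v} \<in> sets ?M" by (rule step_fun_level_sets[OF s])
    have "{t \<in> {0<..<T}. r k t = v} = ({t\<in>{0<..<T}. s k t = v} \<inter> {t \<in> space ?M. nrm (s k t) \<le> ?n t}) \<union>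
        (if v = (\<lambda>x. 0) then space ?M - {t \<in> space ?M. nrm (s k t) \<le> ?n t} else {})"
      by (auto simp: r_def)
    then have "{t \<in> {0<..<T}. r k t = v} \<in> sets ?M" using A L by auto
    then show "{t \<in> {0<..<T}. r k t = v} \<in> sets lebesgue" by (simp add: sets_restrict_space_iff)
  qed
  have rlim: "(\<lambda>k. nrm (\<lambda>x. D t x - r k t x)) \<longlonglongrightarrow> 0" if t: "t \<in> {0<..<T}" for t
  proof (rule Lim_transform_eventually[OF lim[OF t]])
    have "eventually (\<lambda>k. nrm (\<lambda>x. D t x - s k t x) < 1) sequentially"
      by (rule order_tendstoD(2)[OF lim[OF t]]) simp
    then show "eventually (\<lambda>k. nrm (\<lambda>x. D t x - s k t x) = nrm (\<lambda>x. D t x - r k t x)) sequentially"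
    proof eventually_elim
      case (elim k)
      have "nrm (\<lambda>x. D t x - (D t x - s k t x)) \<le> nrm (D t) + nrm (\<lambda>x. D t x - s k t x)"
        by (rule nrm_diff_le[OF D fun_subspace_diff[OF subspace D sS[OF t]]])
      then have "nrm (s k t) \<le> ?n t" using elim by simp
      then show ?case by (simp add: r_def)
    qed
  qed
  have bound: "\<bar>q (r k x) (r k y)\<bar> \<le> ?n x * ?n y" if "x \<in> {0<..<T}" "y \<in> {0<..<T}" for k x y
  proof -
    have "\<bar>q (r k x) (r k y)\<bar> \<le> nrm (r k x) * nrm (r k y)" by (rule Cauchy_Schwarz[OF rS rS]) (use that in auto)
    also have "\<dots> \<le> ?n x * ?n y"
      using rn nrm_nonneg rS that nrm_nonneg[OF D[of x]] by (intro mult_mono) auto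
    finally show ?thesis .
  qed
  have nint: "integrable ?M ?n" using int by simp
  define I where "I = (LINT x|?M. ?n x)"
  have inner_meas: "(\<lambda>y. prim T (\<lambda>x. q (r k x) (r k y)) t) \<in> borel_measurable ?M" for k
    by (rule prim_measurable_snd[OF step_kernel_measurable[OF step]])
  have xmeas: "(\<lambda>x. q (r k x) v) \<in> borel_measurable ?M" for k v
    by (rule step_fun_has_integral(1)[OF step, of "\<lambda>w. q w v"])
  have "(\<lambda>k. prim T (\<lambda>y. prim T (\<lambda>x. q (r k x) (r k y)) t) t) \<longlonglongrightarrow> prim T (\<lambda>y. prim T (\<lambda>x. q (D x) (D y)) t) t"
  proof (rule prim_tendsto[where w = "\<lambda>y. I * ?n y"])
    show "integrable ?M (\<lambda>y. I * ?n y)" using nint by simp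
    fix k y assume y: "y \<in> {0<..<T}"
    have "\<bar>prim T (\<lambda>x. q (r k x) (r k y)) t\<bar> \<le> (LINT x|?M. \<bar>q (r k x) (r k y)\<bar>)"
      by (rule prim_bound, rule step_fun_has_integral(2)[OF step, of "\<lambda>w. q w (r k y)"])
    also have "\<dots> \<le> (LINT x|?M. ?n x * ?n y)"
    proof (rule Bochner_Integration.integral_mono)
      show "integrable ?M (\<lambda>x. \<bar>q (r k x) (r k y)\<bar>)"
        by (rule integrable_abs, rule step_fun_has_integral(2)[OF step, of "\<lambda>w. q w (r k y)"])
      show "integrable ?M (\<lambda>x. ?n x * ?n y)" using nint by simp
    qed (use bound y in simp)
    also have "\<dots> = I * ?n y" using nint by (simp add: I_def del: integral_add)
    finally show "\<bar>prim T (\<lambda>x. q (r k x) (r k y)) t\<bar> \<le> I * ?n y" .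
  next
    fix y assume y: "y \<in> {0<..<T}"
    show "(\<lambda>k. prim T (\<lambda>x. q (r k x) (r k y)) t) \<longlonglongrightarrow> prim T (\<lambda>x. q (D x) (D y)) t"
    proof (rule prim_tendsto[where w = "\<lambda>x. ?n x * ?n y"])
      show "integrable ?M (\<lambda>x. ?n x * ?n y)" using nint by simp
      show "(\<lambda>k. q (r k x) (r k y)) \<longlonglongrightarrow> q (D x) (D y)" if "x \<in> {0<..<T}" for x
        by (rule form_tendsto[OF D rS rlim D rS rlim]) (use that y in auto)
    qed (use bound y xmeas in auto)
  qed (rule inner_meas)
  then show ?thesis
    by (rule LIMSEQ_le_const) (use step_kernel_nonneg[OF step] in auto)
qed

end

context psd_form
begin

lemma nrm_scale: "u \<in> S \<Longrightarrow> nrm (\<lambda>x. r *\<^sub>R u x) = \<bar>r\<bar> * nrm u"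
proof -
  assume u: "u \<in> S"
  have ru: "(\<lambda>x. r *\<^sub>R u x) \<in> S" by (rule fun_subspaceD(3)[OF subspace u])
  have "q (\<lambda>x. r *\<^sub>R u x) (\<lambda>x. r *\<^sub>R u x) = r\<^sup>2 * q u u"
    by (simp only: form_scale[OF u ru] form_sym[OF u ru] form_scale[OF u u] power2_eq_square mult.assoc)
  then show ?thesis by (simp add: nrm_def real_sqrt_mult)
qed

text \<open>
  Both \<open>b(\<cdot>,w)\<close> and \<open>a(\<cdot>,w)\<close> are bounded for the graph norm, whose form \<open>b + a\<close> dominates each of them.
\<close>

lemma dominated_form_in_dual:
  assumes r: "psd_form S r" and dom: "\<And>u. u \<in> S \<Longrightarrow> r u u \<le> q u u" and w: "w \<in> S"
  shows "(\<lambda>u. r u w) \<in> dual_space S nrm"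
proof -
  interpret r: psd_form S r by (rule r)
  have "\<bar>r u w\<bar> \<le> r.nrm w * nrm u" if u: "u \<in> S" for u
  proof -
    have "\<bar>r u w\<bar> \<le> r.nrm u * r.nrm w" by (rule r.Cauchy_Schwarz[OF u w])
    also have "\<dots> \<le> nrm u * r.nrm w"
      by (rule mult_right_mono[OF _ r.nrm_nonneg[OF w]]) (simp add: r.nrm_def nrm_def dom[OF u])
    finally show ?thesis by (simp add: mult.commute)
  qed
  then show ?thesis
    unfolding dual_space_def mem_Collect_eq
    by (intro conjI ballI allI exI[of _ "r.nrm w"]) (simp_all add: w r.form_add r.form_scale)
qed

text \<open>
  Vectors of seminorm zero are covered too, as a bounded functional vanishes on them.
\<close>

lemma dual_norm_bound:
  assumes l: "l \<in> dual_space S nrm" and u: "u \<in> S"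
  shows "\<bar>l u\<bar> \<le> dual_norm S nrm l * nrm u"
proof -
  obtain C where C: "C > 0" "\<And>u. u \<in> S \<Longrightarrow> \<bar>l u\<bar> \<le> C * nrm u"
    using dual_space_bound[OF l nrm_nonneg] by blast
  show ?thesis
  proof (cases "nrm u = 0")
    case True
    then show ?thesis using C(2)[OF u] by simp
  next
    case False
    then have pos: "nrm u > 0" using nrm_nonneg[OF u] by simp
    let ?v = "\<lambda>x. (1 / nrm u) *\<^sub>R u x"
    have v: "?v \<in> S" by (rule fun_subspaceD(3)[OF subspace u])
    have "nrm ?v = 1" using nrm_scale[OF u, of "1 / nrm u"] pos by simp
    moreover have "bdd_above ((\<lambda>u. \<bar>l u\<bar>) ` {u \<in> S. nrm u \<le> 1})"
    proof (rule bdd_aboveI2)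
      fix u assume u: "u \<in> {u \<in> S. nrm u \<le> 1}"
      have "\<bar>l u\<bar> \<le> C * nrm u" using C(2)[of u] u by simp
      also have "\<dots> \<le> C * 1" using u C(1) by (intro mult_left_mono) auto
      finally show "\<bar>l u\<bar> \<le> C" by simp
    qed
    ultimately have "\<bar>l ?v\<bar> \<le> dual_norm S nrm l"
      unfolding dual_norm_def using v by (intro cSUP_upper) auto
    then show ?thesis using dual_spaceD(2)[OF l u, of "1 / nrm u"] pos by (simp add: field_simps)
  qed
qed

lemma strongly_measurable_diff:
  assumes f: "strongly_measurable S nrm T f" and h: "strongly_measurable S nrm T h"
  shows "strongly_measurable S nrm T (\<lambda>t x. f t x - h t x)"
proof -
  let ?M = "lebesgue_on {0<..<T}"
  obtain s where s: "\<And>k::nat. step_fun S T (s k)" "AE t in ?M. (\<lambda>k. nrm (\<lambda>a. f t a - s k t a)) \<longlonglongrightarrow> 0"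
    using f unfolding strongly_measurable_def by blast
  obtain r where r: "\<And>k::nat. step_fun S T (r k)" "AE t in ?M. (\<lambda>k. nrm (\<lambda>a. h t a - r k t a)) \<longlonglongrightarrow> 0"
    using h unfolding strongly_measurable_def by blast
  have fS: "AE t in ?M. f t \<in> S" and hS: "AE t in ?M. h t \<in> S"
    using f h by (auto simp: strongly_measurable_def)
  let ?d = "\<lambda>k t x. s k t x - r k t x"
  have step: "step_fun S T (?d k)" for k
    unfolding step_fun_def
  proof (intro conjI allI)
    let ?F = "(\<lambda>(v, w) x. v x - w x) ` ((s k ` {0<..<T}) \<times> (r k ` {0<..<T}))"
    have "?d k ` {0<..<T} \<subseteq> ?F" by force
    moreover have "finite ?F" using s(1)[of k] r(1)[of k] by (simp add: step_fun_def)
    ultimately show "finite (?d k ` {0<..<T})" by (rule finite_subset)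
    show "?d k ` {0<..<T} \<subseteq> S"
      using fun_subspace_diff[OF subspace step_fun_in[OF s(1)] step_fun_in[OF r(1)]] by auto
    fix v
    have "{t \<in> {0<..<T}. ?d k t = v} = (\<Union>(a, b)\<in>{(a, b) \<in> (s k ` {0<..<T}) \<times> (r k ` {0<..<T}). (\<lambda>x. a x - b x) = v}.
        {t \<in> {0<..<T}. s k t = a} \<inter> {t \<in> {0<..<T}. r k t = b})" (is "?L = ?R")
    proof (rule set_eqI)
      fix t show "t \<in> ?L \<longleftrightarrow> t \<in> ?R" by (cases "t \<in> {0<..<T}") (auto intro!: bexI[of _ t])
    qed
    moreover have "\<dots> \<in> sets lebesgue"
    proof (rule sets.finite_UN)
      show "finite {(a, b) \<in> (s k ` {0<..<T}) \<times> (r k ` {0<..<T}). (\<lambda>x. a x - b x) = v}"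
        using s(1)[of k] r(1)[of k]
        by (intro finite_subset[OF _ finite_cartesian_product[of "s k ` {0<..<T}" "r k ` {0<..<T}"]])
           (auto simp: step_fun_def)
      show "(case ab of (a, b) \<Rightarrow> {t \<in> {0<..<T}. s k t = a} \<inter> {t \<in> {0<..<T}. r k t = b}) \<in> sets lebesgue" for ab
        using s(1)[of k] r(1)[of k] by (cases ab) (auto simp: step_fun_def)
    qed
    ultimately show "{t \<in> {0<..<T}. ?d k t = v} \<in> sets lebesgue" by simp
  qed
  have "AE t in ?M. (\<lambda>x. f t x - h t x) \<in> S"
    using fS hS by eventually_elim (rule fun_subspace_diff[OF subspace])
  moreover have "AE t in ?M. (\<lambda>k. nrm (\<lambda>a. (f t a - h t a) - ?d k t a)) \<longlonglongrightarrow> 0"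
    using fS hS s(2) r(2) AE_space
  proof eventually_elim
    case (elim t)
    have t: "t \<in> {0<..<T}" using elim by simp
    let ?e = "\<lambda>k. nrm (\<lambda>a. f t a - s k t a)" and ?e' = "\<lambda>k. nrm (\<lambda>a. h t a - r k t a)"
    have lim: "(\<lambda>k. ?e k + ?e' k) \<longlonglongrightarrow> 0" using tendsto_add[OF elim(3,4)] by simp
    show ?case
    proof (rule tendsto_sandwich[OF _ _ tendsto_const lim])
      show "\<forall>\<^sub>F k in sequentially. 0 \<le> nrm (\<lambda>a. (f t a - h t a) - ?d k t a)"
        by (intro always_eventually allI nrm_nonneg fun_subspace_diff[OF subspace] elim(1,2)
            step_fun_in[OF s(1) t] step_fun_in[OF r(1) t])
      have "nrm (\<lambda>a. (f t a - h t a) - ?d k t a) \<le> ?e k + ?e' k" for k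
      proof -
        have "(\<lambda>a. (f t a - h t a) - ?d k t a) = (\<lambda>a. (f t a - s k t a) - (h t a - r k t a))"
          by (rule ext) (simp add: algebra_simps)
        then show ?thesis
          using nrm_diff_le[OF fun_subspace_diff[OF subspace elim(1) step_fun_in[OF s(1) t]]
              fun_subspace_diff[OF subspace elim(2) step_fun_in[OF r(1) t]], of k k] by simp
      qed
      then show "\<forall>\<^sub>F k in sequentially. nrm (\<lambda>a. (f t a - h t a) - ?d k t a) \<le> ?e k + ?e' k"
        by (intro always_eventually allI)
    qed
  qed
  ultimately show ?thesis
    unfolding strongly_measurable_def using step by (intro conjI exI[of _ ?d]) auto
qed

lemma dual_integrable:
  assumes l: "l \<in> dual_space S nrm" and f: "f \<in> L2_time S nrm T"
  shows "integrable (lebesgue_on {0<..<T}) (\<lambda>t. l (f t))"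
proof -
  interpret finite_measure "lebesgue_on {0<..<T}" by (rule finite_measure_time)
  have sm: "strongly_measurable S nrm T f" and i: "integrable (lebesgue_on {0<..<T}) (\<lambda>t. (nrm (f t))\<^sup>2)"
    using f by (auto simp: L2_time_def)
  obtain C where C: "C > 0" "\<And>u. u \<in> S \<Longrightarrow> \<bar>l u\<bar> \<le> C * nrm u"
    using dual_space_bound[OF l nrm_nonneg] by blast
  show ?thesis
  proof (rule Bochner_Integration.integrable_bound)
    show "integrable (lebesgue_on {0<..<T}) (\<lambda>t. C * (1 + (nrm (f t))\<^sup>2))" using i by simp
    show "(\<lambda>t. l (f t)) \<in> borel_measurable (lebesgue_on {0<..<T})"
      by (rule dual_measurable[OF l subspace nrm_nonneg nrm_zero sm])
    have "AE t in lebesgue_on {0<..<T}. f t \<in> S" using sm by (simp add: strongly_measurable_def)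
    then show "AE t in lebesgue_on {0<..<T}. norm (l (f t)) \<le> norm (C * (1 + (nrm (f t))\<^sup>2))"
    proof eventually_elim
      case (elim t)
      have "nrm (f t) \<le> 1 + (nrm (f t))\<^sup>2"
        using zero_le_power2[of "nrm (f t) - 1"] nrm_nonneg[OF elim] unfolding power2_diff by simp
      then have "C * nrm (f t) \<le> C * (1 + (nrm (f t))\<^sup>2)" using C(1) by (intro mult_left_mono) auto
      then have "norm (l (f t)) \<le> C * (1 + (nrm (f t))\<^sup>2)" using C(2)[OF elim] by simp
      then show ?case unfolding real_norm_def by (rule order_trans[OF _ abs_ge_self])
    qed
  qed
qed

lemma continuous_dual:
  fixes I :: "real set"
  assumes l: "l \<in> dual_space S nrm" and cS: "\<And>t. t \<in> I \<Longrightarrow> C t \<in> S"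
    and C: "\<And>t. t \<in> I \<Longrightarrow> ((\<lambda>s. nrm (\<lambda>a. C s a - C t a)) \<longlongrightarrow> 0) (at t within I)"
  shows "continuous_on I (\<lambda>t. l (C t))"
  unfolding continuous_on_def
proof
  fix t assume t: "t \<in> I"
  have ev: "\<forall>\<^sub>F s in at t within I. C s \<in> S" by (simp add: eventually_at_filter cS)
  show "((\<lambda>t. l (C t)) \<longlongrightarrow> l (C t)) (at t within I)"
    by (rule dual_tendsto[OF l subspace _ cS[OF t] ev C[OF t]]) (rule nrm_nonneg)
qed

lemma continuous_form:
  fixes I :: "real set"
  assumes cS: "\<And>t. t \<in> I \<Longrightarrow> C t \<in> S"
    and C: "\<And>t. t \<in> I \<Longrightarrow> ((\<lambda>s. nrm (\<lambda>a. C s a - C t a)) \<longlongrightarrow> 0) (at t within I)"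
  shows "continuous_on (I \<times> I) (\<lambda>(s, t). q (C s) (C t))"
  unfolding continuous_on_sequentially
proof (intro allI ballI impI, elim conjE)
  fix x :: "nat \<Rightarrow> real \<times> real" and a assume a: "a \<in> I \<times> I" and xI: "\<forall>n. x n \<in> I \<times> I" and lim: "x \<longlonglongrightarrow> a"
  have conv: "(\<lambda>n. nrm (\<lambda>p. C t p - C (y n) p)) \<longlonglongrightarrow> 0" if t: "t \<in> I" and y: "\<And>n. y n \<in> I" "y \<longlonglongrightarrow> t" for t y
  proof -
    let ?k = "\<lambda>s. nrm (\<lambda>p. C s p - C t p)"
    have "?k t = 0" by (simp add: nrm_zero)
    then have "continuous (at t within I) ?k" using C[OF t] by (simp add: continuous_within)
    from continuous_within_tendsto_compose'[OF this y(1) y(2)]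
    have "(\<lambda>n. ?k (y n)) \<longlonglongrightarrow> 0" using \<open>?k t = 0\<close> by simp
    then show ?thesis using nrm_diff_commute[OF cS[OF y(1)] cS[OF t]] by simp
  qed
  have "(\<lambda>n. q (C (fst (x n))) (C (snd (x n)))) \<longlonglongrightarrow> q (C (fst a)) (C (snd a))"
  proof (rule form_tendsto)
    show "(\<lambda>n. nrm (\<lambda>p. C (fst a) p - C (fst (x n)) p)) \<longlonglongrightarrow> 0"
      by (rule conv) (use a xI lim in \<open>auto intro: tendsto_fst simp: mem_Times_iff\<close>)
    show "(\<lambda>n. nrm (\<lambda>p. C (snd a) p - C (snd (x n)) p)) \<longlonglongrightarrow> 0"
      by (rule conv) (use a xI lim in \<open>auto intro: tendsto_snd simp: mem_Times_iff\<close>)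
  qed (use a xI cS in \<open>auto simp: mem_Times_iff\<close>)
  then show "((\<lambda>(s, t). q (C s) (C t)) \<circ> x) \<longlonglongrightarrow> (case a of (s, t) \<Rightarrow> q (C s) (C t))"
    by (simp add: o_def case_prod_beta)
qed

end



section \<open>Square integrable fields and the weak divergence\<close>

lemma L2_measurable: "f \<in> L2 S \<Longrightarrow> f \<in> borel_measurable (lebesgue_on S)"
  and L2_integrable: "f \<in> L2 S \<Longrightarrow> integrable (lebesgue_on S) (\<lambda>x. (norm (f x))\<^sup>2)"
  by (auto simp: L2_def)

lemma L2_weighted_integrable:
  fixes f g :: "'a::euclidean_space \<Rightarrow> 'b::euclidean_space"
  assumes f: "f \<in> L2 S" and g: "g \<in> L2 S" and w: "w \<in> borel_measurable (lebesgue_on S)"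
    and C: "\<And>x. x \<in> S \<Longrightarrow> \<bar>w x\<bar> \<le> (C::real)"
  shows "integrable (lebesgue_on S) (\<lambda>x. w x * (f x \<bullet> g x))"
proof (rule Bochner_Integration.integrable_bound)
  show "integrable (lebesgue_on S) (\<lambda>x. C * ((norm (f x))\<^sup>2 + (norm (g x))\<^sup>2))"
    using L2_integrable[OF f] L2_integrable[OF g] by simp
  show "(\<lambda>x. w x * (f x \<bullet> g x)) \<in> borel_measurable (lebesgue_on S)"
    by (rule borel_measurable_times[OF w borel_measurable_inner[OF L2_measurable[OF f] L2_measurable[OF g]]])
  show "AE x in lebesgue_on S. norm (w x * (f x \<bullet> g x)) \<le> norm (C * ((norm (f x))\<^sup>2 + (norm (g x))\<^sup>2))"
  proof (rule AE_I2)
    fix x assume "x \<in> space (lebesgue_on S)"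
    then have wx: "\<bar>w x\<bar> \<le> C" using C by simp
    have "\<bar>f x \<bullet> g x\<bar> \<le> norm (f x) * norm (g x)" by (rule Cauchy_Schwarz_ineq2)
    also have "\<dots> \<le> (norm (f x))\<^sup>2 + (norm (g x))\<^sup>2"
    proof -
      have "0 \<le> (norm (f x) - norm (g x))\<^sup>2" "0 \<le> norm (f x) * norm (g x)" by auto
      then show ?thesis unfolding power2_diff by linarith
    qed
    finally have fg: "\<bar>f x \<bullet> g x\<bar> \<le> (norm (f x))\<^sup>2 + (norm (g x))\<^sup>2" .
    have "norm (w x * (f x \<bullet> g x)) \<le> C * ((norm (f x))\<^sup>2 + (norm (g x))\<^sup>2)"
      unfolding real_norm_def abs_mult using wx by (intro mult_mono wx fg) auto
    then show "norm (w x * (f x \<bullet> g x)) \<le> norm (C * ((norm (f x))\<^sup>2 + (norm (g x))\<^sup>2))"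
      using abs_ge_self order_trans unfolding real_norm_def by blast
  qed
qed

lemma L2_inner_integrable:
  assumes "f \<in> L2 S" "g \<in> L2 S" shows "integrable (lebesgue_on S) (\<lambda>x. f x \<bullet> g x)"
  using L2_weighted_integrable[OF assms, of "\<lambda>_. 1" 1] by simp

lemma L2_mult_integrable:
  fixes f g :: "'a::euclidean_space \<Rightarrow> real"
  assumes "f \<in> L2 S" "g \<in> L2 S" shows "integrable (lebesgue_on S) (\<lambda>x. f x * g x)"
  using L2_inner_integrable[OF assms] by simp

lemma L2_bounded_by:
  fixes f :: "'a::euclidean_space \<Rightarrow> 'b::euclidean_space"
  assumes m: "f \<in> borel_measurable (lebesgue_on S)" and i: "integrable (lebesgue_on S) h"
    and b: "\<And>x. x \<in> S \<Longrightarrow> (norm (f x))\<^sup>2 \<le> h x"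
  shows "f \<in> L2 S"
proof -
  have "integrable (lebesgue_on S) (\<lambda>x. (norm (f x))\<^sup>2)"
  proof (rule Bochner_Integration.integrable_bound[OF i])
    show "(\<lambda>x. (norm (f x))\<^sup>2) \<in> borel_measurable (lebesgue_on S)"
      by (rule borel_measurable_power[OF measurable_compose[OF m borel_measurable_norm]])
    show "AE x in lebesgue_on S. norm ((norm (f x))\<^sup>2) \<le> norm (h x)"
      by (rule AE_I2) (use b in \<open>auto intro: order_trans[OF _ abs_ge_self]\<close>)
  qed
  then show ?thesis using m by (simp add: L2_def)
qed

lemma L2_add:
  fixes f g :: "'a::euclidean_space \<Rightarrow> 'b::euclidean_space"
  assumes f: "f \<in> L2 S" and g: "g \<in> L2 S" shows "(\<lambda>x. f x + g x) \<in> L2 S"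
proof (rule L2_bounded_by)
  show "(\<lambda>x. f x + g x) \<in> borel_measurable (lebesgue_on S)"
    by (rule borel_measurable_add[OF L2_measurable[OF f] L2_measurable[OF g]])
  show "integrable (lebesgue_on S) (\<lambda>x. 2 * (norm (f x))\<^sup>2 + 2 * (norm (g x))\<^sup>2)"
    using L2_integrable[OF f] L2_integrable[OF g] by simp
  fix x
  have "(norm (f x + g x))\<^sup>2 \<le> (norm (f x) + norm (g x))\<^sup>2" by (intro power_mono norm_triangle_ineq) simp
  also have "\<dots> \<le> 2 * (norm (f x))\<^sup>2 + 2 * (norm (g x))\<^sup>2"
  proof -
    have "0 \<le> (norm (f x) - norm (g x))\<^sup>2" by simp
    then show ?thesis unfolding power2_diff power2_sum by linarith
  qed
  finally show "(norm (f x + g x))\<^sup>2 \<le> 2 * (norm (f x))\<^sup>2 + 2 * (norm (g x))\<^sup>2" .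
qed

lemma L2_bounded_mult:
  fixes f :: "'a::euclidean_space \<Rightarrow> 'b::euclidean_space"
  assumes f: "f \<in> L2 S" and w: "w \<in> borel_measurable (lebesgue_on S)" and C: "\<And>x. x \<in> S \<Longrightarrow> \<bar>w x\<bar> \<le> (C::real)"
  shows "(\<lambda>x. w x *\<^sub>R f x) \<in> L2 S"
proof (rule L2_bounded_by)
  show "(\<lambda>x. w x *\<^sub>R f x) \<in> borel_measurable (lebesgue_on S)"
    by (rule borel_measurable_scaleR[OF w L2_measurable[OF f]])
  show "integrable (lebesgue_on S) (\<lambda>x. C\<^sup>2 * (norm (f x))\<^sup>2)" using L2_integrable[OF f] by simp
  fix x assume "x \<in> S"
  then have "\<bar>w x\<bar>\<^sup>2 \<le> C\<^sup>2" using C[of x] by (intro power_mono) auto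
  then show "(norm (w x *\<^sub>R f x))\<^sup>2 \<le> C\<^sup>2 * (norm (f x))\<^sup>2"
    by (simp add: power_mult_distrib mult_right_mono)
qed

lemma L2_subspace: "fun_subspace (L2 S :: ('a::euclidean_space \<Rightarrow> 'b::euclidean_space) set)"
  unfolding fun_subspace_def
proof (intro conjI ballI allI)
  show "(\<lambda>x. 0) \<in> (L2 S :: ('a \<Rightarrow> 'b) set)" by (simp add: L2_def)
  show "(\<lambda>x. r *\<^sub>R u x) \<in> L2 S" if "u \<in> L2 S" for u :: "'a \<Rightarrow> 'b" and r
    by (rule L2_bounded_mult[OF that, of "\<lambda>_. r" "\<bar>r\<bar>"]) auto
qed (rule L2_add)

lemma L2_snd: "U \<in> L2 S \<Longrightarrow> (\<lambda>p. snd (U p)) \<in> L2 S"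
  for U :: "'a::euclidean_space \<Rightarrow> 'b::euclidean_space \<times> 'c::euclidean_space"
proof (rule L2_bounded_by[of _ _ "\<lambda>p. (norm (U p))\<^sup>2"])
  assume U: "U \<in> L2 S"
  show "(\<lambda>p. snd (U p)) \<in> borel_measurable (lebesgue_on S)"
    by (rule measurable_compose[OF L2_measurable[OF U] borel_measurable_continuous_onI[OF continuous_on_snd[OF continuous_on_id]]])
  show "integrable (lebesgue_on S) (\<lambda>p. (norm (U p))\<^sup>2)" by (rule L2_integrable[OF U])
  show "(norm (snd (U p)))\<^sup>2 \<le> (norm (U p))\<^sup>2" for p
    by (intro power_mono) (use norm_snd_le[of "snd (U p)" "fst (U p)"] in simp_all)
qed

lemma L2_integrable_on_cbox:
  fixes f :: "'a::euclidean_space \<Rightarrow> real"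
  assumes f: "f \<in> L2 S" and S: "S \<in> sets lebesgue" and ab: "cbox a b \<subseteq> S"
  shows "integrable lebesgue (\<lambda>x. indicator (cbox a b) x * f x)"
proof -
  have ind: "(\<lambda>x. indicator (cbox a b) x :: real) \<in> L2 S"
  proof (rule L2_bounded_by)
    show m: "(\<lambda>x. indicator (cbox a b) x :: real) \<in> borel_measurable (lebesgue_on S)"
      by (intro borel_imp_measurable_lebesgue_on borel_measurable_indicator) simp
    show "integrable (lebesgue_on S) (\<lambda>x. indicator (cbox a b) x :: real)"
    proof (subst integrable_restrict_space)
      have "(\<lambda>x. indicator S x *\<^sub>R (indicator (cbox a b) x :: real)) = indicator (cbox a b)"
        using ab by (auto simp: indicator_def fun_eq_iff)
      moreover have "integrable lebesgue (indicator (cbox a b) :: 'a \<Rightarrow> real)"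
        by (rule integrable_real_indicator) (use lmeasurable_cbox[of a b] in \<open>auto simp: fmeasurable_def\<close>)
      ultimately show "integrable lebesgue (\<lambda>x. indicator S x *\<^sub>R (indicator (cbox a b) x :: real))"
        by simp
    qed (use S in simp)
  qed (simp add: indicator_def)
  have "integrable lebesgue (\<lambda>x. indicator S x *\<^sub>R (indicator (cbox a b) x * f x))"
    using L2_mult_integrable[OF ind f] by (subst (asm) integrable_restrict_space) (use S in auto)
  moreover have "(\<lambda>x. indicator S x *\<^sub>R (indicator (cbox a b) x * f x)) = (\<lambda>x. indicator (cbox a b) x * f x)"
    using ab by (auto simp: indicator_def fun_eq_iff)
  ultimately show ?thesis by simp
qed

text \<open>
  All forms used below arise in this way.  The map \<open>L\<close> is linear only up to null sets, as are
  the weak divergence and the trace, which are obtained by choosing a representative.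
\<close>

lemma psd_form_weighted_pullback:
  fixes L :: "('x \<Rightarrow> 'y::real_vector) \<Rightarrow> 'a::euclidean_space \<Rightarrow> 'b::euclidean_space"
  assumes D: "fun_subspace D" and L: "\<And>u. u \<in> D \<Longrightarrow> L u \<in> L2 S"
    and add: "\<And>u v. u \<in> D \<Longrightarrow> v \<in> D \<Longrightarrow> AE x in lebesgue_on S. L (\<lambda>x. u x + v x) x = L u x + L v x"
    and scale: "\<And>u r. u \<in> D \<Longrightarrow> AE x in lebesgue_on S. L (\<lambda>x. r *\<^sub>R u x) x = r *\<^sub>R L u x"
    and w: "w \<in> borel_measurable (lebesgue_on S)" and C: "\<And>x. x \<in> S \<Longrightarrow> 0 \<le> w x \<and> w x \<le> C"
  shows "psd_form D (\<lambda>u v. LINT x|lebesgue_on S. w x * (L u x \<bullet> L v x))"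
proof -
  have int: "integrable (lebesgue_on S) (\<lambda>x. w x * (f x \<bullet> g x))" if "f \<in> L2 S" "g \<in> L2 S" for f g :: "'a \<Rightarrow> 'b"
    by (rule L2_weighted_integrable[OF that w, of C]) (use C in auto)
  show ?thesis
  proof
    show "fun_subspace D" by (rule D)
    fix u v z assume u: "u \<in> D" and v: "v \<in> D" and z: "z \<in> D"
    have "(LINT x|lebesgue_on S. w x * (L (\<lambda>x. u x + v x) x \<bullet> L z x)) =
        (LINT x|lebesgue_on S. w x * (L u x \<bullet> L z x) + w x * (L v x \<bullet> L z x))"
    proof (rule integral_cong_AE)
      show "AE x in lebesgue_on S. w x * (L (\<lambda>x. u x + v x) x \<bullet> L z x) = w x * (L u x \<bullet> L z x) + w x * (L v x \<bullet> L z x)"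
        using add[OF u v] by eventually_elim (simp add: inner_add_left distrib_left)
    qed (intro borel_measurable_integrable int L fun_subspaceD[OF D] u v z
          borel_measurable_add | assumption)+
    then show "(LINT x|lebesgue_on S. w x * (L (\<lambda>x. u x + v x) x \<bullet> L z x)) =
        (LINT x|lebesgue_on S. w x * (L u x \<bullet> L z x)) + (LINT x|lebesgue_on S. w x * (L v x \<bullet> L z x))"
      using int[OF L[OF u] L[OF z]] int[OF L[OF v] L[OF z]] by simp
  next
    fix u z r assume u: "u \<in> D" and z: "z \<in> D"
    have "(LINT x|lebesgue_on S. w x * (L (\<lambda>x. r *\<^sub>R u x) x \<bullet> L z x)) =
        (LINT x|lebesgue_on S. r * (w x * (L u x \<bullet> L z x)))"
    proof (rule integral_cong_AE)
      show "AE x in lebesgue_on S. w x * (L (\<lambda>x. r *\<^sub>R u x) x \<bullet> L z x) = r * (w x * (L u x \<bullet> L z x))"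
        using scale[OF u, of r] by eventually_elim simp
      show "(\<lambda>x. w x * (L (\<lambda>x. r *\<^sub>R u x) x \<bullet> L z x)) \<in> borel_measurable (lebesgue_on S)"
        by (rule borel_measurable_integrable[OF int[OF L[OF fun_subspaceD(3)[OF D u]] L[OF z]]])
      show "(\<lambda>x. r * (w x * (L u x \<bullet> L z x))) \<in> borel_measurable (lebesgue_on S)"
        by (rule borel_measurable_times[OF borel_measurable_const borel_measurable_integrable[OF int[OF L[OF u] L[OF z]]]])
    qed
    then show "(LINT x|lebesgue_on S. w x * (L (\<lambda>x. r *\<^sub>R u x) x \<bullet> L z x)) =
        r * (LINT x|lebesgue_on S. w x * (L u x \<bullet> L z x))" by simp
  next
    fix u v
    show "(LINT x|lebesgue_on S. w x * (L u x \<bullet> L v x)) = (LINT x|lebesgue_on S. w x * (L v x \<bullet> L u x))"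
      by (simp add: inner_commute)
    show "0 \<le> (LINT x|lebesgue_on S. w x * (L u x \<bullet> L u x))"
      by (rule Bochner_Integration.integral_nonneg_AE, rule AE_I2) (use C in simp)
  qed
qed

lemma psd_form_add:
  assumes "psd_form D q" "psd_form D r" shows "psd_form D (\<lambda>u v. q u v + r u v)"
proof -
  interpret q: psd_form D q by fact
  interpret r: psd_form D r by fact
  show ?thesis
    by unfold_locales
       (auto simp: q.subspace q.form_add r.form_add q.form_scale r.form_scale algebra_simps
          q.form_sym r.form_sym q.form_nonneg r.form_nonneg)
qed

lemma psd_form_subset:
  assumes "psd_form D q" "fun_subspace D'" "D' \<subseteq> D" shows "psd_form D' q"
proof -
  interpret q: psd_form D q by fact
  show ?thesis
    using assms(2,3) by unfold_locales (auto intro: q.form_add q.form_scale q.form_sym q.form_nonneg)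
qed

lemma continuous_compact_support_L2:
  fixes f :: "'a::euclidean_space \<Rightarrow> 'b::euclidean_space"
  assumes c: "continuous_on UNIV f" and K: "compact K" "\<And>x. x \<notin> K \<Longrightarrow> f x = 0" and S: "S \<in> sets lebesgue"
  shows "f \<in> L2 S"
proof -
  have "compact (f ` K)" by (rule compact_continuous_image[OF continuous_on_subset[OF c] K(1)]) simp
  then obtain C where C: "\<And>y. y \<in> f ` K \<Longrightarrow> norm y \<le> C"
    using compact_imp_bounded bounded_iff by metis
  have m: "f \<in> borel_measurable (lebesgue_on S)"
    by (rule borel_imp_measurable_lebesgue_on, rule borel_measurable_continuous_onI[OF c])
  have KL: "K \<in> lmeasurable" using K(1) by (rule lmeasurable_compact)
  have "integrable lebesgue (\<lambda>x. C\<^sup>2 * indicator K x)"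
    using KL by (intro integrable_mult_right integrable_real_indicator) (auto simp: fmeasurable_def)
  from integrable_mult_indicator[OF S this]
  have i: "integrable (lebesgue_on S) (\<lambda>x. C\<^sup>2 * indicator K x)"
    by (subst integrable_restrict_space) (use S in auto)
  have "(norm (f x))\<^sup>2 \<le> C\<^sup>2 * indicator K x" for x
    using K(2)[of x] power_mono[OF C[of "f x"] norm_ge_zero, of 2] by (cases "x \<in> K") auto
  then show ?thesis by (intro L2_bounded_by[OF m i])
qed

lemma test_function_L2:
  assumes "\<phi> \<in> test_functions T" "S \<in> sets lebesgue" shows "\<phi> \<in> L2 S"
proof -
  obtain K where "compact K" "\<And>x. x \<notin> K \<Longrightarrow> \<phi> x = 0"
    using assms(1) unfolding test_functions_def by blast
  then show ?thesis
    by (rule continuous_compact_support_L2[OF test_function_continuous[OF assms(1)] _ _ assms(2)])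
qed

lemma grad_test_function_L2:
  assumes \<phi>: "\<phi> \<in> test_functions T" and S: "S \<in> sets lebesgue" shows "grad \<phi> \<in> L2 S"
proof -
  obtain K where K: "compact K" "\<And>x. x \<notin> K \<Longrightarrow> \<phi> x = 0" and C: "\<And>k. Ck k \<phi>"
    using \<phi> unfolding test_functions_def by blast
  show ?thesis
  proof (rule continuous_compact_support_L2[OF _ K(1) _ S])
    show "continuous_on UNIV (grad \<phi>)"
      unfolding grad_def
    proof (intro continuous_on_sum continuous_on_scaleR continuous_on_const)
      show "continuous_on UNIV (\<lambda>x. frechet_derivative \<phi> (at x) b)" if "b \<in> Basis" for b
        using C[of "Suc 0"] that by simp
    qed
    fix x assume "x \<notin> K"
    have "open (- K)" using compact_imp_closed[OF K(1)] by auto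
    have "(\<phi> has_derivative (\<lambda>h. 0)) (at x)"
      by (rule has_derivative_transform_within_open[of "\<lambda>_. 0" _ _ _ "- K"])
         (use \<open>x \<notin> K\<close> \<open>open (- K)\<close> K(2) in auto)
    then have "frechet_derivative \<phi> (at x) = (\<lambda>h. 0)" by (rule frechet_derivative_at[symmetric])
    then show "grad \<phi> x = 0" by (simp add: grad_def)
  qed
qed

lemma is_weak_div_L2: "is_weak_div S U f \<Longrightarrow> f \<in> L2 S"
  by (simp add: is_weak_div_def)

text \<open>
  Two weak divergences are square integrable, hence locally integrable, with equal integrals against test functions.
\<close>

lemma is_weak_div_unique:
  assumes S: "open S" and f: "is_weak_div S U f" and h: "is_weak_div S U h"
  shows "AE x in lebesgue_on S. f x = h x"
proof -
  have Sm: "S \<in> sets lebesgue" using lebesgue_openin[of UNIV S] S by simp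
  have fh: "(\<lambda>x. f x - h x) \<in> L2 S"
    by (rule fun_subspace_diff[OF L2_subspace is_weak_div_L2[OF f] is_weak_div_L2[OF h]])
  have "AE x in lebesgue_on S. f x - h x = 0"
  proof (rule AE_zero_if_orthogonal_to_test_functions[OF S L2_integrable_on_cbox[OF fh Sm]])
    fix \<phi> assume \<phi>: "\<phi> \<in> test_functions S"
    note \<phi>2 = test_function_L2[OF \<phi> Sm]
    have "(LINT p|lebesgue_on S. f p * \<phi> p) = (LINT p|lebesgue_on S. h p * \<phi> p)"
      using f h \<phi> by (simp add: is_weak_div_def)
    then show "(LINT x|lebesgue_on S. (f x - h x) * \<phi> x) = 0"
      using L2_mult_integrable[OF is_weak_div_L2[OF f] \<phi>2] L2_mult_integrable[OF is_weak_div_L2[OF h] \<phi>2]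
      by (simp add: left_diff_distrib)
  qed
  then show ?thesis by eventually_elim simp
qed

lemma weak_div_is_weak_div: "U \<in> Hdiv S \<Longrightarrow> is_weak_div S U (weak_div S U)"
  using someI_ex[of "is_weak_div S U"] by (simp add: Hdiv_def weak_div_def)

lemma weak_div_L2: "U \<in> Hdiv S \<Longrightarrow> weak_div S U \<in> L2 S"
  by (rule is_weak_div_L2[OF weak_div_is_weak_div])

lemma Hdiv_L2: "U \<in> Hdiv S \<Longrightarrow> U \<in> L2 S" by (simp add: Hdiv_def)

lemma is_weak_div_add:
  assumes S: "S \<in> sets lebesgue" and U: "U \<in> L2 S" "is_weak_div S U f" and V: "V \<in> L2 S" "is_weak_div S V h"
  shows "is_weak_div S (\<lambda>x. U x + V x) (\<lambda>x. f x + h x)"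
  unfolding is_weak_div_def
proof (intro conjI ballI)
  show "(\<lambda>x. f x + h x) \<in> L2 S" by (rule L2_add[OF is_weak_div_L2[OF U(2)] is_weak_div_L2[OF V(2)]])
  fix \<phi> assume \<phi>: "\<phi> \<in> test_functions S"
  note \<phi>2 = test_function_L2[OF \<phi> S] and g2 = grad_test_function_L2[OF \<phi> S]
  have "(LINT p|lebesgue_on S. U p \<bullet> grad \<phi> p) = - (LINT p|lebesgue_on S. f p * \<phi> p)"
    "(LINT p|lebesgue_on S. V p \<bullet> grad \<phi> p) = - (LINT p|lebesgue_on S. h p * \<phi> p)"
    using U V \<phi> by (auto simp: is_weak_div_def)
  then show "(LINT p|lebesgue_on S. (U p + V p) \<bullet> grad \<phi> p) = - (LINT p|lebesgue_on S. (f p + h p) * \<phi> p)"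
    using L2_inner_integrable[OF U(1) g2] L2_inner_integrable[OF V(1) g2]
      L2_mult_integrable[OF is_weak_div_L2[OF U(2)] \<phi>2] L2_mult_integrable[OF is_weak_div_L2[OF V(2)] \<phi>2]
    by (simp add: inner_add_left distrib_right)
qed

lemma is_weak_div_scale:
  assumes "is_weak_div S U f" shows "is_weak_div S (\<lambda>x. r *\<^sub>R U x) (\<lambda>x. r * f x)"
  using assms fun_subspaceD(3)[OF L2_subspace is_weak_div_L2[OF assms], of r]
  by (simp add: is_weak_div_def mult.assoc)

lemma Hdiv_subspace:
  assumes S: "S \<in> sets lebesgue" shows "fun_subspace (Hdiv S)"
  unfolding fun_subspace_def
proof (intro conjI ballI allI)
  have "is_weak_div S (\<lambda>x. 0) (\<lambda>x. 0)" using fun_subspaceD(1)[OF L2_subspace] by (auto simp: is_weak_div_def)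
  then show "(\<lambda>x. 0) \<in> Hdiv S" using fun_subspaceD(1)[OF L2_subspace] by (auto simp: Hdiv_def)
  show "(\<lambda>x. u x + v x) \<in> Hdiv S" if "u \<in> Hdiv S" "v \<in> Hdiv S" for u v
    using is_weak_div_add[OF S Hdiv_L2[OF that(1)] weak_div_is_weak_div[OF that(1)]
        Hdiv_L2[OF that(2)] weak_div_is_weak_div[OF that(2)]]
      L2_add[OF Hdiv_L2[OF that(1)] Hdiv_L2[OF that(2)]] by (auto simp: Hdiv_def)
  show "(\<lambda>x. r *\<^sub>R u x) \<in> Hdiv S" if "u \<in> Hdiv S" for u r
    using is_weak_div_scale[OF weak_div_is_weak_div[OF that]] fun_subspaceD(3)[OF L2_subspace Hdiv_L2[OF that]]
    by (auto simp: Hdiv_def)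
qed

lemma weak_div_add:
  assumes S: "open S" and U: "U \<in> Hdiv S" and V: "V \<in> Hdiv S"
  shows "AE x in lebesgue_on S. weak_div S (\<lambda>x. U x + V x) x = weak_div S U x + weak_div S V x"
proof -
  have Sm: "S \<in> sets lebesgue" using lebesgue_openin[of UNIV S] S by simp
  show ?thesis
    by (rule is_weak_div_unique[OF S weak_div_is_weak_div[OF fun_subspaceD(2)[OF Hdiv_subspace[OF Sm] U V]]
        is_weak_div_add[OF Sm Hdiv_L2[OF U] weak_div_is_weak_div[OF U] Hdiv_L2[OF V] weak_div_is_weak_div[OF V]]])
qed

lemma weak_div_scale:
  assumes S: "open S" and U: "U \<in> Hdiv S"
  shows "AE x in lebesgue_on S. weak_div S (\<lambda>x. r *\<^sub>R U x) x = r * weak_div S U x"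
proof -
  have Sm: "S \<in> sets lebesgue" using lebesgue_openin[of UNIV S] S by simp
  show ?thesis
    by (rule is_weak_div_unique[OF S weak_div_is_weak_div[OF fun_subspaceD(3)[OF Hdiv_subspace[OF Sm] U]]
        is_weak_div_scale[OF weak_div_is_weak_div[OF U]]])
qed

lemma green_add:
  assumes S: "open S" and U: "U \<in> Hdiv S" and V: "V \<in> Hdiv S" and \<phi>: "\<phi> \<in> test_functions T"
  shows "green S (\<lambda>x. U x + V x) \<phi> = green S U \<phi> + green S V \<phi>"
proof -
  have Sm: "S \<in> sets lebesgue" using lebesgue_openin[of UNIV S] S by simp
  note \<phi>2 = test_function_L2[OF \<phi> Sm] and g2 = grad_test_function_L2[OF \<phi> Sm]
  have UV: "(\<lambda>x. U x + V x) \<in> Hdiv S" by (rule fun_subspaceD(2)[OF Hdiv_subspace[OF Sm] U V])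
  have int: "integrable (lebesgue_on S) (\<lambda>p. W p \<bullet> grad \<phi> p + weak_div S W p * \<phi> p)" if "W \<in> Hdiv S" for W
    by (rule Bochner_Integration.integrable_add[OF L2_inner_integrable[OF Hdiv_L2[OF that] g2]
          L2_mult_integrable[OF weak_div_L2[OF that] \<phi>2]])
  have "green S (\<lambda>x. U x + V x) \<phi> = (LINT p|lebesgue_on S.
      (U p \<bullet> grad \<phi> p + weak_div S U p * \<phi> p) + (V p \<bullet> grad \<phi> p + weak_div S V p * \<phi> p))"
    unfolding green_def
  proof (rule integral_cong_AE[OF borel_measurable_integrable[OF int[OF UV]]
        borel_measurable_add[OF borel_measurable_integrable[OF int[OF U]] borel_measurable_integrable[OF int[OF V]]]])
    show "AE p in lebesgue_on S. (U p + V p) \<bullet> grad \<phi> p + weak_div S (\<lambda>x. U x + V x) p * \<phi> p =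
       (U p \<bullet> grad \<phi> p + weak_div S U p * \<phi> p) + (V p \<bullet> grad \<phi> p + weak_div S V p * \<phi> p)"
      using weak_div_add[OF S U V] by eventually_elim (simp add: inner_add_left distrib_right)
  qed
  also have "\<dots> = green S U \<phi> + green S V \<phi>"
    unfolding green_def by (rule Bochner_Integration.integral_add[OF int[OF U] int[OF V]])
  finally show ?thesis .
qed

lemma green_scale:
  assumes S: "open S" and U: "U \<in> Hdiv S" and \<phi>: "\<phi> \<in> test_functions T"
  shows "green S (\<lambda>x. r *\<^sub>R U x) \<phi> = r * green S U \<phi>"
proof -
  have Sm: "S \<in> sets lebesgue" using lebesgue_openin[of UNIV S] S by simp
  note \<phi>2 = test_function_L2[OF \<phi> Sm] and g2 = grad_test_function_L2[OF \<phi> Sm]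
  have rU: "(\<lambda>x. r *\<^sub>R U x) \<in> Hdiv S" by (rule fun_subspaceD(3)[OF Hdiv_subspace[OF Sm] U])
  have int: "integrable (lebesgue_on S) (\<lambda>p. W p \<bullet> grad \<phi> p + weak_div S W p * \<phi> p)" if "W \<in> Hdiv S" for W
    by (rule Bochner_Integration.integrable_add[OF L2_inner_integrable[OF Hdiv_L2[OF that] g2]
          L2_mult_integrable[OF weak_div_L2[OF that] \<phi>2]])
  have "green S (\<lambda>x. r *\<^sub>R U x) \<phi> = (LINT p|lebesgue_on S. r * (U p \<bullet> grad \<phi> p + weak_div S U p * \<phi> p))"
    unfolding green_def
  proof (rule integral_cong_AE[OF borel_measurable_integrable[OF int[OF rU]]
        borel_measurable_times[OF borel_measurable_const borel_measurable_integrable[OF int[OF U]]]])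
    show "AE p in lebesgue_on S. (r *\<^sub>R U p) \<bullet> grad \<phi> p + weak_div S (\<lambda>x. r *\<^sub>R U x) p * \<phi> p =
       r * (U p \<bullet> grad \<phi> p + weak_div S U p * \<phi> p)"
      using weak_div_scale[OF S U, of r] by eventually_elim (simp add: algebra_simps)
  qed
  then show ?thesis by (simp add: green_def)
qed

section \<open>Normal traces and the operators\<close>

lemma zero_in_dual_space: "(\<lambda>u. 0) \<in> dual_space S p"
  unfolding dual_space_def by (auto intro!: exI[of _ 0])

lemma test_function_slice_L2:
  fixes \<phi> :: "(real ^ 'n::finite) \<times> real \<Rightarrow> real"
  assumes \<phi>: "\<phi> \<in> test_functions T" shows "(\<lambda>x. \<phi> (x, h)) \<in> L2 UNIV"
proof -
  obtain K where K: "compact K" "\<And>x. x \<notin> K \<Longrightarrow> \<phi> x = 0"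
    using \<phi> unfolding test_functions_def by blast
  show ?thesis
  proof (rule continuous_compact_support_L2)
    show "continuous_on UNIV (\<lambda>x. \<phi> (x, h))"
      by (rule continuous_on_compose2[OF test_function_continuous[OF \<phi>], of UNIV "\<lambda>x. (x, h)",
            OF continuous_on_Pair[OF continuous_on_id continuous_on_const]]) simp
    show "compact (fst ` K)" by (rule compact_continuous_image[OF continuous_on_fst[OF continuous_on_id] K(1)])
    show "\<phi> (x, h) = 0" if "x \<notin> fst ` K" for x using K(2)[of "(x, h)"] that by force
  qed simp
qed

lemma psd_form_L2:
  assumes "w \<in> borel_measurable (lebesgue_on S)" "\<And>x. x \<in> S \<Longrightarrow> 0 \<le> w x \<and> w x \<le> C"
  shows "psd_form (L2 S :: ('a::euclidean_space \<Rightarrow> 'b::euclidean_space) set) (\<lambda>u v. LINT x|lebesgue_on S. w x * (u x \<bullet> v x))"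
  by (rule psd_form_weighted_pullback[where L = "\<lambda>u. u", OF L2_subspace _ _ _ assms]) auto

text \<open>
  The norm of \<open>H\<^sup>1\<^sup>/\<^sup>2\<close> dominates the \<open>L\<^sup>2\<close> norm, so Cauchy--Schwarz gives the bound.
\<close>

lemma top_functional_in_dual:
  fixes k :: "real ^ 'n::finite \<Rightarrow> real"
  assumes k: "k \<in> L2 UNIV" shows "top_functional H k \<in> Hmhalf (\<lambda>x. H)"
proof -
  interpret q: psd_form "L2 UNIV :: (real ^ 'n \<Rightarrow> real) set" "\<lambda>u v. LINT x|lebesgue_on UNIV. 1 * (u x \<bullet> v x)"
    by (rule psd_form_L2[of _ _ 1]) auto
  have q: "(LINT x|lebesgue_on UNIV. 1 * (u x \<bullet> v x)) = (LINT x|lebesgue. u x * v x)" for u v :: "real ^ 'n \<Rightarrow> real"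
    by (simp add: lebesgue_on_UNIV_eq)
  have slice: "(\<lambda>x. u (x, H)) \<in> L2 UNIV" if "u \<in> Hhalf (\<lambda>x. H)" for u :: "'n pt \<Rightarrow> real"
    using that by (simp add: Hhalf_def)
  have int: "integrable lebesgue (\<lambda>x. k x * u (x, H))" if "u \<in> Hhalf (\<lambda>x. H)" for u
    using L2_mult_integrable[OF k slice[OF that]] by (simp add: lebesgue_on_UNIV_eq)
  show ?thesis
    unfolding dual_space_def mem_Collect_eq
  proof (intro conjI ballI allI exI[of _ "q.nrm k"])
    show "top_functional H k (\<lambda>a. u a + v a) = top_functional H k u + top_functional H k v"
      if "u \<in> Hhalf (\<lambda>x. H)" "v \<in> Hhalf (\<lambda>x. H)" for u v
      using int[OF that(1)] int[OF that(2)] by (simp add: top_functional_def distrib_left)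
    show "top_functional H k (\<lambda>a. r *\<^sub>R u a) = r * top_functional H k u" for u r
      by (simp add: top_functional_def mult.left_commute[of _ r])
    fix u :: "'n pt \<Rightarrow> real" assume u: "u \<in> Hhalf (\<lambda>x. H)"
    have "\<bar>top_functional H k u\<bar> \<le> q.nrm k * q.nrm (\<lambda>x. u (x, H))"
      using q.Cauchy_Schwarz[OF k slice[OF u]] by (simp only: q top_functional_def)
    also have "\<dots> \<le> q.nrm k * Hhalf_norm (\<lambda>x. H) u"
    proof (intro mult_left_mono q.nrm_nonneg[OF k])
      show "q.nrm (\<lambda>x. u (x, H)) \<le> Hhalf_norm (\<lambda>x. H) u"
        unfolding q.nrm_def unfolding q Hhalf_norm_def by (simp add: power2_eq_square)
    qed
    finally show "\<bar>top_functional H k u\<bar> \<le> q.nrm k * Hhalf_norm (\<lambda>x. H) u" .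
  qed
qed

locale stratified_fluid =
  fixes H g Hm rho_m rho_p c_m c_p :: real
    and zb :: "real ^ 'n::finite \<Rightarrow> real" and rho c :: "real \<Rightarrow> real"
  assumes H: "H > 0" and g: "g > 0" and zb_cont: "continuous_on UNIV zb" and Hm: "Hm < H"
    and zb: "\<And>x. 0 \<le> zb x \<and> zb x \<le> Hm"
    and rho_diff: "\<And>z. z \<in> {0..H} \<Longrightarrow> rho differentiable (at z within {0..H})"
    and rho_C1: "continuous_on {0..H} (\<lambda>z. vector_derivative rho (at z within {0..H}))"
    and c_cont: "continuous_on {0..H} c"
    and rho_m: "0 < rho_m" and rho: "\<And>z. z \<in> {0..H} \<Longrightarrow> rho_m \<le> rho z \<and> rho z \<le> rho_p"
    and c_m: "0 < c_m" and c: "\<And>z. z \<in> {0..H} \<Longrightarrow> c_m \<le> c z \<and> c z \<le> c_p"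
    and N2: "\<And>z. z \<in> {0..H} \<Longrightarrow> N2 H g rho c z \<ge> 0"
begin

abbreviation "\<Omega> \<equiv> Dom H zb"
abbreviation "aform u v \<equiv> inner_G H g zb rho c (Gt H g zb rho c u) (Gt H g zb rho c v)"
abbreviation "bform \<equiv> inner_H H zb rho"
abbreviation "DGt \<equiv> dom_Gt H zb"
abbreviation "DG \<equiv> dom_G H zb"
abbreviation "ttrace \<equiv> is_L2_top_trace H zb"

lemma open_Dom: "open \<Omega>"
proof -
  have "\<Omega> = {p. zb (fst p) < snd p} \<inter> {p. snd p < H}" by (auto simp: Dom_def)
  moreover have "continuous_on UNIV (\<lambda>p::'n pt. zb (fst p))"
    by (rule continuous_on_compose2[OF zb_cont continuous_on_fst[OF continuous_on_id]]) simp
  ultimately show ?thesis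
    by (auto intro!: open_Int open_Collect_less continuous_on_snd continuous_on_id continuous_on_const)
qed

lemma Dom_measurable: "\<Omega> \<in> sets lebesgue"
  using lebesgue_openin[of UNIV \<Omega>] open_Dom by simp

lemma Dom_height: "p \<in> \<Omega> \<Longrightarrow> snd p \<in> {0..H}"
  using zb[of "fst p"] by (auto simp: Dom_def)

lemma coefficient_measurable:
  assumes "continuous_on {0..H} f"
  shows "(\<lambda>p. f (snd p) :: real) \<in> borel_measurable (lebesgue_on \<Omega>)"
  by (rule continuous_imp_measurable_on_sets_lebesgue[OF continuous_on_compose2[OF assms
        continuous_on_snd[OF continuous_on_id]] Dom_measurable]) (use Dom_height in auto)

lemma coefficient_bounded:
  assumes "continuous_on {0..H} f"
  obtains C where "\<And>p. p \<in> \<Omega> \<Longrightarrow> \<bar>f (snd p) :: real\<bar> \<le> C"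
proof -
  have "compact (f ` {0..H})" by (rule compact_continuous_image[OF assms]) simp
  then obtain C where "\<And>y. y \<in> f ` {0..H} \<Longrightarrow> norm y \<le> C"
    using compact_imp_bounded bounded_iff by metis
  then show thesis using that[of C] Dom_height by auto
qed

lemma rho_cont: "continuous_on {0..H} rho"
  unfolding continuous_on_eq_continuous_within
  by (intro ballI differentiable_imp_continuous_within rho_diff)

lemma rho_pos: "z \<in> {0..H} \<Longrightarrow> 0 < rho z" and c_pos: "z \<in> {0..H} \<Longrightarrow> 0 < c z"
  using rho[of z] rho_m c[of z] c_m by auto

lemma N2_cont: "continuous_on {0..H} (N2 H g rho c)"
proof -
  have "rho z \<noteq> 0" "(c z)\<^sup>2 \<noteq> 0" if "z \<in> {0..H}" for z using rho_pos[OF that] c_pos[OF that] by auto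
  then have "continuous_on {0..H} (\<lambda>z. - (g / rho z) * vector_derivative rho (at z within {0..H}) - g\<^sup>2 / (c z)\<^sup>2)"
    by (intro continuous_on_diff continuous_on_mult continuous_on_minus continuous_on_divide
        continuous_on_power continuous_on_const rho_cont rho_C1 c_cont) auto
  then show ?thesis by (simp add: N2_def cong: continuous_on_cong)
qed

lemma c2_cont: "continuous_on {0..H} (\<lambda>z. (c z)\<^sup>2)"
  by (intro continuous_on_power c_cont)

lemma gc2_cont: "continuous_on {0..H} (\<lambda>z. g / (c z)\<^sup>2)"
  by (intro continuous_on_divide continuous_on_const c2_cont) (use c_pos in force)

lemma rhoc2_cont: "continuous_on {0..H} (\<lambda>z. rho z / (c z)\<^sup>2)"
  by (intro continuous_on_divide rho_cont c2_cont) (use c_pos in force)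

lemma N_cont: "continuous_on {0..H} (\<lambda>z. sqrt (N2 H g rho c z))"
  by (rule continuous_on_real_sqrt[OF N2_cont])

lemma ttrace_add:
  assumes U: "U \<in> Hdiv \<Omega>" "ttrace U k" and V: "V \<in> Hdiv \<Omega>" "ttrace V l"
  shows "ttrace (\<lambda>x. U x + V x) (\<lambda>x. k x + l x)"
proof -
  have kl: "k \<in> L2 UNIV" "l \<in> L2 UNIV" using U V by (auto simp: is_L2_top_trace_def)
  then have s: "(\<lambda>x. k x + l x) \<in> L2 UNIV" by (rule L2_add)
  have "top_functional H (\<lambda>x. k x + l x) \<phi> = green \<Omega> (\<lambda>x. U x + V x) \<phi>"
    if \<phi>: "\<phi> \<in> test_functions {(x, z). zb x < z}" for \<phi>
  proof -
    have "top_functional H (\<lambda>x. k x + l x) \<phi> = top_functional H k \<phi> + top_functional H l \<phi>"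
      unfolding top_functional_def
      using L2_mult_integrable[OF kl(1) test_function_slice_L2[OF \<phi>, of H]]
        L2_mult_integrable[OF kl(2) test_function_slice_L2[OF \<phi>, of H]]
      by (simp add: distrib_right lebesgue_on_UNIV_eq)
    also have "\<dots> = green \<Omega> (\<lambda>x. U x + V x) \<phi>"
      using U(2) V(2) \<phi> by (simp add: is_L2_top_trace_def has_top_trace_def green_add[OF open_Dom U(1) V(1) \<phi>])
    finally show ?thesis .
  qed
  then show ?thesis using s top_functional_in_dual[OF s] by (simp add: is_L2_top_trace_def has_top_trace_def)
qed

lemma ttrace_scale:
  assumes U: "U \<in> Hdiv \<Omega>" "ttrace U k"
  shows "ttrace (\<lambda>x. r *\<^sub>R U x) (\<lambda>x. r * k x)"
proof -
  have k: "k \<in> L2 UNIV" using U by (auto simp: is_L2_top_trace_def)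
  have s: "(\<lambda>x. r * k x) \<in> L2 UNIV" using fun_subspaceD(3)[OF L2_subspace k, of r] by simp
  have "top_functional H (\<lambda>x. r * k x) \<phi> = green \<Omega> (\<lambda>x. r *\<^sub>R U x) \<phi>"
    if \<phi>: "\<phi> \<in> test_functions {(x, z). zb x < z}" for \<phi>
  proof -
    have "top_functional H (\<lambda>x. r * k x) \<phi> = r * top_functional H k \<phi>"
      unfolding top_functional_def by (simp add: mult.assoc)
    also have "\<dots> = green \<Omega> (\<lambda>x. r *\<^sub>R U x) \<phi>"
      using U(2) \<phi> by (simp add: is_L2_top_trace_def has_top_trace_def green_scale[OF open_Dom U(1) \<phi>])
    finally show ?thesis .
  qed
  then show ?thesis using s top_functional_in_dual[OF s] by (simp add: is_L2_top_trace_def has_top_trace_def)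
qed

text \<open>
  The test functions are box approximations in all variables.  Their boxes reach from a height between the
  highest point of the bottom and the surface to a height above the surface, so that their restrictions to \<open>z = H\<close>
  approximate the indicator functions of boxes in the horizontal variables.
\<close>

lemma ttrace_unique:
  assumes k: "ttrace U k" and l: "ttrace U l"
  shows "AE x in lebesgue. k x = l x"
proof -
  have kl: "k \<in> L2 UNIV" "l \<in> L2 UNIV" using k l by (auto simp: is_L2_top_trace_def)
  have d: "(\<lambda>x. k x - l x) \<in> L2 UNIV" by (rule fun_subspace_diff[OF L2_subspace kl])
  have "AE x in lebesgue_on UNIV. k x - l x = 0"
  proof (rule AE_zero_if_orthogonal_to_box_approximations[OF open_UNIV L2_integrable_on_cbox[OF d]])
    fix a b :: "real ^ 'n"
    define lo where "lo = (Hm + H) / 2"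
    define \<phi> where "\<phi> m = box_approx m (a, lo) (b, H + 1)" for m
    have sub: "cbox (a, lo) (b, H + 1) \<subseteq> {(x, z). zb x < z}"
    proof (clarsimp simp: cbox_Pair_eq)
      fix x z assume "lo \<le> z"
      then show "zb x < z" using zb[of x] Hm by (simp add: lo_def)
    qed
    have \<phi>: "\<phi> m \<in> test_functions {(x, z). zb x < z}" for m
      unfolding \<phi>_def by (rule box_approx_test_function[OF sub])
    have slice: "(\<lambda>x. \<phi> m (x, H)) \<in> L2 UNIV" for m by (rule test_function_slice_L2[OF \<phi>])
    have out: "\<phi> m (x, H) = 0" if "x \<notin> cbox a b" for m x
    proof -
      have "(x, H) \<notin> box (a, lo) (b, H + 1)"
        using that box_subset_cbox[of "(a, lo)" "(b, H + 1)"] by (auto simp: cbox_Pair_eq)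
      then show ?thesis by (simp add: \<phi>_def box_approx_def box_bump_zero)
    qed
    have "(\<lambda>x. \<phi> m (x, H)) \<in> borel_measurable lebesgue" for m
      using L2_measurable[OF slice[of m]] by (simp add: lebesgue_on_UNIV_eq)
    moreover have "\<bar>\<phi> m (x, H)\<bar> \<le> 1" for m x unfolding \<phi>_def by (rule box_approx_bounds)
    moreover have "(\<lambda>m. \<phi> m (x, H)) \<longlonglongrightarrow> indicator (box a b) x" for x
    proof -
      have "(x, H) \<in> box (a, lo) (b, H + 1) \<longleftrightarrow> x \<in> box a b"
        using Hm by (auto simp: mem_box Basis_prod_def lo_def inner_prod_def)
      then have "indicator (box (a, lo) (b, H + 1)) (x, H) = (indicator (box a b) x :: real)"
        by (simp add: indicator_def)
      then show ?thesis
        unfolding \<phi>_def using box_approx_tendsto_indicator[of "(a, lo)" "(b, H + 1)" "(x, H)"] by simp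
    qed
    moreover have "(LINT x|lebesgue. (indicator (cbox a b) x * (k x - l x)) * \<phi> m (x, H)) = 0" for m
    proof -
      have "(indicator (cbox a b) x * (k x - l x)) * \<phi> m (x, H) = k x * \<phi> m (x, H) - l x * \<phi> m (x, H)" for x
        using out[of x m] by (cases "x \<in> cbox a b") (auto simp: algebra_simps)
      then have "(LINT x|lebesgue. (indicator (cbox a b) x * (k x - l x)) * \<phi> m (x, H)) =
          top_functional H k (\<phi> m) - top_functional H l (\<phi> m)"
        unfolding top_functional_def
        using L2_mult_integrable[OF kl(1) slice[of m]] L2_mult_integrable[OF kl(2) slice[of m]]
        by (simp add: lebesgue_on_UNIV_eq)
      also have "\<dots> = 0" using k l \<phi>[of m] by (simp add: is_L2_top_trace_def has_top_trace_def)
      finally show ?thesis .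
    qed
    ultimately show "\<exists>\<psi>. (\<forall>m::nat. \<psi> m \<in> borel_measurable lebesgue) \<and>
        (\<forall>m x. \<bar>\<psi> m x\<bar> \<le> 1) \<and> (\<forall>x. (\<lambda>m. \<psi> m x) \<longlonglongrightarrow> indicator (box a b) x) \<and>
        (\<forall>m. (LINT x|lebesgue. (indicator (cbox a b) x * (k x - l x)) * \<psi> m x) = 0)"
      by (intro exI[of _ "\<lambda>m x. \<phi> m (x, H)"]) auto
  qed auto
  then show ?thesis unfolding lebesgue_on_UNIV_eq by eventually_elim simp
qed

lemma dom_GtD:
  assumes "U \<in> DGt"
  shows "U \<in> Hdiv \<Omega>" "U \<in> L2 \<Omega>" "ttrace U (L2_top_trace H zb U)" "L2_top_trace H zb U \<in> L2 UNIV"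
proof -
  show "U \<in> Hdiv \<Omega>" using assms by (simp add: dom_Gt_def)
  then show "U \<in> L2 \<Omega>" by (rule Hdiv_L2)
  show "ttrace U (L2_top_trace H zb U)"
    using assms someI_ex[of "ttrace U"] by (simp add: dom_Gt_def L2_top_trace_def)
  then show "L2_top_trace H zb U \<in> L2 UNIV" by (simp add: is_L2_top_trace_def)
qed

lemma dom_Gt_subspace: "fun_subspace (DGt)"
  unfolding fun_subspace_def
proof (intro conjI ballI allI)
  note HS = Hdiv_subspace[OF Dom_measurable]
  have sc: "(\<lambda>x. r *\<^sub>R u x) \<in> DGt" if "u \<in> Hdiv \<Omega>" "ttrace u k" for u k r
    using ttrace_scale[OF that, of r] fun_subspaceD(3)[OF HS that(1), of r] by (auto simp: dom_Gt_def)
  show "(\<lambda>x. r *\<^sub>R u x) \<in> DGt" if "u \<in> DGt" for u r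
    by (rule sc[OF dom_GtD(1,3)[OF that]])
  show "(\<lambda>x. u x + v x) \<in> DGt" if "u \<in> DGt" "v \<in> DGt" for u v
    using ttrace_add[OF dom_GtD(1,3)[OF that(1)] dom_GtD(1,3)[OF that(2)]]
      fun_subspaceD(2)[OF HS dom_GtD(1)[OF that(1)] dom_GtD(1)[OF that(2)]] by (auto simp: dom_Gt_def)
  have z: "(\<lambda>x. 0) \<in> Hdiv \<Omega>" by (rule fun_subspaceD(1)[OF HS])
  have z2: "(\<lambda>x. 0::real) \<in> L2 (UNIV :: (real ^ 'n) set)" by (rule fun_subspaceD(1)[OF L2_subspace])
  have "green \<Omega> (\<lambda>x. 0) \<phi> = 0" if "\<phi> \<in> test_functions T" for \<phi> T
    using green_scale[OF open_Dom z that, of 0] by simp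
  then have "ttrace (\<lambda>x. 0) (\<lambda>x. 0)"
    using top_functional_in_dual[OF z2, of H] z2 by (auto simp: is_L2_top_trace_def has_top_trace_def top_functional_def)
  then show "(\<lambda>x. 0) \<in> DGt" using z by (auto simp: dom_Gt_def)
qed

lemma L2_top_trace_add:
  assumes "U \<in> DGt" "V \<in> DGt"
  shows "AE x in lebesgue. L2_top_trace H zb (\<lambda>x. U x + V x) x = L2_top_trace H zb U x + L2_top_trace H zb V x"
  by (rule ttrace_unique[OF dom_GtD(3)[OF fun_subspaceD(2)[OF dom_Gt_subspace assms]]
        ttrace_add[OF dom_GtD(1,3)[OF assms(1)] dom_GtD(1,3)[OF assms(2)]]])

lemma L2_top_trace_scale:
  assumes "U \<in> DGt"
  shows "AE x in lebesgue. L2_top_trace H zb (\<lambda>x. r *\<^sub>R U x) x = r * L2_top_trace H zb U x"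
  by (rule ttrace_unique[OF dom_GtD(3)[OF fun_subspaceD(3)[OF dom_Gt_subspace assms]]
        ttrace_scale[OF dom_GtD(1,3)[OF assms(1)]]])

lemma bform_psd: "psd_form (L2 \<Omega>) bform"
  unfolding inner_H_def
  by (rule psd_form_L2[OF coefficient_measurable[OF rho_cont], of rho_p])
     (use rho rho_pos Dom_height in \<open>meson less_imp_le\<close>)

lemma bform_psd_Gt: "psd_form (DGt) bform"
  by (rule psd_form_subset[OF bform_psd dom_Gt_subspace]) (use dom_GtD(2) in blast)

lemma bform_definite:
  assumes u: "u \<in> L2 \<Omega>" and "bform u u = 0" shows "AE p in lebesgue_on \<Omega>. u p = 0"
proof -
  have "integrable (lebesgue_on \<Omega>) (\<lambda>p. rho (snd p) * (u p \<bullet> u p))"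
    by (rule L2_weighted_integrable[OF u u coefficient_measurable[OF rho_cont], of rho_p])
       (use rho rho_pos Dom_height in \<open>force simp: abs_of_pos\<close>)
  moreover have "AE p in lebesgue_on \<Omega>. 0 \<le> rho (snd p) * (u p \<bullet> u p)"
    by (rule AE_I2) (use rho_pos Dom_height in \<open>force intro!: mult_nonneg_nonneg\<close>)
  ultimately have "AE p in lebesgue_on \<Omega>. rho (snd p) * (u p \<bullet> u p) = 0"
    using assms(2) integral_nonneg_eq_0_iff_AE unfolding inner_H_def by blast
  then show ?thesis using AE_space
  proof eventually_elim
    case (elim p)
    then have "rho (snd p) \<noteq> 0" using rho_pos[OF Dom_height[of p]] by auto
    then show ?case using elim by simp
  qed
qed

text \<open>
  The form is a sum of three weighted \<open>L\<^sup>2\<close> products of components that depend linearly on the field up to null sets.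
\<close>

lemma aform_psd: "psd_form (DGt) aform"
proof -
  let ?D = DGt
  let ?\<phi> = "\<lambda>U p. (c (snd p))\<^sup>2 *\<^sub>R (weak_div \<Omega> U p - (g / (c (snd p))\<^sup>2) *\<^sub>R snd (U p))"
  let ?\<psi> = "\<lambda>U p. sqrt (N2 H g rho c (snd p)) *\<^sub>R snd (U p)"
  let ?\<gamma> = "\<lambda>U x. - g * L2_top_trace H zb U x"
  have 1: "psd_form ?D (\<lambda>u v. LINT p|lebesgue_on \<Omega>. (rho (snd p) / (c (snd p))\<^sup>2) * (?\<phi> u p \<bullet> ?\<phi> v p))"
  proof -
    obtain C where C: "\<And>p. p \<in> \<Omega> \<Longrightarrow> \<bar>rho (snd p) / (c (snd p))\<^sup>2\<bar> \<le> C"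
      using coefficient_bounded[OF rhoc2_cont] by blast
    show ?thesis
    proof (rule psd_form_weighted_pullback[OF dom_Gt_subspace _ _ _ coefficient_measurable[OF rhoc2_cont], where C = C])
      fix u assume u: "u \<in> ?D"
      obtain C1 where C1: "\<And>p. p \<in> \<Omega> \<Longrightarrow> \<bar>(c (snd p))\<^sup>2\<bar> \<le> C1" using coefficient_bounded[OF c2_cont] by blast
      obtain C2 where C2: "\<And>p. p \<in> \<Omega> \<Longrightarrow> \<bar>g / (c (snd p))\<^sup>2\<bar> \<le> C2" using coefficient_bounded[OF gc2_cont] by blast
      show "?\<phi> u \<in> L2 \<Omega>"
        by (rule L2_bounded_mult[OF fun_subspace_diff[OF L2_subspace weak_div_L2[OF dom_GtD(1)[OF u]]
              L2_bounded_mult[OF L2_snd[OF dom_GtD(2)[OF u]] coefficient_measurable[OF gc2_cont] C2]]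
              coefficient_measurable[OF c2_cont] C1])
      fix r
      show "AE p in lebesgue_on \<Omega>. ?\<phi> (\<lambda>x. r *\<^sub>R u x) p = r *\<^sub>R ?\<phi> u p"
        using weak_div_scale[OF open_Dom dom_GtD(1)[OF u], of r] by eventually_elim (simp add: algebra_simps)
    next
      fix u v assume u: "u \<in> ?D" and v: "v \<in> ?D"
      show "AE p in lebesgue_on \<Omega>. ?\<phi> (\<lambda>x. u x + v x) p = ?\<phi> u p + ?\<phi> v p"
        using weak_div_add[OF open_Dom dom_GtD(1)[OF u] dom_GtD(1)[OF v]]
        by eventually_elim (simp only: snd_add scaleR_add_right add_diff_add)
    next
      fix p assume "p \<in> \<Omega>"
      then show "0 \<le> rho (snd p) / (c (snd p))\<^sup>2 \<and> rho (snd p) / (c (snd p))\<^sup>2 \<le> C"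
        using C[of p] rho_pos[OF Dom_height[of p]] by auto
    qed
  qed
  have 2: "psd_form ?D (\<lambda>u v. LINT p|lebesgue_on \<Omega>. rho (snd p) * (?\<psi> u p \<bullet> ?\<psi> v p))"
  proof (rule psd_form_weighted_pullback[OF dom_Gt_subspace _ _ _ coefficient_measurable[OF rho_cont], where C = rho_p])
    fix u assume u: "u \<in> ?D"
    obtain C1 where C1: "\<And>p. p \<in> \<Omega> \<Longrightarrow> \<bar>sqrt (N2 H g rho c (snd p))\<bar> \<le> C1" using coefficient_bounded[OF N_cont] by blast
    show "?\<psi> u \<in> L2 \<Omega>"
      by (rule L2_bounded_mult[OF L2_snd[OF dom_GtD(2)[OF u]] coefficient_measurable[OF N_cont] C1])
  next
    fix p assume "p \<in> \<Omega>"
    then show "0 \<le> rho (snd p) \<and> rho (snd p) \<le> rho_p" using rho[OF Dom_height, of p] rho_pos[OF Dom_height, of p] by auto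
  qed (auto simp: algebra_simps)
  have 3: "psd_form ?D (\<lambda>u v. LINT x|lebesgue_on UNIV. (rho H / g) * (?\<gamma> u x \<bullet> ?\<gamma> v x))"
  proof (rule psd_form_weighted_pullback[OF dom_Gt_subspace, where C = "rho H / g"])
    fix u assume u: "u \<in> ?D"
    show "?\<gamma> u \<in> L2 UNIV" using fun_subspaceD(3)[OF L2_subspace dom_GtD(4)[OF u], of "- g"] by simp
    fix r
    show "AE x in lebesgue_on UNIV. ?\<gamma> (\<lambda>x. r *\<^sub>R u x) x = r *\<^sub>R ?\<gamma> u x"
      unfolding lebesgue_on_UNIV_eq using L2_top_trace_scale[OF u, of r] by eventually_elim simp
  next
    fix u v assume u: "u \<in> ?D" and v: "v \<in> ?D"
    show "AE x in lebesgue_on UNIV. ?\<gamma> (\<lambda>x. u x + v x) x = ?\<gamma> u x + ?\<gamma> v x"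
      unfolding lebesgue_on_UNIV_eq using L2_top_trace_add[OF u v] by eventually_elim (simp add: algebra_simps)
  next
    show "0 \<le> rho H / g \<and> rho H / g \<le> rho H / g" using rho_pos[of H] g H by simp
  qed simp
  show ?thesis
    using psd_form_add[OF psd_form_add[OF 1 2] 3]
    by (simp only: inner_G_def Gt_def case_prod_conv lebesgue_on_UNIV_eq mult.assoc inner_real_def real_scaleR_def)
qed

lemma graph_psd: "psd_form (DGt) (\<lambda>u v. bform u v + aform u v)"
  by (rule psd_form_add[OF bform_psd_Gt aform_psd])

lemma dom_GD: "U \<in> DG \<Longrightarrow> U \<in> DGt" by (simp add: dom_G_def)

lemma bottom_trace_lincomb:
  assumes U: "U \<in> Hdiv \<Omega>" "has_bottom_trace H zb U l" and V: "V \<in> Hdiv \<Omega>" "has_bottom_trace H zb V m"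
    and zero: "\<And>u. l u + r * m u = 0"
  shows "has_bottom_trace H zb (\<lambda>x. U x + r *\<^sub>R V x) (\<lambda>u. 0)"
  unfolding has_bottom_trace_def
proof (intro conjI ballI zero_in_dual_space)
  fix \<phi> :: "'n pt \<Rightarrow> real" assume \<phi>: "\<phi> \<in> test_functions {(x, z). z < H}"
  have "green \<Omega> (\<lambda>x. U x + r *\<^sub>R V x) \<phi> = green \<Omega> U \<phi> + r * green \<Omega> V \<phi>"
    by (simp only: green_add[OF open_Dom U(1) fun_subspaceD(3)[OF Hdiv_subspace[OF Dom_measurable] V(1)] \<phi>]
        green_scale[OF open_Dom V(1) \<phi>])
  also have "\<dots> = l \<phi> + r * m \<phi>" using U(2) V(2) \<phi> by (simp add: has_bottom_trace_def)
  finally show "0 = green \<Omega> (\<lambda>x. U x + r *\<^sub>R V x) \<phi>" using zero[of \<phi>] by simp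
qed

lemma dom_G_subspace: "fun_subspace (DG)"
proof -
  note S = dom_Gt_subspace
  have tr: "has_bottom_trace H zb U (\<lambda>u. 0)" "U \<in> Hdiv \<Omega>" if "U \<in> DG" for U
    using that dom_GtD(1) by (auto simp: dom_G_def)
  have z: "has_bottom_trace H zb (\<lambda>x. 0) (\<lambda>u. 0)"
  proof -
    have z0: "(\<lambda>x. 0) \<in> Hdiv \<Omega>" by (rule dom_GtD(1)[OF fun_subspaceD(1)[OF S]])
    have "green \<Omega> (\<lambda>x. 0) \<phi> = 0" if "\<phi> \<in> test_functions T" for \<phi> T
      using green_scale[OF open_Dom z0 that, of 0] by simp
    then show ?thesis by (auto simp: has_bottom_trace_def zero_in_dual_space)
  qed
  have z0: "(\<lambda>x. 0) \<in> DG" using z fun_subspaceD(1)[OF S] by (simp add: dom_G_def)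
  show ?thesis
    unfolding fun_subspace_def
  proof (intro conjI ballI allI z0)
    show "(\<lambda>x. u x + v x) \<in> DG" if "u \<in> DG" "v \<in> DG" for u v
      using bottom_trace_lincomb[OF tr(2,1)[OF that(1)] tr(2,1)[OF that(2)], of 1]
        fun_subspaceD(2)[OF S dom_GD[OF that(1)] dom_GD[OF that(2)]] by (simp add: dom_G_def)
    show "(\<lambda>x. r *\<^sub>R u x) \<in> DG" if "u \<in> DG" for u r
      using bottom_trace_lincomb[OF tr(2,1)[OF z0] tr(2,1)[OF that], of r]
        fun_subspaceD(3)[OF S dom_GD[OF that]] by (simp add: dom_G_def)
  qed
qed

text \<open>
  Two fields with the same bottom trace differ by an element of \<open>\<D>(G)\<close>, which is what makes their difference an admissible test vector.
\<close>

lemma bottom_trace_diff_in_dom_G: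
  assumes U: "U \<in> DGt" "has_bottom_trace H zb U l" and V: "V \<in> DGt" "has_bottom_trace H zb V l"
  shows "(\<lambda>x. U x - V x) \<in> DG"
  using bottom_trace_lincomb[OF dom_GtD(1)[OF U(1)] U(2) dom_GtD(1)[OF V(1)] V(2), of "-1"]
    fun_subspace_diff[OF dom_Gt_subspace U(1) V(1)] by (simp add: dom_G_def)

end

section \<open>Uniqueness of the solution\<close>

context stratified_fluid
begin

text \<open>
  For fixed \<open>W\<close>, put \<open>f = b(U,W)\<close>, \<open>v = b(V,W)\<close> and \<open>h = a(U,W)\<close>.  Then \<open>f' = v\<close> and \<open>v' = - h\<close> in the sense of
  distributions, the latter because \<open>\<phi>'\<close> is a test function along with \<open>\<phi>\<close>.  By du Bois-Reymond, \<open>f\<close> and \<open>v\<close> are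
  primitives up to constants, and the initial conditions, read off from the continuous representatives of \<open>U\<close> in \<open>\<H>\<close>
  and of \<open>V\<close> in the dual of \<open>\<D>(G)\<close>, make both constants zero.
\<close>

lemma solution_integral_identity:
  assumes T: "T > 0" and sol: "is_solution H g T zb rho c ub U"
  obtains C where "\<And>t. t \<in> {0..T} \<Longrightarrow> C t \<in> L2 \<Omega>"
    "\<And>t. t \<in> {0..T} \<Longrightarrow> ((\<lambda>s. norm_H H zb rho (\<lambda>a. C s a - C t a)) \<longlongrightarrow> 0) (at t within {0..T})"
    "AE t in lebesgue_on {0<..<T}. norm_H H zb rho (\<lambda>a. U t a - C t a) = 0"
    "\<And>W. W \<in> DG \<Longrightarrow> integrable (lebesgue_on {0<..<T}) (\<lambda>r. aform (U r) W)"
    "\<And>W s. W \<in> DG \<Longrightarrow> s \<in> {0..T} \<Longrightarrow> bform (C s) W = - prim T (prim T (\<lambda>r. aform (U r) W)) s"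
proof -
  let ?M = "lebesgue_on {0<..<T}"
  let ?p = "graph_norm H g zb rho c"
  interpret b: psd_form "L2 \<Omega>" bform by (rule bform_psd)
  interpret a: psd_form "DGt" aform by (rule aform_psd)
  interpret E: psd_form "DGt" "\<lambda>u v. bform u v + aform u v" by (rule graph_psd)
  interpret E0: psd_form "DG" "\<lambda>u v. bform u v + aform u v"
    by (rule psd_form_subset[OF graph_psd dom_G_subspace]) (use dom_GD in blast)
  have bn: "norm_H H zb rho = b.nrm" by (rule ext) (simp add: norm_H_def b.nrm_def)
  have En: "?p = E.nrm" "?p = E0.nrm" by (rule ext, simp add: graph_norm_def E.nrm_def E0.nrm_def)+
  have UL2: "U \<in> L2_time (DGt) E.nrm T" using sol unfolding is_solution_def En(1) by blast
  then have Usm: "strongly_measurable (DGt) E.nrm T U" by (simp add: L2_time_def)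
  then have UD: "AE t in ?M. U t \<in> DGt" by (simp add: strongly_measurable_def)
  obtain V where V: "V \<in> L2_time (L2 \<Omega>) b.nrm T" "weak_time_deriv (L2 \<Omega>) b.nrm T U V"
    "zero_at_time_0 (dual_space (DG) E0.nrm) (dual_norm (DG) E0.nrm) T (\<lambda>t W. bform (V t) W)"
    using sol unfolding is_solution_def bn En(2) by blast
  have Vsm: "strongly_measurable (L2 \<Omega>) b.nrm T V" using V(1) by (simp add: L2_time_def)
  then have VD: "AE t in ?M. V t \<in> L2 \<Omega>" by (simp add: strongly_measurable_def)
  obtain C where C: "\<And>t. t \<in> {0..T} \<Longrightarrow> C t \<in> L2 \<Omega>"
    "\<And>t. t \<in> {0..T} \<Longrightarrow> ((\<lambda>s. b.nrm (\<lambda>a. C s a - C t a)) \<longlongrightarrow> 0) (at t within {0..T})"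
    "AE t in ?M. b.nrm (\<lambda>a. U t a - C t a) = 0" "b.nrm (C 0) = 0"
    using sol unfolding is_solution_def zero_at_time_0_def bn by blast
  obtain D where D: "\<And>t. t \<in> {0..T} \<Longrightarrow> D t \<in> dual_space (DG) E0.nrm"
    "\<And>t. t \<in> {0..T} \<Longrightarrow> ((\<lambda>s. dual_norm (DG) E0.nrm (\<lambda>a. D s a - D t a)) \<longlongrightarrow> 0) (at t within {0..T})"
    "AE t in ?M. dual_norm (DG) E0.nrm (\<lambda>W. bform (V t) W - D t W) = 0"
    "dual_norm (DG) E0.nrm (D 0) = 0"
    using V(3) unfolding zero_at_time_0_def by blast
  have eqn: "(LINT t|?M. bform (U t) W * deriv (deriv \<phi>) t) + (LINT t|?M. aform (U t) W * \<phi> t) = 0"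
    if "W \<in> DG" "\<phi> \<in> test_functions {0<..<T}" for W \<phi>
    using sol that unfolding is_solution_def by blast
  have T0: "0 \<in> {0..T}" using T by simp
  \<comment> \<open>The initial condition for \<open>V\<close> compares functionals, so differences of functionals have to be estimated.\<close>
  have ddiff: "(\<lambda>u. l u - m u) \<in> dual_space (DG) E0.nrm"
    if l: "l \<in> dual_space (DG) E0.nrm" and m: "m \<in> dual_space (DG) E0.nrm" for l m
  proof -
    obtain K where K: "\<And>u. u \<in> DG \<Longrightarrow> \<bar>l u\<bar> \<le> K * E0.nrm u"
      using dual_space_bound[OF l E0.nrm_nonneg] by blast
    obtain L where L: "\<And>u. u \<in> DG \<Longrightarrow> \<bar>m u\<bar> \<le> L * E0.nrm u"
      using dual_space_bound[OF m E0.nrm_nonneg] by blast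
    have "\<bar>l u - m u\<bar> \<le> (K + L) * E0.nrm u" if "u \<in> DG" for u
      using K[OF that] L[OF that] unfolding distrib_right by linarith
    then show ?thesis
      unfolding dual_space_def mem_Collect_eq
      by (intro conjI ballI allI exI[of _ "K + L"])
         (simp_all add: dual_spaceD[OF l] dual_spaceD[OF m] algebra_simps)
  qed
  have main: "integrable ?M (\<lambda>r. aform (U r) W)"
    "s \<in> {0..T} \<Longrightarrow> bform (C s) W = - prim T (prim T (\<lambda>r. aform (U r) W)) s" if W: "W \<in> DG" for W s
  proof -
    note WG = dom_GD[OF W] and W2 = dom_GtD(2)[OF dom_GD[OF W]]
    have lb: "(\<lambda>u. bform u W) \<in> dual_space (DGt) E.nrm"
      by (rule E.dominated_form_in_dual[OF bform_psd_Gt _ WG]) (simp add: a.form_nonneg)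
    have la: "(\<lambda>u. aform u W) \<in> dual_space (DGt) E.nrm"
      by (rule E.dominated_form_in_dual[OF aform_psd _ WG]) (simp add: b.form_nonneg dom_GtD(2))
    have lV: "(\<lambda>u. bform u W) \<in> dual_space (L2 \<Omega>) b.nrm" by (rule b.form_in_dual[OF W2])
    define f where "f t = bform (U t) W" for t
    define h where "h t = aform (U t) W" for t
    define v where "v t = bform (V t) W" for t
    have f: "integrable ?M f" unfolding f_def by (rule E.dual_integrable[OF lb UL2])
    have h: "integrable ?M h" unfolding h_def by (rule E.dual_integrable[OF la UL2])
    have v: "integrable ?M v" unfolding v_def by (rule b.dual_integrable[OF lV V(1)])
    then show "integrable ?M (\<lambda>r. aform (U r) W)" using h by (simp add: h_def[abs_def])
    have weak1: "(LINT t|?M. f t * deriv \<phi> t) = - (LINT t|?M. v t * \<phi> t)" if "\<phi> \<in> test_functions {0<..<T}" for \<phi>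
      unfolding f_def v_def
    proof (rule dual_weak_time_deriv[OF lV b.subspace b.nrm_nonneg b.nrm_zero V(2) _ VD _ _ that])
      show "AE t in ?M. U t \<in> L2 \<Omega>" using UD by eventually_elim (rule dom_GtD(2))
      show "(\<lambda>t. bform (U t) W) \<in> borel_measurable ?M" using f by (auto simp: f_def[abs_def])
      show "(\<lambda>t. bform (V t) W) \<in> borel_measurable ?M" using v by (auto simp: v_def[abs_def])
    qed
    have weak2: "(LINT t|?M. v t * deriv \<phi> t) = - (LINT t|?M. - h t * \<phi> t)" if "\<phi> \<in> test_functions {0<..<T}" for \<phi>
      using weak1[OF deriv_test_function[OF that]] eqn[OF W that] by (simp add: f_def h_def)
    obtain Cf where Cf: "AE t in ?M. f t = Cf + prim T v t"
      using weak_derivative_imp_primitive[OF T f v weak1] by blast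
    have hm: "integrable ?M (\<lambda>t. - h t)" using h by simp
    obtain Cv where "AE t in ?M. v t = Cv + prim T (\<lambda>t. - h t) t"
      using weak_derivative_imp_primitive[OF T v hm weak2] by blast
    then have Cv: "AE t in ?M. v t = Cv - prim T h t" by (simp add: prim_uminus)
    have pc: "continuous_on {0..T} (prim T k)" if "integrable ?M k" for k
      by (rule continuous_on_subset[OF prim_continuous[OF that]]) simp
    have fc: "continuous_on {0..T} (\<lambda>t. bform (C t) W)"
      by (rule b.continuous_dual[OF lV C(1,2)])
    have AEC: "AE t in ?M. bform (C t) W = Cf + prim T v t"
      using Cf C(3) UD AE_space
    proof eventually_elim
      case (elim t)
      then have "C t \<in> L2 \<Omega>" using C(1)[of t] by simp
      then show ?case using b.form_null_diff[OF dom_GtD(2)[OF elim(3)] _ W2 elim(2)] elim(1) by (simp add: f_def)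
    qed
    have Ceq: "bform (C t) W = Cf + prim T v t" if "t \<in> {0..T}" for t
      by (rule continuous_AE_eq_imp_eq[OF T fc _ AEC that]) (intro continuous_on_add continuous_on_const pc[OF v])
    have "bform (C 0) W = 0"
      using b.Cauchy_Schwarz[OF C(1)[OF T0] W2] C(4) by simp
    then have "Cf = 0" using Ceq[OF T0] by (simp add: prim_0)
    have vc: "continuous_on {0..T} (\<lambda>t. D t W)"
      unfolding continuous_on_def
    proof
      fix t assume t: "t \<in> {0..T}"
      have lim: "((\<lambda>s. dual_norm (DG) E0.nrm (\<lambda>a. D s a - D t a) * E0.nrm W) \<longlongrightarrow> 0) (at t within {0..T})"
        using tendsto_mult_right[OF D(2)[OF t], of "E0.nrm W"] by simp
      have "((\<lambda>s. D s W - D t W) \<longlongrightarrow> 0) (at t within {0..T})"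
      proof (rule Lim_null_comparison[OF _ lim])
        show "\<forall>\<^sub>F s in at t within {0..T}. norm (D s W - D t W) \<le>
            dual_norm (DG) E0.nrm (\<lambda>a. D s a - D t a) * E0.nrm W"
          unfolding eventually_at_filter
        proof (intro always_eventually allI impI)
          fix s assume s: "s \<in> {0..T}"
          show "norm (D s W - D t W) \<le> dual_norm (DG) E0.nrm (\<lambda>a. D s a - D t a) * E0.nrm W"
            using E0.dual_norm_bound[OF ddiff[OF D(1)[OF s] D(1)[OF t]] W] by simp
        qed
      qed
      then show "((\<lambda>t. D t W) \<longlongrightarrow> D t W) (at t within {0..T})" by (rule LIM_zero_cancel)
    qed
    have AED: "AE t in ?M. D t W = Cv - prim T h t"
      using Cv D(3) VD AE_space
    proof eventually_elim
      case (elim t)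
      then have t: "t \<in> {0..T}" by simp
      note Vt = elim(3)
      have G2: "u \<in> L2 \<Omega>" if "u \<in> DG" for u by (rule dom_GtD(2)[OF dom_GD[OF that]])
      have flip: "bform (V t) u = bform u (V t)" if "u \<in> L2 \<Omega>" for u by (rule b.form_sym[OF Vt that])
      have "\<bar>bform (V t) u\<bar> \<le> b.nrm (V t) * E0.nrm u" if u: "u \<in> DG" for u
      proof -
        have "\<bar>bform (V t) u\<bar> \<le> b.nrm (V t) * b.nrm u" by (rule b.Cauchy_Schwarz[OF Vt G2[OF u]])
        also have "\<dots> \<le> b.nrm (V t) * E0.nrm u"
          by (rule mult_left_mono[OF _ b.nrm_nonneg[OF Vt]])
             (simp add: b.nrm_def E0.nrm_def a.form_nonneg[OF dom_GD[OF u]])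
        finally show ?thesis .
      qed
      moreover have "bform (V t) (\<lambda>x. u x + w x) = bform (V t) u + bform (V t) w"
        if "u \<in> DG" "w \<in> DG" for u w
        by (simp only: flip[OF L2_add[OF G2[OF that(1)] G2[OF that(2)]]] flip[OF G2[OF that(1)]] flip[OF G2[OF that(2)]]
            b.form_add[OF G2[OF that(1)] G2[OF that(2)] Vt])
      moreover have "bform (V t) (\<lambda>x. r *\<^sub>R u x) = r * bform (V t) u" if "u \<in> DG" for u r
        by (simp only: flip[OF fun_subspaceD(3)[OF L2_subspace G2[OF that]]] flip[OF G2[OF that]] b.form_scale[OF G2[OF that] Vt])
      ultimately have "(\<lambda>u. bform (V t) u) \<in> dual_space (DG) E0.nrm"
        unfolding dual_space_def mem_Collect_eq by (intro conjI ballI allI exI[of _ "b.nrm (V t)"])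
      from E0.dual_norm_bound[OF ddiff[OF this D(1)[OF t]] W]
      have "\<bar>bform (V t) W - D t W\<bar> \<le> 0" unfolding elim(2) by simp
      then show ?case using elim(1) by (simp add: v_def)
    qed
    have Deq: "D t W = Cv - prim T h t" if "t \<in> {0..T}" for t
      by (rule continuous_AE_eq_imp_eq[OF T vc _ AED that]) (intro continuous_on_diff continuous_on_const pc[OF h])
    have "D 0 W = 0" using E0.dual_norm_bound[OF D(1)[OF T0] W] D(4) by simp
    then have "Cv = 0" using Deq[OF T0] by (simp add: prim_0)
    then have vh: "AE t in ?M. v t = - prim T h t" using Cv by simp
    have "integrable ?M (\<lambda>t. - prim T h t)" using continuous_integrable_time[OF pc[OF h]] by simp
    then have "prim T v s = prim T (\<lambda>t. - prim T h t) s" for s by (rule prim_cong_AE[OF v _ vh])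
    then show "bform (C s) W = - prim T (prim T (\<lambda>r. aform (U r) W)) s" if "s \<in> {0..T}"
      using Ceq[OF that] \<open>Cf = 0\<close> by (simp add: prim_uminus h_def[abs_def])
  qed
  show thesis by (rule that[OF C(1) _ _ main]) (use C(2,3) bn in simp_all)
qed

end


context stratified_fluid
begin

text \<open>
  The kernels \<open>B\<close> and \<open>A\<close> are built from two versions of the difference of the solutions: the version continuous in
  \<open>L\<^sup>2\<close>, which makes \<open>B\<close> continuous up to the diagonal, and a version with values in \<open>\<D>(G)\<close> at all times that is a
  pointwise limit of step functions, which makes \<open>A\<close> measurable.
\<close>

lemma solution_unique:
  assumes T: "T > 0" and sol1: "is_solution H g T zb rho c ub U1" and sol2: "is_solution H g T zb rho c ub U2"
  shows "AE t in lebesgue_on {0<..<T}. AE p in lebesgue_on \<Omega>. U1 t p = U2 t p"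
proof -
  let ?M = "lebesgue_on {0<..<T}"
  interpret b: psd_form "L2 \<Omega>" bform by (rule bform_psd)
  interpret a: psd_form "DGt" aform by (rule aform_psd)
  interpret E: psd_form "DGt" "\<lambda>u v. bform u v + aform u v" by (rule graph_psd)
  interpret finite_measure ?M by (rule finite_measure_time)
  have bn: "norm_H H zb rho = b.nrm" by (rule ext) (simp add: norm_H_def b.nrm_def)
  have En: "graph_norm H g zb rho c = E.nrm" by (rule ext) (simp add: graph_norm_def E.nrm_def)
  have an: "a.nrm u \<le> E.nrm u" if "u \<in> DGt" for u
    by (simp add: a.nrm_def E.nrm_def b.form_nonneg[OF dom_GtD(2)[OF that]])
  obtain C1 where C1: "\<And>t. t \<in> {0..T} \<Longrightarrow> C1 t \<in> L2 \<Omega>"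
    "\<And>t. t \<in> {0..T} \<Longrightarrow> ((\<lambda>s. b.nrm (\<lambda>a. C1 s a - C1 t a)) \<longlongrightarrow> 0) (at t within {0..T})"
    "AE t in ?M. b.nrm (\<lambda>a. U1 t a - C1 t a) = 0"
    "\<And>W. W \<in> DG \<Longrightarrow> integrable ?M (\<lambda>r. aform (U1 r) W)"
    "\<And>W s. W \<in> DG \<Longrightarrow> s \<in> {0..T} \<Longrightarrow> bform (C1 s) W = - prim T (prim T (\<lambda>r. aform (U1 r) W)) s"
    by (rule solution_integral_identity[OF T sol1, unfolded bn], rule that, assumption+)
  obtain C2 where C2: "\<And>t. t \<in> {0..T} \<Longrightarrow> C2 t \<in> L2 \<Omega>"
    "\<And>t. t \<in> {0..T} \<Longrightarrow> ((\<lambda>s. b.nrm (\<lambda>a. C2 s a - C2 t a)) \<longlongrightarrow> 0) (at t within {0..T})"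
    "AE t in ?M. b.nrm (\<lambda>a. U2 t a - C2 t a) = 0"
    "\<And>W. W \<in> DG \<Longrightarrow> integrable ?M (\<lambda>r. aform (U2 r) W)"
    "\<And>W s. W \<in> DG \<Longrightarrow> s \<in> {0..T} \<Longrightarrow> bform (C2 s) W = - prim T (prim T (\<lambda>r. aform (U2 r) W)) s"
    by (rule solution_integral_identity[OF T sol2, unfolded bn], rule that, assumption+)
  have U1L: "U1 \<in> L2_time (DGt) E.nrm T" and U2L: "U2 \<in> L2_time (DGt) E.nrm T"
    using sol1 sol2 unfolding is_solution_def En by blast+
  then have sm: "strongly_measurable (DGt) E.nrm T U1" "strongly_measurable (DGt) E.nrm T U2"
    by (simp_all add: L2_time_def)
  then have dom: "AE t in ?M. U1 t \<in> DGt" "AE t in ?M. U2 t \<in> DGt"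
    by (simp_all add: strongly_measurable_def)
  have trace: "AE t in ?M. has_bottom_trace H zb (U1 t) (ub t)" "AE t in ?M. has_bottom_trace H zb (U2 t) (ub t)"
    using sol1 sol2 unfolding is_solution_def by blast+
  define C where "C t = (\<lambda>x. C1 t x - C2 t x)" for t
  define D where "D t = (\<lambda>x. U1 t x - U2 t x)" for t
  have CL: "C t \<in> L2 \<Omega>" if "t \<in> {0..T}" for t
    unfolding C_def by (rule fun_subspace_diff[OF L2_subspace C1(1)[OF that] C2(1)[OF that]])
  have Ccont: "((\<lambda>s. b.nrm (\<lambda>a. C s a - C t a)) \<longlongrightarrow> 0) (at t within {0..T})" if t: "t \<in> {0..T}" for t
  proof (rule tendsto_sandwich[OF _ _ tendsto_const])
    let ?e = "\<lambda>s. b.nrm (\<lambda>a. C1 s a - C1 t a) + b.nrm (\<lambda>a. C2 s a - C2 t a)"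
    show "(?e \<longlongrightarrow> 0) (at t within {0..T})" using tendsto_add[OF C1(2)[OF t] C2(2)[OF t]] by simp
    show "\<forall>\<^sub>F s in at t within {0..T}. 0 \<le> b.nrm (\<lambda>a. C s a - C t a)"
      unfolding eventually_at_filter
      by (intro always_eventually allI impI b.nrm_nonneg fun_subspace_diff[OF L2_subspace CL CL[OF t]])
    show "\<forall>\<^sub>F s in at t within {0..T}. b.nrm (\<lambda>a. C s a - C t a) \<le> ?e s"
      unfolding eventually_at_filter
    proof (intro always_eventually allI impI)
      fix s assume s: "s \<in> {0..T}"
      have "(\<lambda>a. C s a - C t a) = (\<lambda>a. (C1 s a - C1 t a) - (C2 s a - C2 t a))"
        by (rule ext) (simp add: C_def algebra_simps)
      then show "b.nrm (\<lambda>a. C s a - C t a) \<le> ?e s"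
        using b.nrm_diff_le[OF fun_subspace_diff[OF L2_subspace C1(1)[OF s] C1(1)[OF t]]
            fun_subspace_diff[OF L2_subspace C2(1)[OF s] C2(1)[OF t]]] by simp
    qed
  qed
  \<comment> \<open>The properties that the version \<open>D0\<close> below must have at every time at which it does not vanish.\<close>
  define P where "P t \<longleftrightarrow> U1 t \<in> DGt \<and> U2 t \<in> DGt \<and> D t \<in> DG \<and>
    b.nrm (\<lambda>x. D t x - C t x) = 0" for t
  have P: "AE t in ?M. P t"
    using dom trace C1(3) C2(3) AE_space
  proof eventually_elim
    case (elim t)
    then have t: "t \<in> {0..T}" by simp
    have DG: "D t \<in> DG"
      unfolding D_def by (rule bottom_trace_diff_in_dom_G[OF elim(1,3,2,4)])
    note d1 = fun_subspace_diff[OF L2_subspace dom_GtD(2)[OF elim(1)] C1(1)[OF t]]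
    note d2 = fun_subspace_diff[OF L2_subspace dom_GtD(2)[OF elim(2)] C2(1)[OF t]]
    have "(\<lambda>x. D t x - C t x) = (\<lambda>x. (U1 t x - C1 t x) - (U2 t x - C2 t x))"
      by (rule ext) (simp add: C_def D_def algebra_simps)
    then have "b.nrm (\<lambda>x. D t x - C t x) \<le> 0"
      using b.nrm_diff_le[OF d1 d2] elim(5,6) by simp
    moreover have "0 \<le> b.nrm (\<lambda>x. D t x - C t x)"
      by (rule b.nrm_nonneg[OF fun_subspace_diff[OF L2_subspace dom_GtD(2)[OF dom_GD[OF DG]] CL[OF t]]])
    ultimately show ?case using elim(1,2) DG by (simp add: P_def)
  qed
  have Dsm: "strongly_measurable (DGt) E.nrm T D"
    unfolding D_def[abs_def] by (rule E.strongly_measurable_diff[OF sm])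
  obtain D0 s0 where D0: "AE t in ?M. D0 t = D t" "\<And>t. D0 t \<in> DGt"
    "\<And>k::nat. step_fun (DGt) T (s0 k)"
    "\<And>t. t \<in> {0<..<T} \<Longrightarrow> (\<lambda>k. E.nrm (\<lambda>x. D0 t x - s0 k t x)) \<longlonglongrightarrow> 0"
    "\<And>t. D0 t = (\<lambda>x. 0) \<or> (t \<in> {0<..<T} \<and> D0 t = D t \<and> P t)"
    by (rule strongly_measurable_regular_version[where p = E.nrm and P = P, OF dom_Gt_subspace E.nrm_zero Dsm P],
        rule that, assumption+)
  have alim: "(\<lambda>k. a.nrm (\<lambda>x. D0 t x - s0 k t x)) \<longlonglongrightarrow> 0" if t: "t \<in> {0<..<T}" for t
  proof (rule tendsto_sandwich[OF _ _ tendsto_const D0(4)[OF t]])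
    have d: "(\<lambda>x. D0 t x - s0 k t x) \<in> DGt" for k
      by (rule fun_subspace_diff[OF dom_Gt_subspace D0(2) step_fun_in[OF D0(3) t]])
    show "\<forall>\<^sub>F k in sequentially. 0 \<le> a.nrm (\<lambda>x. D0 t x - s0 k t x)"
      by (intro always_eventually allI a.nrm_nonneg d)
    show "\<forall>\<^sub>F k in sequentially. a.nrm (\<lambda>x. D0 t x - s0 k t x) \<le> E.nrm (\<lambda>x. D0 t x - s0 k t x)"
      by (intro always_eventually allI an d)
  qed
  define n where "n t = a.nrm (D0 t)" for t
  have n: "integrable ?M n"
    unfolding n_def
  proof (rule Bochner_Integration.integrable_bound)
    show "integrable ?M (\<lambda>t. 2 + (E.nrm (U1 t))\<^sup>2 + (E.nrm (U2 t))\<^sup>2)"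
      using U1L U2L by (simp add: L2_time_def)
    show "(\<lambda>t. a.nrm (D0 t)) \<in> borel_measurable ?M" by (rule a.kernel_measurable(2)[OF D0(2,3) alim])
    show "AE t in ?M. norm (a.nrm (D0 t)) \<le> norm (2 + (E.nrm (U1 t))\<^sup>2 + (E.nrm (U2 t))\<^sup>2)"
    proof (rule AE_I2)
      fix t
      have "a.nrm (D0 t) \<le> 2 + (E.nrm (U1 t))\<^sup>2 + (E.nrm (U2 t))\<^sup>2"
        using D0(5)[of t]
      proof
        assume "D0 t = (\<lambda>x. 0)"
        then show ?thesis by (simp add: a.nrm_zero)
      next
        assume t: "t \<in> {0<..<T} \<and> D0 t = D t \<and> P t"
        have "a.nrm (D0 t) \<le> E.nrm (D0 t)" by (rule an[OF D0(2)])
        also have "\<dots> \<le> E.nrm (U1 t) + E.nrm (U2 t)"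
          using t E.nrm_diff_le[of "U1 t" "U2 t"] by (simp add: P_def D_def)
        also have "\<dots> \<le> 2 + (E.nrm (U1 t))\<^sup>2 + (E.nrm (U2 t))\<^sup>2"
          using zero_le_power2[of "E.nrm (U1 t) - 1"] zero_le_power2[of "E.nrm (U2 t) - 1"]
            zero_le_power2[of "E.nrm (U1 t)"] zero_le_power2[of "E.nrm (U2 t)"]
          unfolding power2_diff power_one mult_1_right by linarith
        finally show ?thesis .
      qed
      then show "norm (a.nrm (D0 t)) \<le> norm (2 + (E.nrm (U1 t))\<^sup>2 + (E.nrm (U2 t))\<^sup>2)"
        using a.nrm_nonneg[OF D0(2)[of t]] by simp
    qed
  qed
  have eq: "AE \<tau> in ?M. \<forall>s\<in>{0..T}. bform (C s) (C \<tau>) = - prim T (prim T (\<lambda>r. aform (D0 r) (D0 \<tau>))) s"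
    using P D0(1) AE_space
  proof eventually_elim
    case (elim \<tau>)
    have DG: "D \<tau> \<in> DG" and \<tau>: "\<tau> \<in> {0..T}" using elim by (simp_all add: P_def)
    note DL = dom_GtD(2)[OF dom_GD[OF DG]]
    let ?h1 = "\<lambda>r. aform (U1 r) (D \<tau>)" and ?h2 = "\<lambda>r. aform (U2 r) (D \<tau>)"
    note h1 = C1(4)[OF DG] and h2 = C2(4)[OF DG]
    have pi: "integrable ?M (prim T k)" if "integrable ?M k" for k
      by (rule continuous_integrable_time, rule continuous_on_subset[OF prim_continuous[OF that]]) simp
    have "AE r in ?M. ?h1 r - ?h2 r = aform (D0 r) (D \<tau>)"
      using P D0(1)
      by eventually_elim (simp add: P_def D_def a.form_diff dom_GD[OF DG, unfolded D_def])
    moreover have "integrable ?M (\<lambda>r. aform (D0 r) (D \<tau>))"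
    proof (rule Bochner_Integration.integrable_bound)
      show "integrable ?M (\<lambda>r. n r * a.nrm (D \<tau>))" using n by simp
      show "(\<lambda>r. aform (D0 r) (D \<tau>)) \<in> borel_measurable ?M"
        by (rule lebesgue_on_AE_measurable[OF borel_measurable_diff[OF borel_measurable_integrable[OF h1]
              borel_measurable_integrable[OF h2]] _ calculation]) simp
      show "AE r in ?M. norm (aform (D0 r) (D \<tau>)) \<le> norm (n r * a.nrm (D \<tau>))"
      proof (rule AE_I2)
        fix r
        show "norm (aform (D0 r) (D \<tau>)) \<le> norm (n r * a.nrm (D \<tau>))"
          using order_trans[OF a.Cauchy_Schwarz[OF D0(2) dom_GD[OF DG]] abs_ge_self] by (simp add: n_def)
      qed
    qed
    ultimately have pd: "prim T (\<lambda>r. ?h1 r - ?h2 r) = prim T (\<lambda>r. aform (D0 r) (D \<tau>))"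
      by (intro ext prim_cong_AE Bochner_Integration.integrable_diff h1 h2)
    show ?case
    proof
      fix s assume s: "s \<in> {0..T}"
      have "bform (C s) (C \<tau>) = bform (C s) (D \<tau>)"
        using b.form_null_diff[OF DL CL[OF \<tau>] CL[OF s]] elim(1) b.form_sym[OF CL[OF s] DL] b.form_sym[OF CL[OF s] CL[OF \<tau>]]
        by (simp add: P_def)
      also have "\<dots> = bform (C1 s) (D \<tau>) - bform (C2 s) (D \<tau>)"
        unfolding C_def by (rule b.form_diff[OF C1(1)[OF s] C2(1)[OF s] DL])
      also have "\<dots> = - (prim T (prim T ?h1) s - prim T (prim T ?h2) s)"
        using C1(5)[OF DG s] C2(5)[OF DG s] by simp
      also have "\<dots> = - prim T (\<lambda>r. prim T ?h1 r - prim T ?h2 r) s"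
        by (simp only: prim_diff[OF pi[OF h1] pi[OF h2]])
      also have "(\<lambda>r. prim T ?h1 r - prim T ?h2 r) = prim T (\<lambda>r. ?h1 r - ?h2 r)"
        by (rule ext) (rule prim_diff[OF h1 h2, symmetric])
      finally show "bform (C s) (C \<tau>) = - prim T (prim T (\<lambda>r. aform (D0 r) (D0 \<tau>))) s"
        unfolding pd using elim(2) by simp
    qed
  qed
  have zero: "bform (C t) (C t) = 0" if "t \<in> {0..T}" for t
  proof (rule energy_identity_imp_zero[OF T, where A = "\<lambda>r \<tau>. aform (D0 r) (D0 \<tau>)" and n = n
        and B = "\<lambda>s t. bform (C s) (C t)"])
    show "(\<lambda>(r, \<tau>). aform (D0 r) (D0 \<tau>)) \<in> borel_measurable (?M \<Otimes>\<^sub>M ?M)"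
      by (rule a.kernel_measurable(1)[OF D0(2,3) alim])
    show "\<bar>aform (D0 s) (D0 t)\<bar> \<le> n s * n t" for s t unfolding n_def by (rule a.Cauchy_Schwarz[OF D0(2) D0(2)])
    show "aform (D0 s) (D0 t) = aform (D0 t) (D0 s)" for s t by (rule a.form_sym[OF D0(2) D0(2)])
    show "0 \<le> prim T (\<lambda>\<tau>. prim T (\<lambda>r. aform (D0 r) (D0 \<tau>)) t) t" for t
      by (rule a.kernel_nonneg[OF D0(2,3) alim n[unfolded n_def[abs_def]]])
    show "continuous_on ({0..T} \<times> {0..T}) (\<lambda>(s, t). bform (C s) (C t))"
      by (rule b.continuous_form[OF CL Ccont])
    show "bform (C s) (C t) = bform (C t) (C s)" if "s \<in> {0..T}" "t \<in> {0..T}" for s t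
      by (rule b.form_sym[OF CL[OF that(1)] CL[OF that(2)]])
    show "0 \<le> bform (C t) (C t)" if "t \<in> {0..T}" for t by (rule b.form_nonneg[OF CL[OF that]])
  qed (rule n eq that)+
  show ?thesis
    using P AE_space
  proof eventually_elim
    case (elim t)
    then have t: "t \<in> {0..T}" and DL: "D t \<in> L2 \<Omega>" using dom_GtD(2)[OF dom_GD] by (simp_all add: P_def)
    have "bform (D t) (D t) = bform (C t) (D t)"
      by (rule b.form_null_diff[OF DL CL[OF t] DL]) (use elim in \<open>simp add: P_def\<close>)
    also have "\<bar>\<dots>\<bar> \<le> b.nrm (C t) * b.nrm (D t)" by (rule b.Cauchy_Schwarz[OF CL[OF t] DL])
    also have "\<dots> = 0" using zero[OF t] by (simp add: b.nrm_def)
    finally have "bform (D t) (D t) = 0" by simp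
    from bform_definite[OF DL this] show ?case by eventually_elim (simp add: D_def)
  qed
qed

end

theorem theorem3p1:
  fixes H g T Hm R rho_m rho_p c_m c_p :: real
    and zb :: "real ^ 'n \<Rightarrow> real" and grad_zb :: "real ^ 'n \<Rightarrow> real ^ 'n"
    and rho c :: "real \<Rightarrow> real"
    and ub :: "real \<Rightarrow> ((real ^ 'n) \<times> real \<Rightarrow> real) \<Rightarrow> real"
    and U1 U2 :: "real \<Rightarrow> (real ^ 'n) \<times> real \<Rightarrow> (real ^ 'n) \<times> real"
  assumes "CARD('n) + 1 \<in> {2, 3}"
    and "H > 0" "g > 0" "T > 0"
    and "W1inf_with_grad zb grad_zb" "continuous_on UNIV zb"
    and "Hm > 0" "R > 0" "Hm < H"
    and "\<And>x. 0 \<le> zb x \<and> zb x \<le> Hm"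
    and "AE x in lebesgue. norm x \<ge> R \<longrightarrow> grad_zb x = 0"
    and "\<And>z. z \<in> {0..H} \<Longrightarrow> rho differentiable (at z within {0..H})"
    and "continuous_on {0..H} (\<lambda>z. vector_derivative rho (at z within {0..H}))"
    and "continuous_on {0..H} c"
    and "0 < rho_m" "\<And>z. z \<in> {0..H} \<Longrightarrow> rho_m \<le> rho z \<and> rho z \<le> rho_p"
    and "0 < c_m" "\<And>z. z \<in> {0..H} \<Longrightarrow> c_m \<le> c z \<and> c z \<le> c_p"
    and "\<And>z. z \<in> {0..H} \<Longrightarrow> N2 H g rho c z \<ge> 0"
    and "ub \<in> H2_time (Hmhalf zb) (Hmhalf_norm zb) T"
    and "is_solution H g T zb rho c ub U1"
    and "is_solution H g T zb rho c ub U2"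
  shows "AE t in lebesgue_on {0<..<T}. AE p in lebesgue_on (Dom H zb). U1 t p = U2 t p"
proof -
  interpret stratified_fluid H g Hm rho_m rho_p c_m c_p zb rho c
    by unfold_locales (use assms in blast)+
  show ?thesis by (rule solution_unique[OF assms(4,21,22)])
qed

end
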